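(* Let $d\in\mathbb{N}$ and $\rho_c=d\frac{N-1}{N+1}$. For any $N>2$, there exist constants $C_N^\pm$, depending only on $N$ and $d$, such that the number of negative-homogeneous elements satisfies $$C_N^-(\rho-\rho_c)^{3/2}\exp\Bigl\{\frac{\beta_Nd}{\rho-\rho_c}\Bigr\}\ \le\ c_F(N,d,\rho)\ \le\ C_N^+(\rho-\rho_c)^{3/2}\exp\Bigl\{\frac{\beta_Nd}{\rho-\rho_c}\Bigr\}$$ for $\rho_c<\rho\le2$, where $$\beta_N=\frac{2N^2}{(N+1)^2}\log(\alpha_N^{-1}).$$ In particular, $\beta_3=\frac98\log(\alpha_3^{-1})\approx1.164517$.
   Context: $c_F$ counts the negative-homogeneous elements of the model space associated with the SPDE $\partial_tu=\Delta^{\rho/2}u+f(u)+\xi$ on $\mathbb{T}^d$, $f$ a polynomial of degree $N$, $\xi$ space-time white noise. Precisely: scaling $\mathfrak{s}=(\rho,1,\dots,1)$, $|k|_{\mathfrak{s}}=\rho k_0+k_1+\dots+k_d$ for $k\in\mathbb{N}_0^{d+1}$, and $\alpha_0=-\frac{\rho+d}{2}-\kappa$, where $\kappa>0$ is a sufficiently small constant. Formal symbols are built from $\mathbf{1}$, $X_0,\dots,X_d$, $\Xi$ by a commutative associative product with unit $\mathbf{1}$ and a unary operation $\mathcal{I}_\rho$; $X^k=X_0^{k_0}\cdots X_d^{k_d}$. By convention $\mathcal{I}_\rho(X^k)=0$ for all $k$ (in particular $\mathcal{I}_\rho(\mathbf{1})=0$), and $0$ is not listed as a symbol. Set $\mathcal{W}_0=\mathcal{U}_0=\emptyset$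 and, for $m\ge1$, $$\mathcal{W}_m=\mathcal{W}_{m-1}\cup\{\Xi\}\cup\bigcup_{n=1}^N\{\tau_1\cdots\tau_n:\tau_i\in\mathcal{U}_{m-1}\},\qquad \mathcal{U}_m=\{X^k:k\in\mathbb{N}_0^{d+1}\}\cup\{\mathcal{I}_\rho(\tau):\tau\in\mathcal{W}_m\},$$ and $\mathcal{F}_F=\bigcup_{m\ge0}(\mathcal{W}_m\cup\mathcal{U}_m)$. The homogeneity is defined by $|\Xi|_{\mathfrak{s}}=\alpha_0$, $|X^k|_{\mathfrak{s}}=|k|_{\mathfrak{s}}$, $|\mathcal{I}_\rho(\tau)|_{\mathfrak{s}}=|\tau|_{\mathfrak{s}}+\rho$, $|\tau\bar\tau|_{\mathfrak{s}}=|\tau|_{\mathfrak{s}}+|\bar\tau|_{\mathfrak{s}}$, and $$c_F(N,d,\rho)=|\{\tau\in\mathcal{F}_F:|\tau|_{\mathfrak{s}}<0\}|.$$ A regular tree of degree $N$ is a rooted tree in which each vertex except the leaves has exactly $N$ children. $w_n^{(N)}$ denotes the number of non-homeomorphic (unordered) regular trees of degree $N$ with $n$ vertices, as analysed by Otter (The number of trees, 1948), with asymptotics $w_n^{(N)}\sim c_N(\alpha_N^{-1})^n/n^{3/2}$, where $\alpha_N$ is the radius of convergence of the generating series; in particular $\alpha_3\approx0.3551817$ and $\lim_{N\to\infty}\alpha_N\approx0.3383219$.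
   Formalization: The decimal is corrected: with α_N the radius of convergence of the series counting all n vertices, α_3³≈0.3551817 and 3β_3≈1.164517 (within 10^-6), so β_3≈0.388172; the printed α_3≈0.3551817 and β_3≈1.164517 contradict this definition and the two-sided bound. *)

theory Defs
  imports "HOL-Analysis.Analysis"
begin

section \<open>Symbols of the model space\<close>

text \<open>
  The formal symbols form the free commutative monoid over the generators \<open>X\<^sub>0, X\<^sub>1, \<dots>\<close>, \<open>\<Xi>\<close>
  and \<open>\<I>(\<tau>)\<close>. A symbol is therefore a finite multiset of generators: the product is the
  multiset sum and the unit symbol is \<open>{#}\<close>.
\<close>

datatype gen = X nat | Xi | I "gen multiset"

type_synonym symb = "gen multiset"

definition Xpow :: "nat \<Rightarrow> (nat \<Rightarrow> nat) \<Rightarrow> symb" where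
  "Xpow d k = (\<Sum>i\<le>d. replicate_mset (k i) (X i))"

text \<open>
  The convention \<open>\<I>(X\<^sup>k) = 0\<close>, with \<open>0\<close> not listed as a symbol, is rendered by applying \<open>\<I>\<close> only
  to symbols that are not of the form \<open>X\<^sup>k\<close>.
\<close>

function WW UU :: "nat \<Rightarrow> nat \<Rightarrow> nat \<Rightarrow> symb set" where
  "WW d N 0 = {}"
| "UU d N 0 = {}"
| "WW d N (Suc m) = WW d N m \<union> {{#Xi#}} \<union>
     (\<Union>n\<in>{1..N}. {(\<Sum>i=1..n. \<tau> i) |\<tau>. \<forall>i\<in>{1..n}. \<tau> i \<in> UU d N m})"
| "UU d N (Suc m) = range (Xpow d) \<union>
     {{#I \<tau>#} |\<tau>. \<tau> \<in> WW d N (Suc m) \<and> \<tau> \<notin> range (Xpow d)}"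
  by pat_completeness auto
termination
  by (relation "Wellfounded.measure (case_sum (\<lambda>(d, N, m). 2 * m) (\<lambda>(d, N, m). 2 * m + 1))") auto

definition FF :: "nat \<Rightarrow> nat \<Rightarrow> symb set" where
  "FF d N = (\<Union>m. WW d N m \<union> UU d N m)"

definition alpha0 :: "nat \<Rightarrow> real \<Rightarrow> real \<Rightarrow> real" where
  "alpha0 d \<rho> \<kappa> = - (\<rho> + real d) / 2 - \<kappa>"

primrec gen_hom :: "nat \<Rightarrow> real \<Rightarrow> real \<Rightarrow> gen \<Rightarrow> real" where
  "gen_hom d \<rho> \<kappa> (X i) = (if i = 0 then \<rho> else 1)"
| "gen_hom d \<rho> \<kappa> Xi = alpha0 d \<rho> \<kappa>"
| "gen_hom d \<rho> \<kappa> (I \<tau>) = sum_mset (image_mset (gen_hom d \<rho> \<kappa>) \<tau>) + \<rho>"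

definition homog :: "nat \<Rightarrow> real \<Rightarrow> real \<Rightarrow> symb \<Rightarrow> real" where
  "homog d \<rho> \<kappa> \<tau> = (\<Sum>g\<in>#\<tau>. gen_hom d \<rho> \<kappa> g)"

definition neg_symbols :: "nat \<Rightarrow> nat \<Rightarrow> real \<Rightarrow> real \<Rightarrow> symb set" where
  "neg_symbols N d \<rho> \<kappa> = {\<tau> \<in> FF d N. homog d \<rho> \<kappa> \<tau> < 0}"

definition c_F :: "nat \<Rightarrow> nat \<Rightarrow> real \<Rightarrow> real \<Rightarrow> nat" where
  "c_F N d \<rho> \<kappa> = card (neg_symbols N d \<rho> \<kappa>)"

definition rho_c :: "nat \<Rightarrow> nat \<Rightarrow> real" where
  "rho_c N d = real d * (real N - 1) / (real N + 1)"


section \<open>Regular trees\<close>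

text \<open>
  Unordered rooted trees up to isomorphism: a tree is the multiset of the subtrees at the
  children of its root.
\<close>

datatype utree = Node "utree multiset"

primrec vertices :: "utree \<Rightarrow> nat" where
  "vertices (Node M) = 1 + sum_mset (image_mset vertices M)"

inductive regular :: "nat \<Rightarrow> utree \<Rightarrow> bool" for N :: nat where
  leaf: "regular N (Node {#})"
| node: "size M = N \<Longrightarrow> \<forall>t\<in>#M. regular N t \<Longrightarrow> regular N (Node M)"

definition w :: "nat \<Rightarrow> nat \<Rightarrow> nat" where
  "w N n = card {t. regular N t \<and> vertices t = n}"

text \<open>
  Pitfall: \<^term>\<open>w N n\<close> counts \<^emph>\<open>all\<close> vertices, so it vanishes unless \<open>n \<equiv> 1 (mod N)\<close>. The
  constants tabulated by Otter (such as 0.3551817 for \<open>N = 3\<close>) are radii of the series in which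
  the same trees are counted by their non-leaf vertices; a regular tree with \<open>i\<close> non-leaf
  vertices has \<open>N i + 1\<close> vertices, so those constants are \<open>alphaR N ^ N\<close>.
\<close>

definition alphaR :: "nat \<Rightarrow> real" where
  "alphaR N = real_of_ereal (conv_radius (\<lambda>n. real (w N n)))"

definition betaR :: "nat \<Rightarrow> real" where
  "betaR N = 2 * real N ^ 2 / (real N + 1) ^ 2 * ln (1 / alphaR N)"

end

(* A negative symbol is, up to missing children and polynomial decorations, a regular tree whose leaves
   are the noises. With i non-leaf vertices its homogeneity is i (N+1) (rho - rho_c) / 2 - (rho + d) / 2
   up to kappa, and every defect costs a fixed positive amount near rho_c. So c_F counts essentially the
   regular trees with i <= 2 d N / ((N+1)^2 (rho - rho_c)), and defective symbols, which live below a
   fixed smaller fraction of this threshold, are exponentially rarer.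

   For the number of regular trees, Polya's recursion T(z) = 1 + z h_N(T(z), T(z^2), ...) determines the
   singularity of T: with R = z h_{N-1} and G = 1 / (1 - R) one has T' = S G and R' = Q + P G, where S, P
   and Q only involve bounded quantities. Criticality is R = 1 at the radius a, whence
   (1 - R)^2 ~ c (a - z), and T''' = 3 S P^2 G^5 + O(G^4) is (1 - z/a)^(-5/2) up to an error
   O(|1 - z/a|^(-2)) on the open disc, without any analytic continuation. The Cauchy formula and the Poisson
   integral then give the coefficients with relative error O(n^(-1/2)).

   The numerical value for N = 3 follows from a supersolution of the recursion below the radius and from
   lower bounds for T(z^2), T(z^3) above it. *)

theory Submission
  imports Defs "HOL-Complex_Analysis.Complex_Analysis" "HOL-Real_Asymp.Real_Asymp"
begin

section \<open>Regular trees and forests\<close>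

text \<open>The obstacle in the upper bound is that one tree carries exponentially many defective
  symbols. Giving each missing child and each polynomial factor the weight u, the weighted number of
  symbols on a tree is at most \<open>vfac d N u\<close> to the number of vertices, a base that
  tends to 1 with u. A fixed small u makes the entropy of the defects smaller than the exponential
  loss caused by a single defect; as the number of defects is bounded, removing the weights costs
  only a constant. Three derivatives are taken because estimates confined to the open disc lose too
  much on T' itself: its bounded error would give coefficients O(1) against a main term n^(-1/2),
  whereas O(n) against n^(3/2) is harmless, and the exponent 2 of the error is exactly that of the
  Poisson kernel. The constant \<kappa> is chosen after \<rho>: negative trees have up to the order
  of 1 / (\<rho> - rho_c) non-leaf vertices, each of which contributes a multiple of \<kappa>. Trees
  are counted by non-leaf vertices, since counting all vertices would make the series periodic with
  period N.\<close>

primrec inodes :: "utree \<Rightarrow> nat" where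
  "inodes (Node M) = (if M = {#} then 0 else Suc (\<Sum>\<^sub># (image_mset inodes M)))"

definition weight :: "utree multiset \<Rightarrow> nat" where
  "weight M = (\<Sum>t\<in>#M. inodes t)"

definition forests :: "nat \<Rightarrow> nat \<Rightarrow> nat \<Rightarrow> utree multiset set" where
  "forests N k n = {M. size M = k \<and> (\<forall>t\<in>#M. regular N t) \<and> weight M = n}"

definition fcount :: "nat \<Rightarrow> nat \<Rightarrow> nat \<Rightarrow> nat" where
  "fcount N k n = card (forests N k n)"

definition trees :: "nat \<Rightarrow> nat \<Rightarrow> utree set" where
  "trees N n = {t. regular N t \<and> inodes t = n}"

definition tcount :: "nat \<Rightarrow> nat \<Rightarrow> nat" where
  "tcount N n = card (trees N n)"

lemma regular_Node_iff:
  "regular N (Node M) \<longleftrightarrow> M = {#} \<or> size M = N \<and> (\<forall>t\<in>#M. regular N t)"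
  by (auto intro: regular.intros elim: regular.cases)

lemma vertices_eq_inodes:
  assumes "regular N t"
  shows "vertices t = N * inodes t + 1"
  using assms
proof (induction rule: regular.induct)
  case (node M)
  have "(\<Sum>t\<in>#M. vertices t) = (\<Sum>t\<in>#M. N * inodes t + 1)"
    using node by (intro arg_cong[of _ _ sum_mset] image_mset_cong) auto
  also have "\<dots> = N * (\<Sum>t\<in>#M. inodes t) + size M"
    by (induction M) (simp_all add: algebra_simps)
  finally show ?case using node by auto
qed simp

lemma finite_multisets_of_size: "finite A \<Longrightarrow> finite {M. set_mset M \<subseteq> A \<and> size M = k}"
proof -
  assume "finite A"
  have "{M. set_mset M \<subseteq> A \<and> size M = k} \<subseteq> mset ` {xs. set xs \<subseteq> A \<and> length xs = k}"
  proof
    fix M assume "M \<in> {M. set_mset M \<subseteq> A \<and> size M = k}"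
    moreover obtain xs where "M = mset xs" using ex_mset by metis
    ultimately show "M \<in> mset ` {xs. set xs \<subseteq> A \<and> length xs = k}" by auto
  qed
  then show ?thesis using finite_lists_length_eq[OF \<open>finite A\<close>] finite_surj by blast
qed

lemma inodes_le_weight: "t \<in># M \<Longrightarrow> inodes t \<le> weight M"
  unfolding weight_def by (induction M) auto

lemma finite_trees: "finite (trees N n)"
proof (induction n rule: less_induct)
  case (less n)
  let ?A = "\<Union>m<n. trees N m"
  have sub: "trees N n \<subseteq> insert (Node {#}) (Node ` {M. set_mset M \<subseteq> ?A \<and> size M = N})"
  proof
    fix t assume t: "t \<in> trees N n"
    obtain M where M: "t = Node M" by (cases t)
    show "t \<in> insert (Node {#}) (Node ` {M. set_mset M \<subseteq> ?A \<and> size M = N})"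
    proof (cases "M = {#}")
      case False
      then have "n = Suc (weight M)" "size M = N" "\<forall>t\<in>#M. regular N t"
        using t M by (auto simp: trees_def regular_Node_iff weight_def)
      then have "set_mset M \<subseteq> ?A"
        using inodes_le_weight[of _ M] by (auto simp: trees_def less_Suc_eq_le)
      then show ?thesis using M \<open>size M = N\<close> by auto
    qed (use M in auto)
  qed
  have "finite {M. set_mset M \<subseteq> ?A \<and> size M = N}"
    using less by (intro finite_multisets_of_size) auto
  then show ?case
    by (intro finite_subset[OF sub] finite.insertI finite_imageI)
qed

lemma finite_forests: "finite (forests N k n)"
proof -
  have "forests N k n \<subseteq> {M. set_mset M \<subseteq> (\<Union>m\<le>n. trees N m) \<and> size M = k}"
    by (auto simp: forests_def trees_def dest: inodes_le_weight)
  then show ?thesis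
    by (rule finite_subset) (auto intro!: finite_multisets_of_size finite_trees)
qed

lemma trees_0: "trees N 0 = {Node {#}}"
proof -
  have "t = Node {#}" if "regular N t" "inodes t = 0" for t
    using that by (cases t) (auto split: if_splits)
  moreover have "regular N (Node {#})" by (rule regular.leaf)
  moreover have "inodes (Node {#}) = 0" by simp
  ultimately show ?thesis unfolding trees_def by blast
qed

lemma tcount_0 [simp]: "tcount N 0 = 1"
  by (simp add: tcount_def trees_0)

lemma trees_Suc:
  assumes "N \<ge> 1"
  shows "trees N (Suc n) = Node ` forests N N n"
proof -
  have "t \<in> Node ` forests N N n" if "t \<in> trees N (Suc n)" for t
    using that by (cases t) (auto simp: trees_def forests_def weight_def regular_Node_iff split: if_splits)
  moreover have "Node M \<in> trees N (Suc n)" if "M \<in> forests N N n" for M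
    using that assms by (auto simp: trees_def forests_def weight_def regular_Node_iff)
  ultimately show ?thesis by auto
qed

lemma tcount_Suc: "N \<ge> 1 \<Longrightarrow> tcount N (Suc n) = fcount N N n"
  unfolding tcount_def fcount_def trees_Suc
  by (simp add: card_image inj_on_def)

lemma fcount_0: "fcount N 0 n = (if n = 0 then 1 else 0)"
proof -
  have "forests N 0 n = (if n = 0 then {{#}} else {})" by (auto simp: forests_def weight_def)
  then show ?thesis by (simp add: fcount_def)
qed

lemma weight_replicate_add: "weight (M + replicate_mset j t) = weight M + j * inodes t"
  by (simp add: weight_def)

text \<open>Deleting \<open>j\<close> copies of \<open>t\<close> is a bijection onto the forests of
  \<open>k - j\<close> trees with the remaining weight. The case distinction matters: for
  \<open>j * inodes t > n\<close> truncated subtraction could produce a nonzero count.\<close>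

lemma card_forests_count_ge:
  assumes "regular N t" "j \<le> k" "j \<ge> 1"
  shows "card {M \<in> forests N k n. j \<le> count M t}
     = (if j * inodes t \<le> n then fcount N (k - j) (n - j * inodes t) else 0)"
proof (cases "j * inodes t \<le> n")
  case True
  have "bij_betw (\<lambda>M. M + replicate_mset j t) (forests N (k - j) (n - j * inodes t))
      {M \<in> forests N k n. j \<le> count M t}"
  proof (rule bij_betwI[where g = "\<lambda>M. M - replicate_mset j t"])
    show "(\<lambda>M. M + replicate_mset j t) \<in> forests N (k - j) (n - j * inodes t) \<rightarrow> {M \<in> forests N k n. j \<le> count M t}"
      using assms True by (auto simp: forests_def weight_replicate_add)
    show "(\<lambda>M. M - replicate_mset j t) \<in> {M \<in> forests N k n. j \<le> count M t} \<rightarrow> forests N (k - j) (n - j * inodes t)"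
    proof
      fix M assume M: "M \<in> {M \<in> forests N k n. j \<le> count M t}"
      then have "replicate_mset j t \<subseteq># M" by (simp add: count_le_replicate_mset_subset_eq)
      then obtain M' where "M = M' + replicate_mset j t"
        by (metis subset_mset.diff_add)
      then show "M - replicate_mset j t \<in> forests N (k - j) (n - j * inodes t)"
        using M by (auto simp: forests_def weight_replicate_add)
    qed
    show "M + replicate_mset j t - replicate_mset j t = M" for M by simp
    show "M - replicate_mset j t + replicate_mset j t = M" if "M \<in> {M \<in> forests N k n. j \<le> count M t}" for M
      using that by (simp add: count_le_replicate_mset_subset_eq)
  qed
  from bij_betw_same_card[OF this] show ?thesis using True by (simp add: fcount_def)
next
  case False
  have "M \<notin> forests N k n" if "j \<le> count M t" for M
  proof
    assume M: "M \<in> forests N k n"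
    have "replicate_mset j t \<subseteq># M" using that by (simp add: count_le_replicate_mset_subset_eq)
    then obtain M' where "M = M' + replicate_mset j t" by (metis subset_mset.diff_add)
    then show False using M False by (auto simp: forests_def weight_replicate_add)
  qed
  then have "{M \<in> forests N k n. j \<le> count M t} = {}" by blast
  then have "card {M \<in> forests N k n. j \<le> count M t} = 0" by (metis card.empty)
  then show ?thesis using False by simp
qed

text \<open>Double counting of pairs of a forest and one of its trees: the multiplicity of
  \<open>t\<close> is the number of \<open>j \<ge> 1\<close> with \<open>j \<le> count M t\<close>,
  and for each such \<open>j\<close> the copies are deleted. This is Newton's identity between
  complete symmetric functions and power sums, so Polya enumeration is obtained without any group
  action.\<close>

lemma fcount_newton:
  "k * fcount N k n =
     (\<Sum>j=1..k. \<Sum>m | m \<le> n \<and> j * m \<le> n. tcount N m * fcount N (k - j) (n - j * m))"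
proof -
  let ?A = "forests N k n" and ?T = "\<Union>m\<le>n. trees N m"
  have fT: "finite ?T" using finite_trees by blast
  have "k * fcount N k n = (\<Sum>M\<in>?A. size M)"
    by (simp add: fcount_def forests_def)
  also have "\<dots> = (\<Sum>M\<in>?A. \<Sum>t\<in>?T. \<Sum>j=1..k. if j \<le> count M t then 1 else 0)"
  proof (rule sum.cong[OF refl])
    fix M assume M: "M \<in> ?A"
    then have sub: "set_mset M \<subseteq> ?T" by (auto simp: forests_def trees_def dest: inodes_le_weight)
    have "(\<Sum>j=1..k. if j \<le> count M t then 1 else 0) = count M t" for t
    proof -
      have "count M t \<le> k" using M by (auto simp: forests_def count_le_size)
      then have "{1..k} \<inter> {j. j \<le> count M t} = {1..count M t}" by auto
      then show ?thesis by (simp add: sum.If_cases)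
    qed
    moreover have "size M = (\<Sum>t\<in>?T. count M t)"
      unfolding size_multiset_overloaded_eq
      by (rule sum.mono_neutral_left[OF fT sub]) (auto simp: not_in_iff)
    ultimately show "size M = (\<Sum>t\<in>?T. \<Sum>j=1..k. if j \<le> count M t then 1 else 0)" by simp
  qed
  also have "\<dots> = (\<Sum>t\<in>?T. \<Sum>M\<in>?A. \<Sum>j=1..k. if j \<le> count M t then 1 else 0)"
    by (rule sum.swap)
  also have "\<dots> = (\<Sum>t\<in>?T. \<Sum>j=1..k. \<Sum>M\<in>?A. if j \<le> count M t then 1 else 0)"
    by (intro sum.cong refl sum.swap)
  also have "\<dots> = (\<Sum>j=1..k. \<Sum>t\<in>?T. \<Sum>M\<in>?A. if j \<le> count M t then 1 else 0)"
    by (rule sum.swap)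
  also have "\<dots> = (\<Sum>j=1..k. \<Sum>t\<in>?T.
      if j * inodes t \<le> n then fcount N (k - j) (n - j * inodes t) else 0)"
  proof (intro sum.cong refl)
    fix j t assume "j \<in> {1..k}" "t \<in> ?T"
    then have "card {M \<in> ?A. j \<le> count M t}
      = (if j * inodes t \<le> n then fcount N (k - j) (n - j * inodes t) else 0)"
      by (intro card_forests_count_ge) (auto simp: trees_def)
    then show "(\<Sum>M\<in>?A. if j \<le> count M t then 1 else 0)
      = (if j * inodes t \<le> n then fcount N (k - j) (n - j * inodes t) else 0)"
      by (simp add: sum.If_cases finite_forests Int_def)
  qed
  also have "\<dots> = (\<Sum>j=1..k. \<Sum>m\<le>n. \<Sum>t\<in>trees N m.
      if j * inodes t \<le> n then fcount N (k - j) (n - j * inodes t) else 0)"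
    by (intro sum.cong refl sum.UNION_disjoint) (auto simp: finite_trees, auto simp: trees_def)
  also have "\<dots> = (\<Sum>j=1..k. \<Sum>m\<le>n. if j * m \<le> n then tcount N m * fcount N (k - j) (n - j * m) else 0)"
    by (intro sum.cong refl) (auto simp: tcount_def trees_def)
  also have "\<dots> = (\<Sum>j=1..k. \<Sum>m | m \<le> n \<and> j * m \<le> n. tcount N m * fcount N (k - j) (n - j * m))"
    by (rule sum.cong[OF refl]) (simp add: sum.If_cases Int_def)
  finally show ?thesis .
qed

lemma w_tcount: "N \<ge> 1 \<Longrightarrow> w N (N * n + 1) = tcount N n"
  unfolding w_def tcount_def trees_def
  by (intro arg_cong[of _ _ card]) (auto simp: vertices_eq_inodes)

lemma w_eq_0: "(\<And>i. n \<noteq> N * i + 1) \<Longrightarrow> w N n = 0"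
proof -
  assume "\<And>i. n \<noteq> N * i + 1"
  then have "{t. regular N t \<and> vertices t = n} = {}" using vertices_eq_inodes by blast
  then show ?thesis unfolding w_def by (metis card.empty)
qed

text \<open>One tree and \<open>N - 1\<close> leaves grafted on a new root add exactly one non-leaf
  vertex. Positivity of the coefficients forces divergence at 1 and, through
  \<open>tcount N 1\<close>, yields aperiodicity.\<close>

lemma tcount_pos: 
  assumes "N \<ge> 1" shows "tcount N n \<ge> 1"
proof (induction n)
  case (Suc n)
  then obtain t where t: "regular N t" "inodes t = n"
    unfolding tcount_def trees_def by (metis (mono_tags, lifting) card.empty empty_Collect_eq not_one_le_zero)
  let ?s = "Node (add_mset t (replicate_mset (N - 1) (Node {#})))"
  have "?s \<in> trees N (Suc n)"
    using t assms by (auto simp: trees_def regular_Node_iff in_replicate_mset)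
  then show ?case unfolding tcount_def
    using finite_trees by (metis One_nat_def Suc_leI card_gt_0_iff empty_iff)
qed simp

section \<open>The Newton recursion for complete homogeneous symmetric functions\<close>

text \<open>\<open>newton s k\<close> is the complete homogeneous symmetric function of degree \<open>k\<close> expressed in the power
  sums \<open>s 1, s 2, \<dots>\<close>, that is, the cycle index of the symmetric group.\<close>

fun newton :: "(nat \<Rightarrow> 'a::field_char_0) \<Rightarrow> nat \<Rightarrow> 'a" where
  "newton s 0 = 1"
| "newton s (Suc k) = (\<Sum>j\<le>k. s (Suc j) * newton s (k - j)) / of_nat (Suc k)"

declare newton.simps(2) [simp del]

lemma newton_rec: "of_nat k * newton s k = (\<Sum>j=1..k. s j * newton s (k - j))"
proof (cases k)
  case (Suc n)
  have "of_nat (Suc n) * newton s (Suc n) = (\<Sum>j\<le>n. s (Suc j) * newton s (n - j))"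
    by (simp add: newton.simps(2) del: of_nat_Suc)
  also have "\<dots> = (\<Sum>j=1..Suc n. s j * newton s (Suc n - j))"
    using sum.shift_bounds_cl_Suc_ivl[of "\<lambda>j. s j * newton s (Suc n - j)" 0 n]
    by (simp add: atMost_atLeast0)
  finally show ?thesis using Suc by simp
qed simp

text \<open>The recursion is assumed only up to \<open>K\<close>, because power sums are often
  compared only for \<open>j \<le> k\<close>.\<close>

lemma newton_unique:
  assumes "H 0 = 1" and "\<And>k. k \<le> K \<Longrightarrow> of_nat k * H k = (\<Sum>j=1..k. s j * H (k - j))"
  shows "k \<le> K \<Longrightarrow> H k = newton s k"
proof (induction k rule: less_induct)
  case (less k)
  show ?case
  proof (cases "k = 0")
    case False
    have "of_nat k * H k = (\<Sum>j=1..k. s j * newton s (k - j))"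
      unfolding assms(2)[OF less.prems] using less by (intro sum.cong) auto
    then show ?thesis using newton_rec[of k s] False by (metis mult_cancel_left of_nat_eq_0_iff)
  qed (use assms in simp)
qed

lemma newton_cong:
  assumes "\<And>j. 1 \<le> j \<Longrightarrow> j \<le> k \<Longrightarrow> s j = s' j"
  shows "newton s k = newton s' k"
proof -
  have "newton s i = newton s' i" if "i \<le> k" for i
    using that
  proof (rule newton_unique[where K=k, rotated 2])
    fix i assume "i \<le> k"
    then show "of_nat i * newton s i = (\<Sum>j = 1..i. s' j * newton s (i - j))"
      unfolding newton_rec using assms by (intro sum.cong) auto
  qed simp
  then show ?thesis by simp
qed

text \<open>Formally, the generating series of \<open>newton s k\<close> is the exponential of the
  sum of \<open>s j\<close> t^j / j, and differentiation multiplies it by the sum of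
  \<open>s' j\<close> t^j / j. Here the formula is extracted from the differentiated recursion, with
  \<open>D\<close> in the place of the derivative.\<close>

lemma newton_deriv_unique:
  fixes s :: "nat \<Rightarrow> 'a::field_char_0"
  assumes "D 0 = 0"
    and "\<And>k. k \<le> K \<Longrightarrow> of_nat k * D k = (\<Sum>j=1..k. s' j * newton s (k - j) + s j * D (k - j))"
  shows "k \<le> K \<Longrightarrow> D k = (\<Sum>j=1..k. s' j / of_nat j * newton s (k - j))"
proof (induction k rule: less_induct)
  case (less k)
  let ?h = "newton s"
  show ?case
  proof (cases "k = 0")
    case False
    have "(\<Sum>j=1..k. s j * D (k - j))
        = (\<Sum>j=1..k. \<Sum>i | i \<in> {1..k} \<and> i + j \<le> k. s' i / of_nat i * (s j * ?h (k - i - j)))"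
    proof (rule sum.cong[OF refl])
      fix j assume j: "j \<in> {1..k}"
      then have set: "{i. i \<in> {1..k} \<and> i + j \<le> k} = {1..k - j}" by auto
      have "D (k - j) = (\<Sum>i=1..k-j. s' i / of_nat i * ?h (k - j - i))"
        using j less by simp
      then show "s j * D (k - j) = (\<Sum>i | i \<in> {1..k} \<and> i + j \<le> k. s' i / of_nat i * (s j * ?h (k - i - j)))"
        unfolding set by (simp add: sum_distrib_left mult_ac add.commute)
    qed
    \<comment> \<open>Exchanging the sums turns the inner one into the recursion for degree
      \<open>k - i\<close>; the weights \<open>i\<close> and \<open>k - i\<close> then add up to the
      factor \<open>k\<close>.\<close>
    also have "\<dots> = (\<Sum>i=1..k. \<Sum>j | j \<in> {1..k} \<and> i + j \<le> k. s' i / of_nat i * (s j * ?h (k - i - j)))"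
      by (rule sum.swap_restrict) auto
    also have "\<dots> = (\<Sum>i=1..k. s' i / of_nat i * (of_nat (k - i) * ?h (k - i)))"
    proof (rule sum.cong[OF refl])
      fix i assume i: "i \<in> {1..k}"
      then have set: "{j. j \<in> {1..k} \<and> i + j \<le> k} = {1..k - i}" by auto
      show "(\<Sum>j | j \<in> {1..k} \<and> i + j \<le> k. s' i / of_nat i * (s j * ?h (k - i - j)))
        = s' i / of_nat i * (of_nat (k - i) * ?h (k - i))"
        unfolding set newton_rec by (simp add: sum_distrib_left mult_ac)
    qed
    finally have "of_nat k * D k
        = (\<Sum>i=1..k. s' i * ?h (k - i) + s' i / of_nat i * (of_nat (k - i) * ?h (k - i)))"
      using assms(2)[OF less.prems] by (simp add: sum.distrib)
    also have "\<dots> = (\<Sum>i=1..k. of_nat k * (s' i / of_nat i * ?h (k - i)))"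
      by (intro sum.cong refl) (auto simp: field_simps of_nat_diff)
    also have "\<dots> = of_nat k * (\<Sum>i=1..k. s' i / of_nat i * ?h (k - i))"
      by (simp add: sum_distrib_left)
    finally show ?thesis using False by (metis mult_cancel_left of_nat_eq_0_iff)
  qed (use assms in simp)
qed

lemma newton_has_field_derivative:
  fixes s :: "nat \<Rightarrow> 'a::real_normed_field \<Rightarrow> 'a"
  assumes "\<And>j. 1 \<le> j \<Longrightarrow> j \<le> k \<Longrightarrow> (s j has_field_derivative s' j) (at z within A)"
  shows "((\<lambda>z. newton (\<lambda>j. s j z) k) has_field_derivative
           (\<Sum>j=1..k. s' j / of_nat j * newton (\<lambda>j. s j z) (k - j))) (at z within A)"
proof -
  let ?h = "\<lambda>k z. newton (\<lambda>j. s j z) k"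
  have ex: "\<exists>D. (?h i has_field_derivative D) (at z within A)" if "i \<le> k" for i
    using that
  proof (induction i rule: less_induct)
    case (less i)
    show ?case
    proof (cases i)
      case (Suc n)
      have "\<exists>D. \<forall>j\<le>n. (?h (n - j) has_field_derivative D j) (at z within A)"
        using less Suc by (intro choice) (metis diff_le_self le_imp_less_Suc le_trans less_imp_le)
      then obtain D where D: "\<And>j. j \<le> n \<Longrightarrow> (?h (n - j) has_field_derivative D j) (at z within A)"
        by blast
      have nz: "(of_nat (Suc n) :: 'a) \<noteq> 0" by (rule of_nat_neq_0)
      show ?thesis unfolding Suc newton.simps(2) using less.prems Suc nz
        by (auto intro!: exI derivative_eq_intros D assms simp del: of_nat_Suc)
    qed (auto intro!: exI derivative_intros)
  qed
  define D where "D i = (SOME d. (?h i has_field_derivative d) (at z within A))" for i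
  have D: "(?h i has_field_derivative D i) (at z within A)" if "i \<le> k" for i
    unfolding D_def using someI_ex[OF ex[OF that]] .
  \<comment> \<open>Differentiability is known by induction, and the value follows from uniqueness
    of derivatives. Uniqueness is available unless \<open>z\<close> is no limit point of
    \<open>A\<close>, in which case every value is a derivative.\<close>
  show ?thesis
  proof (cases "at z within A = bot")
    case True
    then show ?thesis by (simp add: has_field_derivative_iff)
  next
    case nb: False
    have uniq: "d = d'" if "(f has_field_derivative d) (at z within A)" "(f has_field_derivative d') (at z within A)"
      for f :: "'a \<Rightarrow> 'a" and d d'
      using that nb unfolding has_field_derivative_iff by (rule tendsto_unique[rotated])
    have D0: "D 0 = 0"
      by (rule uniq[OF D]) auto
    have "of_nat i * D i = (\<Sum>j=1..i. s' j * ?h (i - j) z + s j z * D (i - j))" if "i \<le> k" for i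
    proof (rule uniq)
      show "((\<lambda>z. of_nat i * ?h i z) has_field_derivative of_nat i * D i) (at z within A)"
        by (rule DERIV_cmult[OF D[OF that]])
      show "((\<lambda>z. of_nat i * ?h i z) has_field_derivative
          (\<Sum>j=1..i. s' j * ?h (i - j) z + s j z * D (i - j))) (at z within A)"
        unfolding newton_rec using that by (auto intro!: derivative_eq_intros D assms sum.cong)
    qed
    from newton_deriv_unique[where K=k, OF D0 this, of k] show ?thesis using D[of k] by simp
  qed
qed

lemma continuous_on_newton:
  fixes s :: "nat \<Rightarrow> 'b::topological_space \<Rightarrow> 'a::real_normed_field"
  assumes "\<And>j. 1 \<le> j \<Longrightarrow> j \<le> k \<Longrightarrow> continuous_on A (s j)"
  shows "continuous_on A (\<lambda>z. newton (\<lambda>j. s j z) k)"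
  using assms
proof (induction k rule: less_induct)
  case (less k)
  have nz: "(of_nat (Suc n) :: 'a) \<noteq> 0" for n by (rule of_nat_neq_0)
  from less nz show ?case
    by (cases k) (auto simp: newton.simps(2) intro!: continuous_intros simp del: of_nat_Suc)
qed

lemma newton_nonneg:
  fixes s :: "nat \<Rightarrow> real"
  assumes "\<And>j. 1 \<le> j \<Longrightarrow> j \<le> k \<Longrightarrow> 0 \<le> s j"
  shows "0 \<le> newton s k"
  using assms
proof (induction k rule: less_induct)
  case (less k)
  then show ?case
    by (cases k) (auto simp: newton.simps(2) intro!: sum_nonneg divide_nonneg_nonneg mult_nonneg_nonneg)
qed

lemma newton_mono:
  fixes s s' :: "nat \<Rightarrow> real"
  assumes "\<And>j. 1 \<le> j \<Longrightarrow> j \<le> k \<Longrightarrow> 0 \<le> s j" "\<And>j. 1 \<le> j \<Longrightarrow> j \<le> k \<Longrightarrow> s j \<le> s' j"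
  shows "newton s k \<le> newton s' k"
  using assms
proof (induction k rule: less_induct)
  case (less k)
  have nn: "0 \<le> newton s i" if "i \<le> k" for i using less.prems that by (intro newton_nonneg) auto
  show ?case
  proof (cases k)
    case (Suc n)
    have "s (Suc j) * newton s (n - j) \<le> s' (Suc j) * newton s' (n - j)" if "j \<le> n" for j
    proof (intro mult_mono)
      show "newton s (n - j) \<le> newton s' (n - j)"
        using less Suc that by auto
      show "0 \<le> s' (Suc j)" using less.prems[of "Suc j"] Suc that by force
    qed (use nn less.prems Suc that in auto)
    then show ?thesis unfolding Suc newton.simps(2) by (intro divide_right_mono sum_mono) auto
  qed simp
qed

lemma norm_newton_le:
  fixes s :: "nat \<Rightarrow> 'a::real_normed_field"
  shows "norm (newton s k) \<le> newton (\<lambda>j. norm (s j)) k"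
proof (induction k rule: less_induct)
  case (less k)
  show ?case
  proof (cases k)
    case (Suc n)
    have "norm (\<Sum>j\<le>n. s (Suc j) * newton s (n - j)) \<le> (\<Sum>j\<le>n. norm (s (Suc j)) * newton (\<lambda>j. norm (s j)) (n - j))"
      using less Suc by (intro sum_norm_le) (auto simp: norm_mult intro!: mult_left_mono)
    then show ?thesis unfolding Suc newton.simps(2)
      by (simp add: norm_divide divide_right_mono del: of_nat_Suc)
  qed simp
qed

lemma newton_of_real: "newton (\<lambda>j. of_real (s j)) k = (of_real (newton s k) :: 'a::real_normed_field)"
proof -
  have "of_real (newton s k) = newton (\<lambda>j. of_real (s j) :: 'a) k"
  proof (rule newton_unique[where K=k])
    fix i assume "i \<le> k"
    have "of_real (of_nat i * newton s i) = (\<Sum>j = 1..i. of_real (s j) * of_real (newton s (i - j)) :: 'a)"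
      unfolding newton_rec by simp
    then show "of_nat i * of_real (newton s i) = (\<Sum>j = 1..i. of_real (s j) * of_real (newton s (i - j)) :: 'a)"
      by simp
  qed auto
  then show ?thesis by simp
qed

text \<open>Only the term \<open>j = 1\<close> is kept at each step of the recursion: the identity
  permutation in the cycle index. This supplies the growth of degree \<open>N\<close> that keeps the
  tree series bounded up to its radius.\<close>

lemma newton_ge_power:
  fixes s :: "nat \<Rightarrow> real"
  assumes "\<And>j. 1 \<le> j \<Longrightarrow> j \<le> k \<Longrightarrow> 0 \<le> s j"
  shows "newton s k \<ge> s 1 ^ k / fact k"
  using assms
proof (induction k)
  case (Suc k)
  have nn: "0 \<le> newton s i" if "i \<le> Suc k" for i using Suc.prems that by (intro newton_nonneg) auto
  have "s 1 * (s 1 ^ k / fact k) \<le> s 1 * newton s k"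
    using Suc by (intro mult_left_mono) auto
  also have "\<dots> \<le> (\<Sum>j\<le>k. s (Suc j) * newton s (k - j))"
    using member_le_sum[of 0 "{..k}" "\<lambda>j. s (Suc j) * newton s (k - j)"] Suc.prems nn by auto
  finally have "s 1 * (s 1 ^ k / fact k) / of_nat (Suc k) \<le> newton s (Suc k)"
    unfolding newton.simps(2) by (rule divide_right_mono) simp
  then show ?case by (simp add: field_simps)
qed simp

text \<open>Quantitative monotonicity in the first power sum: in the difference of the two
  recursions all terms are nonnegative, and the one with \<open>j = 1\<close> is kept. It carries
  the aperiodicity gap from the tree series over to \<open>R\<close>.\<close>

lemma newton_increment:
  fixes s s' :: "nat \<Rightarrow> real"
  assumes "\<And>j. 1 \<le> j \<Longrightarrow> j \<le> k \<Longrightarrow> 0 \<le> s j" "\<And>j. 1 \<le> j \<Longrightarrow> j \<le> k \<Longrightarrow> s j \<le> s' j" "k \<ge> 1"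
  shows "newton s k + (s' 1 - s 1) / real k * newton s' (k - 1) \<le> newton s' k"
proof -
  have s': "0 \<le> s' j" if "1 \<le> j" "j \<le> k" for j using assms that order_trans by blast
  have "real k * newton s k + (s' 1 - s 1) * newton s' (k - 1)
      = (s' 1 - s 1) * newton s' (k - 1) + (\<Sum>j=1..k. s j * newton s (k - j))"
    by (simp add: newton_rec)
  also have "\<dots> \<le> (s' 1 - s 1) * newton s' (k - 1) + (\<Sum>j=1..k. s j * newton s' (k - j))"
    using assms by (intro add_left_mono sum_mono mult_left_mono newton_mono) auto
  also have "\<dots> \<le> (\<Sum>j=1..k. (s' j - s j) * newton s' (k - j)) + (\<Sum>j=1..k. s j * newton s' (k - j))"
  proof (intro add_right_mono member_le_sum[of 1 "{1..k}" "\<lambda>j. (s' j - s j) * newton s' (k - j)"])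
    fix j assume "j \<in> {1..k} - {1}"
    then show "0 \<le> (s' j - s j) * newton s' (k - j)"
      using assms s' by (intro mult_nonneg_nonneg newton_nonneg) auto
  qed (use assms in auto)
  also have "\<dots> = real k * newton s' k"
    by (simp add: newton_rec sum.distrib[symmetric] algebra_simps)
  finally show ?thesis using assms(3) by (simp add: field_simps)
qed

section \<open>The generating series of regular trees\<close>

definition tpart :: "nat \<Rightarrow> nat \<Rightarrow> real \<Rightarrow> real" where
  "tpart N M x = (\<Sum>n\<le>M. real (tcount N n) * x ^ n)"

definition tgf :: "nat \<Rightarrow> 'a::{banach,real_normed_field} \<Rightarrow> 'a" where
  "tgf N z = (\<Sum>n. of_nat (tcount N n) * z ^ n)"

text \<open>Otter's constant, that is \<open>alphaR N ^ N\<close>. As a supremum of points of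
  convergence it can be compared directly with bounds on truncated sums.\<close>

definition rad :: "nat \<Rightarrow> real" where
  "rad N = Sup {x. 0 \<le> x \<and> summable (\<lambda>n. real (tcount N n) * x ^ n)}"

lemma tpart_nonneg: "0 \<le> x \<Longrightarrow> 0 \<le> tpart N M x"
  unfolding tpart_def by (intro sum_nonneg) auto

text \<open>The Polya equation for truncated series, as an inequality: the pairs with
  \<open>j * m \<le> n \<le> M\<close> form a part of the square
  \<open>{..M} \<times> {..M}\<close>, and the remaining terms of the product are nonnegative. No
  convergence is presupposed, so it applies at points whose position relative to the radius is still
  unknown.\<close>

lemma fpart_le_newton:
  assumes x: "0 \<le> x" and s: "\<And>j. 1 \<le> j \<Longrightarrow> j \<le> k \<Longrightarrow> tpart N M (x ^ j) \<le> s j"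
  shows "(\<Sum>n\<le>M. real (fcount N k n) * x ^ n) \<le> newton s k"
  using s
proof (induction k rule: less_induct)
  case (less k)
  let ?f = "\<lambda>k. \<Sum>n\<le>M. real (fcount N k n) * x ^ n"
  show ?case
  proof (cases "k = 0")
    case True
    then show ?thesis by (auto simp: fcount_0 if_distrib if_distribR cong: if_cong)
  next
    case False
    have "real k * ?f k = (\<Sum>n\<le>M. real (k * fcount N k n) * x ^ n)"
      by (simp add: sum_distrib_left mult_ac)
    also have "\<dots> = (\<Sum>n\<le>M. \<Sum>j=1..k. \<Sum>m | m \<le> n \<and> j * m \<le> n.
        (real (tcount N m) * (x ^ j) ^ m) * (real (fcount N (k - j) (n - j * m)) * x ^ (n - j * m)))"
    proof (rule sum.cong[OF refl])
      fix n
      have "x ^ n = (x ^ j) ^ m * x ^ (n - j * m)" if "j * m \<le> n" for j m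
        using that by (simp flip: power_mult power_add)
      then show "real (k * fcount N k n) * x ^ n = (\<Sum>j=1..k. \<Sum>m | m \<le> n \<and> j * m \<le> n.
        (real (tcount N m) * (x ^ j) ^ m) * (real (fcount N (k - j) (n - j * m)) * x ^ (n - j * m)))"
        unfolding fcount_newton[of k] of_nat_sum sum_distrib_right
        by (intro sum.cong refl) auto
    qed
    also have "\<dots> = (\<Sum>j=1..k. \<Sum>n\<le>M. \<Sum>m | m \<le> n \<and> j * m \<le> n.
        (real (tcount N m) * (x ^ j) ^ m) * (real (fcount N (k - j) (n - j * m)) * x ^ (n - j * m)))"
      by (rule sum.swap)
    also have "\<dots> \<le> (\<Sum>j=1..k. s j * newton s (k - j))"
    proof (rule sum_mono)
      fix j assume j: "j \<in> {1..k}"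
      let ?g = "\<lambda>(m, l). (real (tcount N m) * (x ^ j) ^ m) * (real (fcount N (k - j) l) * x ^ l)"
      let ?S = "SIGMA n:{..M}. {m. m \<le> n \<and> j * m \<le> n}"
      \<comment> \<open>Injective on \<open>?S\<close>, because \<open>j * m \<le> n\<close> makes
        the subtraction exact.\<close>
      let ?h = "\<lambda>(n, m). (m, n - j * m)"
      have inj: "inj_on ?h ?S" by (auto simp: inj_on_def)
      have "(\<Sum>n\<le>M. \<Sum>m | m \<le> n \<and> j * m \<le> n.
        (real (tcount N m) * (x ^ j) ^ m) * (real (fcount N (k - j) (n - j * m)) * x ^ (n - j * m)))
         = (\<Sum>p\<in>?S. ?g (?h p))"
        by (subst sum.Sigma) (auto intro!: sum.cong)
      also have "\<dots> = (\<Sum>p\<in>?h ` ?S. ?g p)"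
        by (simp add: sum.reindex[OF inj] o_def)
      also have "\<dots> \<le> (\<Sum>p\<in>{..M} \<times> {..M}. ?g p)"
        using x by (intro sum_mono2) auto
      also have "\<dots> = tpart N M (x ^ j) * ?f (k - j)"
        unfolding tpart_def sum_product by (simp add: sum.cartesian_product)
      also have "\<dots> \<le> s j * newton s (k - j)"
      proof (rule mult_mono)
        show "tpart N M (x ^ j) \<le> s j" using less.prems j by auto
        show "0 \<le> s j" using less.prems[of j] j tpart_nonneg[of "x ^ j" N M] x by force
        show "?f (k - j) \<le> newton s (k - j)" using less j by auto
        show "0 \<le> ?f (k - j)" using x by (intro sum_nonneg) auto
      qed
      finally show "(\<Sum>n\<le>M. \<Sum>m | m \<le> n \<and> j * m \<le> n.
        (real (tcount N m) * (x ^ j) ^ m) * (real (fcount N (k - j) (n - j * m)) * x ^ (n - j * m)))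
        \<le> s j * newton s (k - j)" .
    qed
    also have "\<dots> = real k * newton s k" by (simp add: newton_rec)
    finally show ?thesis using False by simp
  qed
qed

section \<open>Truncated series, supersolutions and convergence up to the radius\<close>

locale regular_trees =
  fixes N :: nat
  assumes N2: "2 \<le> N"
begin

lemma tpart_Suc_le:
  assumes "0 \<le> x" and "\<And>j. 1 \<le> j \<Longrightarrow> j \<le> N \<Longrightarrow> tpart N M (x ^ j) \<le> s j"
  shows "tpart N (Suc M) x \<le> 1 + x * newton s N"
proof -
  have "tpart N (Suc M) x = 1 + x * (\<Sum>n\<le>M. real (fcount N N n) * x ^ n)"
    using N2 unfolding tpart_def sum.atMost_Suc_shift
    by (simp add: tcount_Suc sum_distrib_left mult_ac)
  also have "\<dots> \<le> 1 + x * newton s N"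
    using fpart_le_newton[OF assms(1), of N N M s] assms by (intro add_left_mono mult_left_mono) auto
  finally show ?thesis .
qed

text \<open>The recursion at \<open>x ^ j\<close> involves the series at \<open>x ^ (j * i)\<close>,
  so all powers are bounded at once, by induction on the order of truncation.\<close>

lemma tpart_le_supersolution:
  assumes "0 \<le> x" and Y: "\<And>j. 1 \<le> j \<Longrightarrow> 1 + x ^ j * newton (\<lambda>i. Y (j * i)) N \<le> Y j" "\<And>j. 1 \<le> j \<Longrightarrow> 1 \<le> Y j"
  shows "1 \<le> j \<Longrightarrow> tpart N M (x ^ j) \<le> Y j"
proof (induction M arbitrary: j)
  case 0
  then show ?case using Y(2)[of j] by (simp add: tpart_def)
next
  case (Suc M)
  have "tpart N (Suc M) (x ^ j) \<le> 1 + x ^ j * newton (\<lambda>i. Y (j * i)) N"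
    using assms(1) Suc by (intro tpart_Suc_le) (auto simp flip: power_mult)
  then show ?case using Y(1)[of j] Suc by auto
qed

text \<open>Once the series at the powers \<open>x ^ j\<close> with \<open>j \<ge> 2\<close> is
  under control, a single unknown bound remains. This form works at points slightly beyond the
  radius, whose higher powers still lie inside.\<close>

lemma tpart_le_supersolution_1:
  assumes "0 \<le> x" and "\<And>j M. 2 \<le> j \<Longrightarrow> j \<le> N \<Longrightarrow> tpart N M (x ^ j) \<le> s j"
    and "1 + x * newton s N \<le> s 1" "1 \<le> s 1"
  shows "tpart N M x \<le> s 1"
proof (induction M)
  case 0
  then show ?case using assms by (simp add: tpart_def)
next
  case (Suc M)
  have "tpart N (Suc M) x \<le> 1 + x * newton s N"
  proof (rule tpart_Suc_le)
    fix j assume "1 \<le> j" "j \<le> N"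
    then show "tpart N M (x ^ j) \<le> s j"
      using Suc assms(2)[of j M] by (cases "j = 1") auto
  qed (use assms in auto)
  then show ?case using assms by simp
qed

lemma summable_iff_tpart_bounded:
  assumes "0 \<le> x"
  shows "summable (\<lambda>n. real (tcount N n) * x ^ n) \<longleftrightarrow> (\<exists>B. \<forall>M. tpart N M x \<le> B)"
proof
  assume "summable (\<lambda>n. real (tcount N n) * x ^ n)"
  then have "tpart N M x \<le> (\<Sum>n. real (tcount N n) * x ^ n)" for M
    unfolding tpart_def using assms by (intro sum_le_suminf) auto
  then show "\<exists>B. \<forall>M. tpart N M x \<le> B" by blast
next
  assume "\<exists>B. \<forall>M. tpart N M x \<le> B"
  then obtain B where B: "\<And>M. tpart N M x \<le> B" by blast
  show "summable (\<lambda>n. real (tcount N n) * x ^ n)"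
  proof (rule bounded_imp_summable)
    show "(\<Sum>n\<le>M. real (tcount N n) * x ^ n) \<le> B" for M using B[of M] by (simp add: tpart_def)
  qed (use assms in auto)
qed

lemma tpart_le_tgf:
  assumes "0 \<le> x" "summable (\<lambda>n. real (tcount N n) * x ^ n)"
  shows "tpart N M x \<le> tgf N x"
  unfolding tpart_def tgf_def using assms by (intro sum_le_suminf) auto

lemma summable_down:
  assumes "0 \<le> x" "x \<le> y" "summable (\<lambda>n. real (tcount N n) * y ^ n)"
  shows "summable (\<lambda>n. real (tcount N n) * x ^ n)"
  by (rule summable_comparison_test[OF _ assms(3)])
     (use assms in \<open>auto intro!: mult_left_mono power_mono\<close>)

lemma not_summable_1: "\<not> summable (\<lambda>n. real (tcount N n) * 1 ^ n)"
proof
  assume "summable (\<lambda>n. real (tcount N n) * 1 ^ n)"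
  then have "(\<lambda>n. real (tcount N n)) \<longlonglongrightarrow> 0" by (simp add: summable_LIMSEQ_zero)
  then have "\<forall>\<^sub>F n in sequentially. real (tcount N n) < 1" by (rule order_tendstoD) auto
  then obtain n where "real (tcount N n) < 1" by (auto simp: eventually_sequentially)
  then show False using tcount_pos[of N n] N2 by simp
qed

lemma summable_imp_less_1:
  assumes "0 \<le> x" "summable (\<lambda>n. real (tcount N n) * x ^ n)" shows "x < 1"
  using summable_down[of 1 x] assms not_summable_1 by force

text \<open>With all power sums equal to 2 the generating function is (1 - t)^(-2). This makes the
  constant 2 a supersolution at 1 / (N + 1), hence the radius positive.\<close>

lemma newton_two: "newton (\<lambda>_. 2 :: real) k = real k + 1"
proof -
  have "real k + 1 = newton (\<lambda>_. 2 :: real) k"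
  proof (rule newton_unique[where K=k])
    fix k
    have "(\<Sum>j = 1..k. 2 * (real (k - j) + 1)) = (\<Sum>j = 1..k. 2 * real j)"
      by (rule sum.reindex_bij_witness[of _ "\<lambda>j. k + 1 - j" "\<lambda>j. k + 1 - j"]) (auto simp: of_nat_diff)
    also have "\<dots> = real k * (real k + 1)" by (induction k) (auto simp: algebra_simps)
    finally show "real k * (real k + 1) = (\<Sum>j = 1..k. 2 * (real (k - j) + 1))" by simp
  qed auto
  then show ?thesis by simp
qed

lemma summable_small: "summable (\<lambda>n. real (tcount N n) * (1 / (N + 1)) ^ n)"
proof -
  let ?x = "1 / (real N + 1)"
  have "tpart N M (?x ^ 1) \<le> 2" for M
  proof (rule tpart_le_supersolution[where Y="\<lambda>_. 2"])
    fix j :: nat assume "1 \<le> j"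
    have "?x ^ j \<le> ?x ^ 1" using \<open>1 \<le> j\<close> by (intro power_decreasing) auto
    then have "?x ^ j * (real N + 1) \<le> ?x ^ 1 * (real N + 1)" by (intro mult_right_mono) auto
    then show "1 + ?x ^ j * newton (\<lambda>i. 2) N \<le> 2" by (simp add: newton_two field_simps)
  qed auto
  then show ?thesis using summable_iff_tpart_bounded[of ?x] by (auto simp: add.commute)
qed

lemma rad_set_bdd: "bdd_above {x. 0 \<le> x \<and> summable (\<lambda>n. real (tcount N n) * x ^ n)}"
  using summable_imp_less_1 by (intro bdd_aboveI[of _ 1]) force

lemma rad_upper: "0 \<le> x \<Longrightarrow> summable (\<lambda>n. real (tcount N n) * x ^ n) \<Longrightarrow> x \<le> rad N"
  unfolding rad_def by (rule cSup_upper[OF _ rad_set_bdd]) auto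

lemma rad_pos: "0 < rad N"
proof -
  have "1 / (N + 1) \<le> rad N" by (rule rad_upper) (use summable_small in auto)
  moreover have "0 < 1 / real (N + 1)" by simp
  ultimately show ?thesis by linarith
qed

lemma summable_below_rad:
  assumes "0 \<le> x" "x < rad N"
  shows "summable (\<lambda>n. real (tcount N n) * x ^ n)"
proof -
  let ?A = "{x. 0 \<le> x \<and> summable (\<lambda>n. real (tcount N n) * x ^ n)}"
  have "1 / real (N + 1) \<in> ?A" using summable_small by (intro CollectI conjI) auto
  then have "\<exists>y\<in>?A. x < y"
    using assms(2) less_cSup_iff[OF _ rad_set_bdd, of x] unfolding rad_def by blast
  then obtain y where "x < y" "summable (\<lambda>n. real (tcount N n) * y ^ n)" by blast
  then show ?thesis using summable_down[of x y] assms by simp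
qed

lemma summable_power:
  assumes "0 \<le> x" "summable (\<lambda>n. real (tcount N n) * x ^ n)" "1 \<le> j"
  shows "summable (\<lambda>n. real (tcount N n) * (x ^ j) ^ n)"
proof (rule summable_down[OF _ _ assms(2)])
  have "x < 1" using summable_imp_less_1 assms by blast
  then show "x ^ j \<le> x" using power_decreasing[of 1 j x] assms by simp
qed (use assms in auto)

lemma fser_bounded:
  assumes "0 \<le> x" "summable (\<lambda>n. real (tcount N n) * x ^ n)"
  shows "(\<Sum>n\<le>M. real (fcount N k n) * x ^ n) \<le> newton (\<lambda>j. tgf N (x ^ j)) k"
  using assms by (intro fpart_le_newton tpart_le_tgf summable_power) auto

lemma fser_summable:
  assumes "0 \<le> x" "summable (\<lambda>n. real (tcount N n) * x ^ n)"
  shows "summable (\<lambda>n. real (fcount N k n) * x ^ n)"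
  by (rule bounded_imp_summable[OF _ fser_bounded[OF assms]]) (use assms in auto)

text \<open>T(z^j) as an absolutely convergent power series in \<open>z\<close>, supported on the
  multiples of \<open>j\<close>, so that Cauchy products with the forest series can be
  formed.\<close>

lemma tgf_power_series:
  fixes z :: "'a::{banach,real_normed_field}"
  assumes "summable (\<lambda>n. real (tcount N n) * norm z ^ n)" "1 \<le> j"
  defines "c \<equiv> \<lambda>i. (if j dvd i then of_nat (tcount N (i div j)) else 0) * z ^ i"
  shows "summable (\<lambda>i. norm (c i))" and "(\<Sum>i. c i) = tgf N (z ^ j)"
proof -
  have mono: "strict_mono (\<lambda>m. j * m)" using assms(2) by (auto simp: strict_mono_def)
  have off: "c i = 0" if "i \<notin> range (\<lambda>m. j * m)" for i
    using that by (auto simp: c_def dvd_def)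
  have on: "c (j * m) = of_nat (tcount N m) * (z ^ j) ^ m" for m
    using assms(2) by (simp add: c_def power_mult)
  have s: "summable (\<lambda>m. norm (of_nat (tcount N m) * (z ^ j) ^ m))"
    using summable_power[OF _ assms(1,2)] by (simp add: norm_mult norm_power)
  then have "(\<lambda>m. norm (c (j * m))) sums (\<Sum>m. norm (c (j * m)))"
    unfolding on by (rule summable_sums)
  then have "(\<lambda>i. norm (c i)) sums (\<Sum>m. norm (c (j * m)))"
    by (subst (asm) sums_mono_reindex[OF mono]) (use off in auto)
  then show "summable (\<lambda>i. norm (c i))" by (rule sums_summable)
  have "(\<lambda>m. c (j * m)) sums tgf N (z ^ j)"
    unfolding on tgf_def by (rule summable_sums[OF summable_norm_cancel[OF s]])
  then have "c sums tgf N (z ^ j)"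
    by (subst (asm) sums_mono_reindex[OF mono]) (use off in auto)
  then show "(\<Sum>i. c i) = tgf N (z ^ j)" by (simp add: sums_iff)
qed

text \<open>Each summand of \<open>fcount_newton\<close> is a coefficient of a Cauchy product, so
  the forest series satisfy the recursion that characterises \<open>newton\<close>.\<close>

lemma fser_eq_newton:
  fixes z :: "'a::{banach,real_normed_field}"
  assumes "summable (\<lambda>n. real (tcount N n) * norm z ^ n)"
  shows "(\<Sum>n. of_nat (fcount N k n) * z ^ n) = newton (\<lambda>j. tgf N (z ^ j)) k"
proof -
  let ?b = "\<lambda>k n. of_nat (fcount N k n) * z ^ n"
  let ?c = "\<lambda>j i. (if j dvd i then of_nat (tcount N (i div j)) else 0) * z ^ i"
  have sb: "summable (\<lambda>n. norm (?b k n))" for k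
    using fser_summable[OF _ assms, of k] by (simp add: norm_mult norm_power)
  show ?thesis
  proof (rule newton_unique[where K=k])
    have "(\<lambda>n. ?b 0 n) sums (\<Sum>n\<in>{0}. ?b 0 n)" by (rule sums_finite) (auto simp: fcount_0)
    then show "(\<Sum>n. ?b 0 n) = 1" by (simp add: sums_iff fcount_0)
  next
    fix k
    have eq: "of_nat k * ?b k n = (\<Sum>j=1..k. \<Sum>i\<le>n. ?c j i * ?b (k - j) (n - i))" for n
    proof -
      have "of_nat k * ?b k n = of_nat (k * fcount N k n) * z ^ n" by simp
      also have "\<dots> = (\<Sum>j=1..k. \<Sum>m | m \<le> n \<and> j * m \<le> n.
          of_nat (tcount N m * fcount N (k - j) (n - j * m)) * z ^ n)"
        unfolding fcount_newton[of k] by (simp add: sum_distrib_right)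
      also have "\<dots> = (\<Sum>j=1..k. \<Sum>i\<in>{i. i \<le> n \<and> j dvd i}. ?c j i * ?b (k - j) (n - i))"
      proof (rule sum.cong[OF refl])
        fix j assume j: "j \<in> {1..k}"
        have pw: "z ^ n = z ^ (j * m) * z ^ (n - j * m)" if "j * m \<le> n" for m
          using that by (simp flip: power_add)
        show "(\<Sum>m | m \<le> n \<and> j * m \<le> n. of_nat (tcount N m * fcount N (k - j) (n - j * m)) * z ^ n)
          = (\<Sum>i\<in>{i. i \<le> n \<and> j dvd i}. ?c j i * ?b (k - j) (n - i))"
          using j
          by (intro sum.reindex_bij_witness[of _ "\<lambda>i. i div j" "\<lambda>m. j * m"])
             (auto simp: pw intro: order_trans[OF div_le_dividend])
      qed
      also have "\<dots> = (\<Sum>j=1..k. \<Sum>i\<le>n. ?c j i * ?b (k - j) (n - i))"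
        by (intro sum.cong refl sum.mono_neutral_left) auto
      finally show ?thesis .
    qed
    have "(\<lambda>n. \<Sum>j=1..k. \<Sum>i\<le>n. ?c j i * ?b (k - j) (n - i)) sums
       (\<Sum>j=1..k. (\<Sum>i. ?c j i) * (\<Sum>n. ?b (k - j) n))"
      using tgf_power_series(1)[OF assms] by (intro sums_sum Cauchy_product_sums sb) auto
    then have "(\<lambda>n. of_nat k * ?b k n) sums (\<Sum>j=1..k. (\<Sum>i. ?c j i) * (\<Sum>n. ?b (k - j) n))"
      unfolding eq .
    moreover have "(\<lambda>n. of_nat k * ?b k n) sums (of_nat k * (\<Sum>n. ?b k n))"
      by (rule sums_mult[OF summable_sums[OF summable_norm_cancel[OF sb]]])
    ultimately have "of_nat k * (\<Sum>n. ?b k n) = (\<Sum>j=1..k. (\<Sum>i. ?c j i) * (\<Sum>n. ?b (k - j) n))"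
      by (rule sums_unique2[rotated])
    also have "\<dots> = (\<Sum>j=1..k. tgf N (z ^ j) * (\<Sum>n. ?b (k - j) n))"
      by (rule sum.cong[OF refl], subst tgf_power_series(2)[OF assms]) simp_all
    finally show "of_nat k * (\<Sum>n. ?b k n) = (\<Sum>j=1..k. tgf N (z ^ j) * (\<Sum>n. ?b (k - j) n))" .
  qed simp
qed

lemma tgf_eq:
  fixes z :: "'a::{banach,real_normed_field}"
  assumes "summable (\<lambda>n. real (tcount N n) * norm z ^ n)"
  shows "tgf N z = 1 + z * newton (\<lambda>j. tgf N (z ^ j)) N"
proof -
  have s: "summable (\<lambda>n. of_nat (tcount N n) * z ^ n)"
    by (rule summable_norm_cancel) (use assms in \<open>simp add: norm_mult norm_power\<close>)
  have f: "summable (\<lambda>n. of_nat (fcount N N n) * z ^ n)"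
    by (rule summable_norm_cancel) (use fser_summable[OF _ assms, of N] in \<open>simp add: norm_mult norm_power\<close>)
  have "tgf N z = 1 + (\<Sum>n. of_nat (tcount N (Suc n)) * z ^ Suc n)"
    unfolding tgf_def using suminf_split_head[OF s] by simp
  also have "(\<Sum>n. of_nat (tcount N (Suc n)) * z ^ Suc n) = z * (\<Sum>n. of_nat (fcount N N n) * z ^ n)"
    using N2 suminf_mult[OF f, of z] by (simp add: tcount_Suc mult_ac)
  finally show ?thesis by (simp add: fser_eq_newton[OF assms])
qed

lemma tgf_ge_1:
  assumes "0 \<le> x" "summable (\<lambda>n. real (tcount N n) * x ^ n)"
  shows "1 \<le> tgf N x"
  using tpart_le_tgf[OF assms, of 0] by (simp add: tpart_def)

text \<open>The identity permutation alone gives T \<ge> x T^N / N!. Dividing by T leaves, because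
  of N \<ge> 2, a positive power of T and hence a bound that is uniform up to the radius.\<close>

lemma tgf_power_le:
  assumes "0 \<le> x" "summable (\<lambda>n. real (tcount N n) * x ^ n)"
  shows "x * tgf N x ^ (N - 1) \<le> fact N"
proof -
  have T1: "1 \<le> tgf N x" using tgf_ge_1 assms .
  have "tgf N x ^ N / fact N \<le> newton (\<lambda>j. tgf N (x ^ j)) N"
    using newton_ge_power[of N "\<lambda>j. tgf N (x ^ j)"] tgf_ge_1[OF _ summable_power[OF assms]] assms
    by (force intro: order_trans[of 0 1])
  then have "x * (tgf N x ^ N / fact N) \<le> tgf N x"
    using assms tgf_eq[of x] T1 mult_left_mono[of _ _ x] by force
  also have "tgf N x ^ N = tgf N x * tgf N x ^ (N - 1)"
    using N2 by (simp flip: power_Suc)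
  finally show ?thesis using T1 by (simp add: field_simps)
qed

lemma tgf_bounded:
  obtains B where "\<And>x. rad N / 2 \<le> x \<Longrightarrow> summable (\<lambda>n. real (tcount N n) * x ^ n) \<Longrightarrow> tgf N x \<le> B"
proof
  fix x assume x: "rad N / 2 \<le> x" and s: "summable (\<lambda>n. real (tcount N n) * x ^ n)"
  have x0: "0 < x" using x rad_pos by simp
  have T1: "1 \<le> tgf N x" using tgf_ge_1 x0 s by simp
  have "tgf N x ^ 1 \<le> tgf N x ^ (N - 1)" using T1 N2 by (intro power_increasing) auto
  also have "\<dots> \<le> fact N / x" using tgf_power_le[OF _ s] x0 by (simp add: field_simps)
  also have "\<dots> \<le> fact N / (rad N / 2)" using x rad_pos by (intro divide_left_mono) auto
  finally show "tgf N x \<le> fact N / (rad N / 2)" by simp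
qed

text \<open>Truncated sums are polynomials, so a uniform bound to the left of the radius persists at
  the radius itself. Convergence there makes the series continuous on the closed disc.\<close>

lemma summable_rad: "summable (\<lambda>n. real (tcount N n) * rad N ^ n)"
proof -
  obtain B where B: "\<And>x. rad N / 2 \<le> x \<Longrightarrow> summable (\<lambda>n. real (tcount N n) * x ^ n) \<Longrightarrow> tgf N x \<le> B"
    using tgf_bounded by blast
  have "tpart N M (rad N) \<le> B" for M
  proof -
    have "\<forall>\<^sub>F x in at_left (rad N). rad N / 2 \<le> x \<and> x < rad N"
      using rad_pos eventually_at_left_real[of "rad N / 2" "rad N"] by (auto elim!: eventually_mono)
    then have "\<forall>\<^sub>F x in at_left (rad N). tpart N M x \<le> B"
    proof eventually_elim
      case (elim x)
      then have "0 \<le> x" using rad_pos by simp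
      moreover from this elim have "summable (\<lambda>n. real (tcount N n) * x ^ n)"
        using summable_below_rad by blast
      ultimately show ?case using B[of x] tpart_le_tgf[of x M] elim by simp
    qed
    moreover have "((\<lambda>x. tpart N M x) \<longlongrightarrow> tpart N M (rad N)) (at_left (rad N))"
      unfolding tpart_def by (intro tendsto_intros)
    ultimately show ?thesis by (intro tendsto_upperbound) auto
  qed
  then show ?thesis using summable_iff_tpart_bounded rad_pos by (meson less_imp_le)
qed

lemma summable_iff_le_rad: "0 \<le> x \<Longrightarrow> summable (\<lambda>n. real (tcount N n) * x ^ n) \<longleftrightarrow> x \<le> rad N"
  using rad_upper summable_down[OF _ _ summable_rad] by blast

lemma rad_less_1: "rad N < 1"
  using summable_imp_less_1[OF _ summable_rad] rad_pos by simp

end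

section \<open>The functional equation on the closed disc and criticality at the radius\<close>

context regular_trees begin

text \<open>By \<open>fser_eq_newton\<close>, the generating series of forests of \<open>k\<close>
  regular trees.\<close>

definition h :: "nat \<Rightarrow> 'a::{banach,real_normed_field} \<Rightarrow> 'a" where
  "h k z = newton (\<lambda>j. tgf N (z ^ j)) k"

lemma h_0 [simp]: "h 0 z = 1" by (simp add: h_def)

lemma tgf_eq_h: "norm z \<le> rad N \<Longrightarrow> tgf N z = 1 + z * h N z"
  unfolding h_def by (rule tgf_eq) (simp add: summable_iff_le_rad)

lemma rad_power_less: "2 \<le> j \<Longrightarrow> rad N ^ j < rad N"
  using power_strict_decreasing[of 1 j "rad N"] rad_pos rad_less_1 by simp

lemma rad_power_le: "1 \<le> j \<Longrightarrow> rad N ^ j \<le> rad N"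
  using power_decreasing[of 1 j "rad N"] rad_pos rad_less_1 by simp

lemma norm_power_le_rad:
  fixes z :: "'a::real_normed_field"
  assumes "norm z \<le> rad N" "1 \<le> j"
  shows "norm (z ^ j) \<le> rad N ^ j"
  using assms by (simp add: norm_power power_mono)

lemma norm_power_le_rad':
  fixes z :: "'a::real_normed_field"
  assumes "norm z \<le> rad N" "1 \<le> j"
  shows "norm (z ^ j) \<le> rad N"
  using norm_power_le_rad[OF assms] rad_power_le[OF assms(2)] by linarith

lemma power_le_rad:
  assumes "0 \<le> x" "x \<le> rad N" "1 \<le> j"
  shows "x ^ j \<le> rad N"
  using norm_power_le_rad'[of x j] assms by (simp add: power_abs)

lemma tgf_of_real:
  assumes "0 \<le> x" "x \<le> rad N"
  shows "tgf N (of_real x :: 'a::{banach,real_normed_field}) = of_real (tgf N x)"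
proof -
  have "summable (\<lambda>n. real (tcount N n) * x ^ n)" using assms by (simp add: summable_iff_le_rad)
  from suminf_of_real[OF this, where 'a='a] show ?thesis unfolding tgf_def by simp
qed

lemma h_of_real:
  assumes "0 \<le> x" "x \<le> rad N"
  shows "h k (of_real x :: 'a::{banach,real_normed_field}) = of_real (h k x)"
proof -
  have "newton (\<lambda>j. tgf N ((of_real x :: 'a) ^ j)) k = newton (\<lambda>j. of_real (tgf N (x ^ j))) k"
  proof (rule newton_cong)
    fix j :: nat assume "1 \<le> j"
    then have "x ^ j \<le> rad N" using power_le_rad assms by simp
    then show "tgf N ((of_real x :: 'a) ^ j) = of_real (tgf N (x ^ j))"
      using tgf_of_real[of "x ^ j", where 'a='a] assms by simp
  qed
  then show ?thesis unfolding h_def newton_of_real .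
qed

lemma norm_tgf_le:
  fixes z :: "'a::{banach,real_normed_field}"
  assumes "norm z \<le> x" "x \<le> rad N"
  shows "norm (tgf N z) \<le> tgf N x"
proof -
  have x: "0 \<le> x" using assms norm_ge_zero order_trans by blast
  have s: "summable (\<lambda>n. real (tcount N n) * x ^ n)" using assms x by (simp add: summable_iff_le_rad)
  have "norm (tgf N z) \<le> (\<Sum>n. real (tcount N n) * x ^ n)"
    unfolding tgf_def by (rule norm_suminf_le[OF _ s]) (use assms in \<open>auto simp: norm_mult norm_power intro!: mult_left_mono power_mono\<close>)
  then show ?thesis by (simp add: tgf_def)
qed

lemma tgf_real_ge_1: "0 \<le> x \<Longrightarrow> x \<le> rad N \<Longrightarrow> 1 \<le> tgf N x"
  by (rule tgf_ge_1) (simp_all add: summable_iff_le_rad)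

lemma tgf_power_bound:
  fixes z :: "'a::{banach,real_normed_field}"
  assumes "norm z \<le> rad N" "1 \<le> j"
  shows "norm (tgf N (z ^ j)) \<le> tgf N (rad N ^ j)"
  using assms norm_power_le_rad[OF assms] rad_power_le[of j] by (intro norm_tgf_le)

lemma h_real_pos:
  assumes "0 \<le> x" "x \<le> rad N"
  shows "0 < h k x"
proof -
  have T: "1 \<le> tgf N (x ^ j)" if "1 \<le> j" for j
    using tgf_real_ge_1[of "x ^ j"] power_le_rad[of x j] assms that by simp
  then have T0: "0 \<le> tgf N (x ^ j)" if "1 \<le> j" for j using that by force
  have "0 < tgf N (x ^ 1) ^ k / fact k" using T[of 1] by (intro divide_pos_pos zero_less_power) auto
  also have "\<dots> \<le> h k x" unfolding h_def by (rule newton_ge_power) (use T0 in auto)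
  finally show ?thesis .
qed

lemma continuous_on_tgf: "continuous_on (cball 0 (rad N)) (tgf N :: 'a::{banach,real_normed_field} \<Rightarrow> 'a)"
proof -
  have "uniform_limit (cball (0::'a) (rad N)) (\<lambda>n z. \<Sum>i<n. of_nat (tcount N i) * z ^ i)
      (\<lambda>z. \<Sum>i. of_nat (tcount N i) * z ^ i) sequentially"
    using summable_rad
    by (intro Weierstrass_m_test) (auto simp: norm_mult norm_power intro!: mult_left_mono power_mono)
  then show ?thesis unfolding tgf_def
    by (rule uniform_limit_theorem[rotated]) (auto intro!: continuous_intros always_eventually)
qed

lemma continuous_on_tgf_power:
  assumes "1 \<le> j"
  shows "continuous_on (cball 0 (rad N)) (\<lambda>z. tgf N (z ^ j) :: 'a::{banach,real_normed_field})"
  by (rule continuous_on_compose2[OF continuous_on_tgf])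
     (use norm_power_le_rad' assms in \<open>auto intro!: continuous_intros\<close>)

lemma continuous_on_h: "continuous_on (cball 0 (rad N)) (h k :: 'a::{banach,real_normed_field} \<Rightarrow> 'a)"
  unfolding h_def by (intro continuous_on_newton continuous_on_tgf_power)

definition T' :: "complex \<Rightarrow> complex" where "T' = deriv (tgf N)"

lemma tgf_DERIV_series:
  fixes z :: "'a::{banach,real_normed_field}"
  assumes "norm z < rad N"
  shows "(tgf N has_field_derivative (\<Sum>n. diffs (\<lambda>n. of_nat (tcount N n)) n * z ^ n)) (at z)"
proof -
  have "summable (\<lambda>n. of_nat (tcount N n) * (of_real (rad N) :: 'a) ^ n)"
    using summable_of_real[OF summable_rad, where 'a='a] by simp
  from termdiffs_strong[OF this] show ?thesis
    unfolding tgf_def using assms rad_pos by simp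
qed

lemma has_field_derivative_tgf:
  assumes "norm z < rad N"
  shows "(tgf N has_field_derivative T' z) (at z)"
  using tgf_DERIV_series[OF assms] DERIV_imp_deriv unfolding T'_def by metis

lemma holomorphic_tgf: "tgf N holomorphic_on ball 0 (rad N)"
  using has_field_derivative_tgf by (force simp: holomorphic_on_open)

lemma holomorphic_T': "T' holomorphic_on ball 0 (rad N)"
  unfolding T'_def by (intro holomorphic_deriv holomorphic_tgf open_ball)

lemma T'_real:
  assumes "0 \<le> x" "x < rad N"
  obtains t where "T' (of_real x) = of_real t" "1 \<le> t"
proof
  let ?d = "\<lambda>n. diffs (\<lambda>n. real (tcount N n)) n * x ^ n"
  have s: "summable ?d"
  proof (rule termdiff_converges[where K="rad N"])
    fix y :: real assume "norm y < rad N"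
    then show "summable (\<lambda>n. real (tcount N n) * y ^ n)"
      using summable_below_rad[of "norm y"]
      by (intro summable_norm_cancel[of "\<lambda>n. real (tcount N n) * y ^ n"]) (simp add: abs_mult power_abs)
  qed (use assms in simp)
  have "T' (of_real x) = (\<Sum>n. diffs (\<lambda>n. of_nat (tcount N n)) n * of_real x ^ n)"
    unfolding T'_def by (rule DERIV_imp_deriv, rule tgf_DERIV_series) (use assms in simp)
  also have "\<dots> = (\<Sum>n. of_real (?d n))"
    by (simp add: diffs_def)
  also have "\<dots> = of_real (\<Sum>n. ?d n)" by (rule suminf_of_real[symmetric, OF s])
  finally show "T' (of_real x) = of_real (\<Sum>n. ?d n)" .
  have "1 \<le> ?d 0" using tcount_pos[of N 1] N2 by (simp add: diffs_def)
  also have "\<dots> = (\<Sum>n\<in>{0}. ?d n)" by simp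
  also have "\<dots> \<le> (\<Sum>n. ?d n)"
    using assms by (intro sum_le_suminf s) (auto simp: diffs_def)
  finally show "1 \<le> (\<Sum>n. ?d n)" .
qed

text \<open>The part of the derivative of \<open>h k\<close> that comes from the arguments z^j with
  j \<ge> 2. There T' is evaluated inside a strictly smaller disc, so only the factors
  \<open>h\<close> feel the singularity.\<close>

definition K :: "nat \<Rightarrow> complex \<Rightarrow> complex" where
  "K k z = (\<Sum>j=2..k. z ^ (j - 1) * T' (z ^ j) * h (k - j) z)"

lemma h_has_field_derivative:
  assumes z: "norm z < rad N" and k: "1 \<le> k"
  shows "(h k has_field_derivative (T' z * h (k - 1) z + K k z)) (at z)"
proof -
  have "((\<lambda>z. tgf N (z ^ j)) has_field_derivative (T' (z ^ j) * (of_nat j * z ^ (j - 1)))) (at z)" if "1 \<le> j" for j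
  proof (rule DERIV_chain2[where g="\<lambda>z. z ^ j"])
    have "norm (z ^ j) \<le> norm z ^ 1"
      unfolding norm_power using that z rad_less_1 by (intro power_decreasing) auto
    then show "(tgf N has_field_derivative T' (z ^ j)) (at (z ^ j))"
      using z by (intro has_field_derivative_tgf) auto
  qed (use that in \<open>auto intro!: derivative_eq_intros\<close>)
  then have "(h k has_field_derivative (\<Sum>j=1..k. T' (z ^ j) * (of_nat j * z ^ (j - 1)) / of_nat j * h (k - j) z)) (at z)"
    unfolding h_def by (rule newton_has_field_derivative)
  also have "(\<Sum>j=1..k. T' (z ^ j) * (of_nat j * z ^ (j - 1)) / of_nat j * h (k - j) z)
      = (\<Sum>j=1..k. z ^ (j - 1) * T' (z ^ j) * h (k - j) z)"
    by (intro sum.cong) auto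
  also have "\<dots> = T' z * h (k - 1) z + K k z"
    using k unfolding K_def by (subst sum.atLeast_Suc_atMost) (auto simp: numeral_2_eq_2)
  finally show ?thesis .
qed

definition S where "S z = h N z + z * K N z"
definition R where "R z = z * h (N - 1) z" for z :: complex
definition P where "P z = z * h (N - 2) z * S z"
definition Q where "Q z = h (N - 1) z + z * K (N - 1) z"

lemma T'_eq:
  assumes "norm z < rad N"
  shows "T' z * (1 - R z) = S z"
proof -
  have "((\<lambda>z. 1 + z * h N z) has_field_derivative (h N z + z * (T' z * h (N - 1) z + K N z))) (at z)"
    using N2 h_has_field_derivative[OF assms, of N] by (auto intro!: derivative_eq_intros)
  moreover have "((\<lambda>z. 1 + z * h N z) has_field_derivative T' z) (at z)"
  proof (rule has_field_derivative_transform_within_open[OF has_field_derivative_tgf[OF assms]])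
    show "open (ball (0::complex) (rad N))" by simp
    show "tgf N x = 1 + x * h N x" if "x \<in> ball 0 (rad N)" for x
      using that by (intro tgf_eq_h) simp
  qed (use assms in simp)
  ultimately have "T' z = h N z + z * (T' z * h (N - 1) z + K N z)" by (rule DERIV_unique[rotated])
  then show ?thesis unfolding S_def R_def by (simp add: algebra_simps)
qed

lemma R_has_field_derivative:
  assumes "norm z < rad N"
  shows "(R has_field_derivative (Q z + z * h (N - 2) z * T' z)) (at z)"
proof -
  have "((\<lambda>z. z * h (N - 1) z) has_field_derivative (h (N - 1) z + z * (T' z * h (N - 1 - 1) z + K (N - 1) z))) (at z)"
    using N2 h_has_field_derivative[OF assms, of "N - 1"] by (auto intro!: derivative_eq_intros)
  moreover have "N - 1 - 1 = N - 2" by simp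
  ultimately show ?thesis unfolding R_def Q_def by (simp add: algebra_simps)
qed

text \<open>The sign arguments at the radius take place on the positive axis; \<open>K\<close>,
  \<open>S\<close> and \<open>R\<close> are complex functions and have to be recognised there as
  real with a definite sign.\<close>

lemma K_real:
  assumes "0 \<le> x" "x \<le> rad N"
  obtains t where "K k (of_real x) = of_real t" "0 \<le> t"
proof -
  have "\<exists>t. T' (of_real (x ^ j)) = of_real t \<and> 0 \<le> t" if "2 \<le> j" for j
  proof -
    have "x ^ j \<le> rad N ^ j" using norm_power_le_rad[of x j] that assms by simp
    then have "x ^ j < rad N" using rad_power_less[OF that] by linarith
    then obtain t where "T' (of_real (x ^ j)) = of_real t" "1 \<le> t" using T'_real[of "x ^ j"] assms by auto
    then show ?thesis by force
  qed
  then obtain t where t: "\<And>j. 2 \<le> j \<Longrightarrow> T' (of_real (x ^ j)) = of_real (t j) \<and> 0 \<le> t j" by metis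
  have "K k (of_real x) = of_real (\<Sum>j=2..k. x ^ (j - 1) * t j * h (k - j) x)"
    unfolding K_def using t h_of_real[OF assms, where 'a=complex] by (auto intro!: sum.cong)
  moreover have "0 \<le> (\<Sum>j=2..k. x ^ (j - 1) * t j * h (k - j) x)"
    using t h_real_pos[OF assms] assms by (intro sum_nonneg mult_nonneg_nonneg) (auto simp: less_imp_le)
  ultimately show ?thesis using that by blast
qed

lemma S_real:
  assumes "0 \<le> x" "x \<le> rad N"
  obtains t where "S (of_real x) = of_real t" "0 < t"
proof -
  obtain t where "K N (of_real x) = of_real t" "0 \<le> t" using K_real assms by blast
  then have "S (of_real x) = of_real (h N x + x * t)" "0 < h N x + x * t"
    using h_real_pos[OF assms, of N] assms h_of_real[OF assms, of N, where 'a=complex]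
    by (auto simp: S_def intro!: add_pos_nonneg)
  then show ?thesis using that by blast
qed

lemma R_real: "0 \<le> x \<Longrightarrow> x \<le> rad N \<Longrightarrow> R (of_real x) = of_real (x * h (N - 1) x)"
  using h_of_real[of x "N - 1", where 'a=complex] by (simp add: R_def)

text \<open>In T' (1 - R) = S both T' and S are positive on the real segment, so 1 - R is positive
  too.\<close>

lemma R_less_1:
  assumes "0 \<le> x" "x < rad N"
  shows "x * h (N - 1) x < 1"
proof -
  obtain t where t: "T' (of_real x) = of_real t" "1 \<le> t" using T'_real assms by blast
  obtain s where s: "S (of_real x) = of_real s" "0 < s" using S_real[of x] assms by auto
  have "complex_of_real (t * (1 - x * h (N - 1) x)) = of_real s"
    using T'_eq[of "of_real x"] assms R_real[of x] t s by simp
  then have "t * (1 - x * h (N - 1) x) = s" using of_real_eq_iff by blast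
  then show ?thesis using s t by (smt (verit) mult_nonneg_nonpos)
qed

lemma R_rad_le_1: "rad N * h (N - 1) (rad N) \<le> 1"
proof -
  have "continuous_on (cball 0 (rad N)) (\<lambda>x. x * h (N - 1) x :: real)"
    by (intro continuous_intros continuous_on_h)
  then have "continuous_on {0..rad N} (\<lambda>x. x * h (N - 1) x :: real)"
    by (rule continuous_on_subset) auto
  then have "((\<lambda>x. x * h (N - 1) x :: real) \<longlongrightarrow> rad N * h (N - 1) (rad N)) (at_left (rad N))"
    using rad_pos by (rule continuous_on_Icc_at_leftD)
  moreover have "\<forall>\<^sub>F x in at_left (rad N). x * h (N - 1) x \<le> 1"
    using eventually_at_left_real[OF rad_pos] by eventually_elim (use R_less_1 in \<open>auto simp: less_imp_le\<close>)
  ultimately show ?thesis by (rule tendsto_upperbound) simp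
qed

text \<open>Were the value smaller, the recursion for the truncated series would have a supersolution
  at some point beyond the radius.\<close>

lemma R_rad: "rad N * h (N - 1) (rad N) = 1"
proof (rule ccontr)
  assume "rad N * h (N - 1) (rad N) \<noteq> 1"
  then have less: "rad N * h (N - 1) (rad N) < 1" using R_rad_le_1 by simp
  let ?a = "rad N" and ?T = "tgf N (rad N)"
  \<comment> \<open>The unknown \<open>y\<close> replaces only the value of the series at
    \<open>x\<close>; the power sums with \<open>j \<ge> 2\<close> keep their true values. The
    derivative of \<open>?\<phi>\<close> at \<open>?T\<close> is R - 1 < 0, so slightly above
    \<open>?T\<close> the supersolution inequality is strict and survives a small increase of
    \<open>x\<close>.\<close>
  let ?s = "\<lambda>x y j. if j = 1 then y else tgf N (x ^ j)"
  let ?\<phi> = "\<lambda>y. 1 + ?a * newton (?s ?a y) N - y"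
  have s1: "newton (?s ?a ?T) k = h k ?a" for k
    unfolding h_def by (rule newton_cong) auto
  have "((\<lambda>y. newton (\<lambda>j. ?s ?a y j) N) has_field_derivative
      (\<Sum>j=1..N. (if j = 1 then 1 else 0) / of_nat j * newton (?s ?a ?T) (N - j))) (at ?T)"
    by (rule newton_has_field_derivative) (auto intro!: derivative_eq_intros)
  also have "(\<Sum>j=1..N. (if j = 1 then 1 else 0) / of_nat j * newton (?s ?a ?T) (N - j)) = h (N - 1) ?a"
    using N2 unfolding s1 by (subst sum.atLeast_Suc_atMost) auto
  finally have "(?\<phi> has_field_derivative (?a * h (N - 1) ?a - 1)) (at ?T)"
    by (auto intro!: derivative_eq_intros)
  moreover have "?a * h (N - 1) ?a - 1 < 0" using less by simp
  ultimately obtain d where d: "d > 0" "\<And>e. 0 < e \<Longrightarrow> e < d \<Longrightarrow> ?\<phi> (?T + e) < ?\<phi> ?T"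
    using DERIV_neg_dec_right by blast
  have \<phi>0: "?\<phi> ?T = 0" unfolding s1 using tgf_eq_h[of ?a] rad_pos by simp
  define y where "y = ?T + d / 2"
  have "0 < d / 2" "d / 2 < d" using d(1) by auto
  from d(2)[OF this] have y: "?\<phi> y < 0" unfolding \<phi>0 y_def .
  have y1: "1 \<le> y" using tgf_real_ge_1[of ?a] rad_pos d by (simp add: y_def)
  let ?\<psi> = "\<lambda>x. 1 + x * newton (\<lambda>j. ?s x y j) N - y"
  \<comment> \<open>Up to the square root of the radius, all powers \<open>x ^ j\<close> with
    \<open>j \<ge> 2\<close> stay within the disc of convergence.\<close>
  define b where "b = sqrt ?a"
  have b: "0 < b" "b < 1" "?a < b" "b ^ 2 = ?a"
    using rad_pos rad_less_1 real_less_rsqrt[of ?a ?a] rad_power_less[of 2]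
    by (auto simp: b_def real_sqrt_lt_1_iff)
  have bj: "x ^ j \<le> ?a" if "0 \<le> x" "x \<le> b" "2 \<le> j" for x j
  proof -
    have "x ^ j \<le> b ^ j" using that by (intro power_mono)
    also have "\<dots> \<le> b ^ 2" using that b by (intro power_decreasing) auto
    finally show ?thesis using b by simp
  qed
  have cont: "continuous_on {0..b} ?\<psi>"
  proof (intro continuous_intros continuous_on_newton)
    fix j :: nat assume j: "1 \<le> j"
    have "continuous_on {0..b} (\<lambda>x. tgf N (x ^ j) :: real)" if "2 \<le> j"
      by (rule continuous_on_compose2[OF continuous_on_tgf])
         (use bj that in \<open>auto intro!: continuous_intros\<close>)
    then show "continuous_on {0..b} (\<lambda>x. if j = 1 then y else tgf N (x ^ j))" using j by (cases "j = 1") auto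
  qed
  have "((\<lambda>x. ?\<psi> x) \<longlongrightarrow> ?\<psi> ?a) (at ?a within {0..b})"
    using cont rad_pos b(3) by (auto simp: continuous_on_def)
  then have "((\<lambda>x. ?\<psi> x) \<longlongrightarrow> ?\<psi> ?a) (at ?a)"
    using at_within_interior[of ?a "{0..b}"] rad_pos b(3) by simp
  then have "\<forall>\<^sub>F x in at ?a. ?\<psi> x < 0" using y by (rule order_tendstoD)
  then have "\<forall>\<^sub>F x in at_right ?a. ?\<psi> x < 0" by (simp add: eventually_at_split)
  moreover have "\<forall>\<^sub>F x in at_right ?a. ?a < x \<and> x < b"
    using eventually_at_right_real[OF b(3)] by eventually_elim auto
  ultimately have ev: "\<forall>\<^sub>F x in at_right ?a. ?\<psi> x < 0 \<and> ?a < x \<and> x < b" by eventually_elim auto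
  obtain x where x: "?\<psi> x < 0" "?a < x" "x < b"
    using eventually_happens'[OF trivial_limit_at_right_real ev] by blast
  have "tpart N M x \<le> y" for M
  proof -
    have "tpart N M x \<le> ?s x y 1"
    proof (rule tpart_le_supersolution_1[where s="?s x y"])
      fix j M assume j: "2 \<le> j" "j \<le> N"
      have "tpart N M (x ^ j) \<le> tgf N (x ^ j)"
        using bj[of x j] x rad_pos j by (intro tpart_le_tgf) (auto simp: summable_iff_le_rad)
      then show "tpart N M (x ^ j) \<le> ?s x y j" using j by simp
    qed (use x y1 rad_pos in auto)
    then show ?thesis by simp
  qed
  then have "summable (\<lambda>n. real (tcount N n) * x ^ n)"
    using summable_iff_tpart_bounded[of x] x rad_pos by auto
  then show False using rad_upper[of x] x rad_pos by auto
qed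

end

section \<open>Square-root singularity at the radius of convergence\<close>

context regular_trees begin

definition dl :: "complex \<Rightarrow> real" where
  "dl z = norm (1 - z / of_real (rad N))"

text \<open>Growth of order \<open>e\<close> at the singular point, or a zero if \<open>e\<close> is
  negative. The bound is demanded on the whole open disc, so that it can be inserted into Cauchy
  integrals over circles.\<close>

definition Ord :: "real \<Rightarrow> (complex \<Rightarrow> complex) \<Rightarrow> bool" where
  "Ord e g \<longleftrightarrow> (\<exists>C. \<forall>z. norm z < rad N \<longrightarrow> norm (g z) \<le> C * dl z powr (- e))"

lemma norm_diff_eq_dl: "norm (z - of_real (rad N)) = rad N * dl z"
proof -
  have "z - of_real (rad N) = - (of_real (rad N) * (1 - z / of_real (rad N)))"
    using rad_pos by (simp add: field_simps)
  then have "norm (z - of_real (rad N)) = norm (of_real (rad N) * (1 - z / of_real (rad N)))"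
    by (simp only: norm_minus_cancel)
  then show ?thesis using rad_pos by (simp add: norm_mult dl_def)
qed

lemma dl_le_2: "norm z < rad N \<Longrightarrow> dl z \<le> 2"
  unfolding dl_def using norm_triangle_ineq4[of 1 "z / of_real (rad N)"] rad_pos
  by (simp add: norm_divide field_simps)

lemma dl_pos: "norm z < rad N \<Longrightarrow> 0 < dl z"
  using rad_pos by (auto simp: dl_def)

lemma OrdI: "(\<And>z. norm z < rad N \<Longrightarrow> norm (g z) \<le> C * dl z powr (- e)) \<Longrightarrow> Ord e g"
  unfolding Ord_def by blast

lemma OrdE:
  assumes "Ord e g"
  obtains C where "0 \<le> C" "\<And>z. norm z < rad N \<Longrightarrow> norm (g z) \<le> C * dl z powr (- e)"
proof -
  obtain C where C: "\<And>z. norm z < rad N \<Longrightarrow> norm (g z) \<le> C * dl z powr (- e)"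
    using assms by (auto simp: Ord_def)
  have "norm (g z) \<le> \<bar>C\<bar> * dl z powr (- e)" if "norm z < rad N" for z
    by (rule order_trans[OF C[OF that]]) (auto intro!: mult_right_mono)
  then show ?thesis using that[of "\<bar>C\<bar>"] by auto
qed

lemma Ord_mult:
  assumes "Ord e f" "Ord e' g"
  shows "Ord (e + e') (\<lambda>z. f z * g z)"
proof -
  obtain C where C: "0 \<le> C" "\<And>z. norm z < rad N \<Longrightarrow> norm (f z) \<le> C * dl z powr (- e)"
    using assms OrdE by blast
  obtain D where D: "0 \<le> D" "\<And>z. norm z < rad N \<Longrightarrow> norm (g z) \<le> D * dl z powr (- e')"
    using assms OrdE by blast
  have "norm (f z * g z) \<le> (C * D) * dl z powr (- (e + e'))" if z: "norm z < rad N" for z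
  proof -
    have "norm (f z * g z) \<le> (C * dl z powr (- e)) * (D * dl z powr (- e'))"
      unfolding norm_mult using C D z by (intro mult_mono) auto
    also have "\<dots> = (C * D) * dl z powr (- (e + e'))"
      using powr_add[of "dl z" "- e" "- e'"] by (simp add: mult_ac)
    finally show ?thesis .
  qed
  then show ?thesis by (rule OrdI)
qed

lemma Ord_add:
  assumes "Ord e f" "Ord e g"
  shows "Ord e (\<lambda>z. f z + g z)"
proof -
  obtain C where C: "\<And>z. norm z < rad N \<Longrightarrow> norm (f z) \<le> C * dl z powr (- e)"
    using assms OrdE by blast
  obtain D where D: "\<And>z. norm z < rad N \<Longrightarrow> norm (g z) \<le> D * dl z powr (- e)"
    using assms OrdE by blast
  have "norm (f z + g z) \<le> (C + D) * dl z powr (- e)" if z: "norm z < rad N" for z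
    using C[OF z] D[OF z] norm_triangle_ineq[of "f z" "g z"] by (simp add: distrib_right)
  then show ?thesis by (rule OrdI)
qed

lemma Ord_uminus: "Ord e f \<Longrightarrow> Ord e (\<lambda>z. - f z)"
  by (simp add: Ord_def)

text \<open>As \<open>dl\<close> ranges up to 2 and not 1, passing to a larger order costs the
  factor \<open>2 powr (e' - e)\<close>.\<close>

lemma Ord_mono:
  assumes "Ord e f" "e \<le> e'"
  shows "Ord e' f"
proof -
  obtain C where C: "0 \<le> C" "\<And>z. norm z < rad N \<Longrightarrow> norm (f z) \<le> C * dl z powr (- e)"
    using assms OrdE by blast
  have "norm (f z) \<le> (C * 2 powr (e' - e)) * dl z powr (- e')" if z: "norm z < rad N" for z
  proof -
    have "dl z powr (- e) = dl z powr (e' - e) * dl z powr (- e')" by (simp flip: powr_add)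
    also have "\<dots> \<le> 2 powr (e' - e) * dl z powr (- e')"
      using dl_le_2[OF z] dl_pos[OF z] assms by (intro mult_right_mono powr_mono2) auto
    finally show ?thesis using C(2)[OF z] mult_left_mono[OF _ C(1)] by (force simp: mult.assoc)
  qed
  then show ?thesis by (rule OrdI)
qed

lemma Ord_cong: "Ord e f \<Longrightarrow> (\<And>z. norm z < rad N \<Longrightarrow> f z = g z) \<Longrightarrow> Ord e g"
  unfolding Ord_def by metis

lemma Ord_0I: "(\<And>z. norm z < rad N \<Longrightarrow> norm (g z) \<le> C) \<Longrightarrow> Ord 0 g"
  by (rule OrdI[of _ C]) (use dl_pos in force)

lemma Ord_const: "Ord 0 (\<lambda>_. c)"
  by (rule Ord_0I[of _ "norm c"]) simp

lemma Ord_continuous: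
  assumes "continuous_on (cball 0 (rad N)) f"
  shows "Ord 0 f"
proof -
  have "compact (f ` cball 0 (rad N))" using assms by (intro compact_continuous_image) auto
  then obtain C where "\<And>z. norm z \<le> rad N \<Longrightarrow> norm (f z) \<le> C"
    using compact_imp_bounded bounded_iff by (metis image_eqI mem_cball_0)
  then show ?thesis by (intro Ord_0I[of f C]) auto
qed

lemma norm_segment_less:
  fixes z :: complex
  assumes "norm z < rad N" "0 < s" "s < 1"
  shows "norm (of_real (rad N) + of_real s * (z - of_real (rad N))) < rad N"
proof -
  let ?a = "complex_of_real (rad N)"
  have "?a + of_real s * (z - ?a) = of_real (1 - s) * ?a + of_real s * z" by (simp add: algebra_simps)
  then have "norm (?a + of_real s * (z - ?a)) \<le> (1 - s) * rad N + s * norm z"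
    using norm_triangle_ineq[of "of_real (1 - s) * ?a" "of_real s * z"] assms rad_pos
    by (simp add: norm_mult del: of_real_diff)
  also have "\<dots> < (1 - s) * rad N + s * rad N" using assms by (intro add_strict_left_mono mult_strict_left_mono) auto
  finally show ?thesis by (simp add: algebra_simps)
qed

text \<open>Integration along the segment from the singular point to \<open>z\<close>, which lies in
  the open disc by convexity. The derivative may be unbounded at the start; the comparison function
  s^(1 - e) absorbs this, which is why \<open>e < 1\<close> is required.\<close>

lemma segment_bound:
  assumes z: "norm z < rad N" and cont: "continuous_on (cball 0 (rad N)) f"
    and der: "\<And>z. norm z < rad N \<Longrightarrow> (f has_field_derivative f1 z) (at z)"
    and e: "e < 1" and "0 \<le> B"
    and bound: "\<And>s. 0 < s \<Longrightarrow> s < 1 \<Longrightarrow>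
       norm (f1 (of_real (rad N) + of_real s * (z - of_real (rad N)))) \<le> B * (s * dl z) powr (- e)"
  shows "norm (f z - f (of_real (rad N))) \<le> B * rad N / (1 - e) * dl z powr (1 - e)"
proof -
  let ?a = "complex_of_real (rad N)"
  let ?w = "\<lambda>s. ?a + of_real s * (z - ?a)"
  have w: "norm (?w s) \<le> rad N" if "0 \<le> s" "s \<le> 1" for s
  proof -
    have "?w s = of_real (1 - s) * ?a + of_real s * z" by (simp add: algebra_simps)
    then have "norm (?w s) \<le> (1 - s) * rad N + s * norm z"
      using norm_triangle_ineq[of "of_real (1 - s) * ?a" "of_real s * z"] that rad_pos
      by (simp add: norm_mult del: of_real_diff)
    also have "\<dots> \<le> (1 - s) * rad N + s * rad N" using z that by (intro add_mono mult_left_mono) auto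
    finally show ?thesis by (simp add: algebra_simps)
  qed
  have w': "norm (?w s) < rad N" if "0 < s" "s < 1" for s by (rule norm_segment_less[OF z that])
  let ?\<phi> = "\<lambda>s. B * rad N / (1 - e) * dl z powr (1 - e) * s powr (1 - e)"
  have "norm (f (?w 1) - f (?w 0)) \<le> ?\<phi> 1 - ?\<phi> 0"
  proof (rule differentiable_bound_general[where a=0 and b=1 and f="\<lambda>s. f (?w s)" and \<phi>="?\<phi>"])
    show "continuous_on {0..1} (\<lambda>s. f (?w s))"
      by (rule continuous_on_compose2[OF cont]) (use w in \<open>auto intro!: continuous_intros\<close>)
    show "continuous_on {0..1} ?\<phi>" using e by (intro continuous_intros continuous_on_powr') auto
    fix s :: real assume s: "0 < s" "s < 1"
    have "((\<lambda>x. ?w (of_real x)) has_vector_derivative (z - ?a)) (at s)"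
      by (auto intro!: derivative_eq_intros simp: has_vector_derivative_def scaleR_conv_of_real)
    from field_vector_diff_chain_at[OF this, of f "f1 (?w s)"] der[OF w'[OF s]]
    show "((\<lambda>s. f (?w s)) has_vector_derivative (z - ?a) * f1 (?w s)) (at s)"
      by (simp add: o_def)
    show "(?\<phi> has_vector_derivative (B * rad N * dl z powr (1 - e) * s powr (- e))) (at s)"
      unfolding has_real_derivative_iff_has_vector_derivative[symmetric]
      using DERIV_cmult[OF has_real_derivative_powr[OF s(1), of "1 - e"], of "B * rad N / (1 - e) * dl z powr (1 - e)"] e
      by (simp add: mult.assoc)
    have "norm ((z - ?a) * f1 (?w s)) \<le> (rad N * dl z) * (B * (s * dl z) powr (- e))"
      unfolding norm_mult norm_diff_eq_dl using bound[OF s] rad_pos dl_pos[OF z] by (intro mult_left_mono) auto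
    also have "\<dots> = B * rad N * dl z powr (1 - e) * s powr (- e)"
      using s dl_pos[OF z] by (simp add: powr_mult powr_diff powr_minus field_simps)
    finally show "norm ((z - ?a) * f1 (?w s)) \<le> B * rad N * dl z powr (1 - e) * s powr (- e)" .
  qed simp
  then show ?thesis using e by simp
qed

lemma dl_segment:
  assumes "0 < s"
  shows "dl (of_real (rad N) + of_real s * (z - of_real (rad N))) = s * dl z"
proof -
  have "rad N * dl (of_real (rad N) + of_real s * (z - of_real (rad N))) = rad N * (s * dl z)"
    unfolding norm_diff_eq_dl[symmetric] using assms by (simp add: norm_mult norm_diff_eq_dl mult_ac)
  then show ?thesis using rad_pos by simp
qed

lemma Ord_integrate:
  assumes cont: "continuous_on (cball 0 (rad N)) f"
    and der: "\<And>z. norm z < rad N \<Longrightarrow> (f has_field_derivative f1 z) (at z)"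
    and e: "e < 1" and "Ord e f1"
  shows "Ord (e - 1) (\<lambda>z. f z - f (of_real (rad N)))"
proof -
  obtain C where C: "0 \<le> C" "\<And>z. norm z < rad N \<Longrightarrow> norm (f1 z) \<le> C * dl z powr (- e)"
    using assms OrdE by blast
  have "norm (f z - f (of_real (rad N))) \<le> C * rad N / (1 - e) * dl z powr (- (e - 1))" if z: "norm z < rad N" for z
  proof -
    have "norm (f z - f (of_real (rad N))) \<le> C * rad N / (1 - e) * dl z powr (1 - e)"
      using C(2)[OF norm_segment_less[OF z]] dl_segment
      by (intro segment_bound[OF z cont der e C(1)]) auto
    then show ?thesis by simp
  qed
  then show ?thesis by (rule OrdI)
qed

text \<open>As rad < 1, |z^j| \<le> rad^j < rad, so T' is used only on a compact part of its open
  disc.\<close>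

lemma continuous_on_T'_power:
  assumes "2 \<le> j"
  shows "continuous_on (cball 0 (rad N)) (\<lambda>z. T' (z ^ j))"
proof (rule continuous_on_compose2[OF holomorphic_on_imp_continuous_on[OF holomorphic_T']])
  show "(\<lambda>z::complex. z ^ j) ` cball 0 (rad N) \<subseteq> ball 0 (rad N)"
    using le_less_trans[OF norm_power_le_rad[where 'a=complex] rad_power_less[OF assms]] assms
    by (auto simp: dist_norm)
qed (auto intro!: continuous_intros)

lemma continuous_on_K: "continuous_on (cball 0 (rad N)) (K k)"
  unfolding K_def by (intro continuous_intros continuous_on_h continuous_on_T'_power) auto

lemma continuous_on_S: "continuous_on (cball 0 (rad N)) S"
  unfolding S_def by (intro continuous_intros continuous_on_h continuous_on_K)

lemma continuous_on_R: "continuous_on (cball 0 (rad N)) R"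
  unfolding R_def by (intro continuous_intros continuous_on_h)

lemma continuous_on_P: "continuous_on (cball 0 (rad N)) P"
  unfolding P_def by (intro continuous_intros continuous_on_h continuous_on_S)

lemma continuous_on_Q: "continuous_on (cball 0 (rad N)) Q"
  unfolding Q_def by (intro continuous_intros continuous_on_h continuous_on_K)

text \<open>\<open>E\<close> vanishes at the radius, but its square has the derivative
  \<open>- 2 * V\<close> with \<open>V\<close> continuous on the closed disc and positive at the
  radius: this is the square-root singularity.\<close>

definition E where "E z = 1 - R z"
definition G where "G z = 1 / E z"
definition V where "V z = E z * Q z + P z"

lemma continuous_on_E: "continuous_on (cball 0 (rad N)) E"
  unfolding E_def by (intro continuous_intros continuous_on_R)

lemma continuous_on_V: "continuous_on (cball 0 (rad N)) V"
  unfolding V_def by (intro continuous_intros continuous_on_E continuous_on_Q continuous_on_P)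

lemma E_rad: "E (of_real (rad N)) = 0"
  unfolding E_def using R_real[of "rad N"] R_rad rad_pos by (simp del: of_real_mult)

lemma P_rad: obtains p where "P (of_real (rad N)) = of_real p" "0 < p"
proof -
  obtain s where "S (of_real (rad N)) = of_real s" "0 < s" using S_real[of "rad N"] rad_pos by auto
  then have "P (of_real (rad N)) = of_real (rad N * h (N - 2) (rad N) * s)" "0 < rad N * h (N - 2) (rad N) * s"
    using h_of_real[of "rad N" "N - 2", where 'a=complex] h_real_pos[of "rad N" "N - 2"] rad_pos
    by (auto simp: P_def)
  then show ?thesis using that by blast
qed

text \<open>Aperiodicity of the series: only \<open>z = rad N\<close> gives the full modulus on the closed disc.\<close>

lemma norm_tgf_gap:
  obtains c where "0 < c" "\<And>z::complex. norm z \<le> rad N \<Longrightarrow> norm (tgf N z) \<le> tgf N (rad N) - c * (rad N - Re z)"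
proof
  let ?r = "rad N" and ?t = "real (tcount N 1)"
  have t: "1 \<le> ?t" using tcount_pos[of N 1] N2 by simp
  let ?c = "?t / (1 + ?t * ?r)"
  show "0 < ?c" using t rad_pos by (intro divide_pos_pos add_pos_pos mult_pos_pos) auto
  fix z :: complex assume z: "norm z \<le> ?r"
  let ?f = "\<lambda>n. of_nat (tcount N n) * z ^ n" and ?g = "\<lambda>n. real (tcount N n) * ?r ^ n"
  have sg: "summable ?g" by (rule summable_rad)
  have fg: "norm (?f n) \<le> ?g n" for n
    using z by (auto simp: norm_mult norm_power intro!: mult_left_mono power_mono)
  have sf: "summable ?f" by (rule summable_comparison_test'[OF sg]) (use fg in auto)
  \<comment> \<open>Two consecutive positive coefficients suffice for the gap: the terms of order 0
    and 1 are compared exactly, the tail only by its modulus.\<close>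
  have "tgf N z = (\<Sum>n. ?f (n + 2)) + (\<Sum>i<2. ?f i)" unfolding tgf_def by (rule suminf_split_initial_segment[OF sf])
  then have "norm (tgf N z) \<le> norm (\<Sum>n. ?f (n + 2)) + norm (\<Sum>i<2. ?f i)"
    by (simp add: norm_triangle_ineq)
  also have "norm (\<Sum>n. ?f (n + 2)) \<le> (\<Sum>n. ?g (n + 2))"
    by (rule norm_suminf_le[OF fg summable_ignore_initial_segment[OF sg]])
  also have "(\<Sum>n. ?g (n + 2)) = tgf N ?r - (1 + ?t * ?r)"
    using suminf_split_initial_segment[OF sg, of 2] by (simp add: tgf_def numeral_2_eq_2)
  also have "norm (\<Sum>i<2. ?f i) = norm (1 + of_real ?t * z)" by (simp add: numeral_2_eq_2)
  also have "norm (1 + of_real ?t * z) \<le> (1 + ?t * ?r) - ?c * (?r - Re z)"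
  proof -
    \<comment> \<open>The difference of the moduli is read off from that of their squares, using
      \<open>?u + ?v \<le> 2 * ?u\<close>; this produces the constant \<open>?c\<close>.\<close>
    let ?u = "1 + ?t * ?r" and ?v = "norm (1 + of_real ?t * z)"
    have u: "0 < ?u" using t rad_pos by (intro add_pos_pos mult_pos_pos) auto
    have vu: "?v \<le> ?u"
      using norm_triangle_ineq[of 1 "of_real ?t * z"] z mult_left_mono[of "norm z" ?r ?t] by (simp add: norm_mult)
    have "(norm (1 + of_real t * z))\<^sup>2 = 1 + 2 * t * Re z + t\<^sup>2 * (norm z)\<^sup>2" for t
      by (simp only: cmod_power2) (simp add: power2_eq_square algebra_simps)
    then have "?v\<^sup>2 = 1 + 2 * ?t * Re z + ?t\<^sup>2 * (norm z)\<^sup>2" .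
    also have "\<dots> \<le> 1 + 2 * ?t * Re z + ?t\<^sup>2 * ?r\<^sup>2"
      using z by (intro add_left_mono mult_left_mono power_mono) auto
    finally have "2 * ?t * (?r - Re z) \<le> ?u\<^sup>2 - ?v\<^sup>2"
      by (simp add: power2_eq_square algebra_simps)
    also have "\<dots> = (?u - ?v) * (?u + ?v)" by (simp add: power2_eq_square algebra_simps)
    also have "\<dots> \<le> (?u - ?v) * (2 * ?u)"
    proof (rule mult_left_mono)
      show "?u + ?v \<le> 2 * ?u" using add_left_mono[OF vu, of ?u] by (simp only: mult_2)
      show "0 \<le> ?u - ?v" using vu by (simp only: diff_ge_0_iff_ge)
    qed
    finally have Q: "2 * ?t * (?r - Re z) \<le> (?u - ?v) * (2 * ?u)" .
    have "t * x \<le> y * u" if "2 * t * x \<le> y * (2 * u)" for t x y u :: real using that by simp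
    from this[OF Q] have "?t * (?r - Re z) \<le> (?u - ?v) * ?u" .
    then have "?t * (?r - Re z) / ?u \<le> ?u - ?v" using u by (simp add: pos_divide_le_eq)
    then show ?thesis by simp
  qed
  finally show "norm (tgf N z) \<le> tgf N ?r - ?c * (?r - Re z)" by simp
qed

text \<open>On the closed disc rad dl^2 / 2 \<le> rad - Re z, so the gap for |T| is quadratic in
  \<open>dl\<close>; \<open>newton_increment\<close> passes it on to |R|, and R is 1 at the
  radius.\<close>

lemma Re_E_gap:
  obtains c where "0 < c" "\<And>z::complex. norm z \<le> rad N \<Longrightarrow> c * (dl z)\<^sup>2 \<le> Re (E z)"
proof -
  let ?r = "rad N"
  obtain c where c: "0 < c" "\<And>z::complex. norm z \<le> ?r \<Longrightarrow> norm (tgf N z) \<le> tgf N ?r - c * (?r - Re z)"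
    using norm_tgf_gap by blast
  define c' where "c' = ?r * (c / real (N - 1) * h (N - 2) ?r) * (?r / 2)"
  have "0 < c'" unfolding c'_def using c(1) rad_pos h_real_pos[of ?r] N2 by auto
  moreover have "c' * (dl z)\<^sup>2 \<le> Re (E z)" if z: "norm z \<le> ?r" for z
  proof -
    let ?s = "\<lambda>j. norm (tgf N (z ^ j))" and ?s' = "\<lambda>j. tgf N (?r ^ j)"
    have N1: "N - 1 - 1 = N - 2" by simp
    have "newton ?s (N - 1) + (?s' 1 - ?s 1) / real (N - 1) * newton ?s' (N - 1 - 1) \<le> newton ?s' (N - 1)"
      using tgf_power_bound[OF z] N2 by (intro newton_increment) auto
    then have 1: "newton ?s (N - 1) + (?s' 1 - ?s 1) / real (N - 1) * h (N - 2) ?r \<le> h (N - 1) ?r"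
      unfolding h_def N1 .
    have "(norm z)\<^sup>2 \<le> ?r\<^sup>2" using z by (intro power_mono) auto
    then have "(Re z)\<^sup>2 + (Im z)\<^sup>2 \<le> ?r\<^sup>2" unfolding cmod_power2 .
    moreover have "(?r * dl z)\<^sup>2 = (?r - Re z)\<^sup>2 + (Im z)\<^sup>2"
      unfolding norm_diff_eq_dl[symmetric] cmod_power2 by (simp add: power2_eq_square algebra_simps)
    ultimately have "?r * (?r * (dl z)\<^sup>2) \<le> ?r * (2 * (?r - Re z))"
      by (simp add: power2_eq_square algebra_simps)
    then have d: "?r / 2 * (dl z)\<^sup>2 \<le> ?r - Re z"
      using mult_le_cancel_left_pos[OF rad_pos] by simp
    have "?r / 2 * (dl z)\<^sup>2 * c \<le> ?s' 1 - ?s 1"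
    proof -
      have "?r / 2 * (dl z)\<^sup>2 * c \<le> (?r - Re z) * c" using d c(1) by (intro mult_right_mono) auto
      also have "\<dots> \<le> ?s' 1 - ?s 1" using c(2)[OF z] by (simp add: mult.commute[of c])
      finally show ?thesis .
    qed
    then have "(?r / 2 * (dl z)\<^sup>2 * c) / real (N - 1) * h (N - 2) ?r \<le> (?s' 1 - ?s 1) / real (N - 1) * h (N - 2) ?r"
      using h_real_pos[of ?r "N - 2"] rad_pos by (intro mult_right_mono divide_right_mono) auto
    with 1 have "newton ?s (N - 1) \<le> h (N - 1) ?r - (?r / 2 * (dl z)\<^sup>2 * c) / real (N - 1) * h (N - 2) ?r"
      by linarith
    then have "?r * newton ?s (N - 1) \<le> ?r * (h (N - 1) ?r - (?r / 2 * (dl z)\<^sup>2 * c) / real (N - 1) * h (N - 2) ?r)"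
      using rad_pos by (intro mult_left_mono) auto
    also have "\<dots> = 1 - c' * (dl z)\<^sup>2"
      using R_rad by (simp add: c'_def right_diff_distrib mult_ac)
    finally have 2: "?r * newton ?s (N - 1) \<le> 1 - c' * (dl z)\<^sup>2" .
    have "norm (R z) \<le> ?r * newton ?s (N - 1)"
      unfolding R_def norm_mult h_def using z norm_newton_le[of "\<lambda>j. tgf N (z ^ j)" "N - 1"] rad_pos
      by (intro mult_mono) auto
    then have "Re (R z) \<le> 1 - c' * (dl z)\<^sup>2"
      using 2 complex_Re_le_cmod[of "R z"] by linarith
    then show ?thesis by (simp add: E_def)
  qed
  ultimately show ?thesis using that by blast
qed

lemma Re_E_pos: "norm z < rad N \<Longrightarrow> 0 < Re (E z)"
  by (rule Re_E_gap) (use dl_pos[of z] in \<open>smt (verit) zero_less_power mult_pos_pos\<close>)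

lemma E_nonzero: "norm z < rad N \<Longrightarrow> E z \<noteq> 0"
  using Re_E_pos by fastforce

lemma T'_eq_G: "norm z < rad N \<Longrightarrow> T' z = S z * G z"
  using T'_eq[of z] E_nonzero[of z] by (simp add: G_def E_def field_simps)

lemma R_DERIV:
  assumes "norm z < rad N"
  shows "(R has_field_derivative (Q z + P z * G z)) (at z)"
  using R_has_field_derivative[OF assms] T'_eq_G[OF assms] by (simp add: P_def mult_ac)

lemma E_DERIV:
  assumes "norm z < rad N"
  shows "(E has_field_derivative (- (Q z + P z * G z))) (at z)"
  unfolding E_def by (auto intro!: derivative_eq_intros R_DERIV[OF assms])

lemma E_square_DERIV:
  assumes "norm z < rad N"
  shows "((\<lambda>z. (E z)\<^sup>2) has_field_derivative (- 2 * V z)) (at z)"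
proof -
  have "((\<lambda>z. (E z)\<^sup>2) has_field_derivative (2 * E z * - (Q z + P z * G z))) (at z)"
    using DERIV_mult[OF E_DERIV[OF assms] E_DERIV[OF assms]] by (simp add: power2_eq_square algebra_simps)
  also have "2 * E z * - (Q z + P z * G z) = - 2 * V z"
    using E_nonzero[OF assms] by (simp add: V_def G_def field_simps)
  finally show ?thesis .
qed

text \<open>Near the singularity the mean value theorem applied to \<open>E\<^sup>2\<close> gives
  \<open>\<bar>E\<bar>\<^sup>2 \<ge> p \<bar>z - rad N\<bar>\<close>; elsewhere aperiodicity applies.\<close>

lemma E_lower: obtains c where "0 < c" "\<And>z. norm z < rad N \<Longrightarrow> c * dl z powr (1/2) \<le> norm (E z)"
proof -
  let ?r = "rad N" and ?a = "complex_of_real (rad N)"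
  obtain p where p: "P ?a = of_real p" "0 < p" using P_rad by blast
  obtain c where c: "0 < c" "\<And>z. norm z \<le> ?r \<Longrightarrow> c * (dl z)\<^sup>2 \<le> Re (E z)" using Re_E_gap by blast
  have Va: "V ?a = of_real p" by (simp add: V_def E_rad p)
  have "?a \<in> cball 0 ?r" using rad_pos by simp
  then obtain \<eta> where \<eta>: "\<eta> > 0" "\<And>w. norm w \<le> ?r \<Longrightarrow> dist w ?a < \<eta> \<Longrightarrow> dist (V w) (V ?a) < p / 2"
    using continuous_on_V[unfolded continuous_on_iff] p(2) by (metis half_gt_zero mem_cball_0)
  \<comment> \<open>The first value serves near the singular point, the second at distance at least
    \<eta>, where \<open>dl\<close> lies between \<eta> / rad and 2.\<close>
  define m where "m = min (sqrt (p * ?r)) (c * (\<eta> / ?r)\<^sup>2 / 2 powr (1/2))"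
  have m: "0 < m" unfolding m_def using p rad_pos c \<eta> by auto
  have "m * dl z powr (1/2) \<le> norm (E z)" if z: "norm z < ?r" for z
  proof (cases "?r * dl z < \<eta>")
    case True
    \<comment> \<open>The linear term removes the main part -2p of the derivative. What remains is
      at most p in modulus, so half of the slope survives.\<close>
    let ?f = "\<lambda>z. (E z)\<^sup>2 + 2 * of_real p * z"
    have "norm (?f z - ?f ?a) \<le> p * ?r / (1 - 0) * dl z powr (1 - 0)"
    proof (rule segment_bound[OF z])
      show "continuous_on (cball 0 ?r) ?f" by (intro continuous_intros continuous_on_E)
      show "(?f has_field_derivative (- 2 * V z + 2 * of_real p)) (at z)" if "norm z < ?r" for z
        using DERIV_add[OF E_square_DERIV[OF that] DERIV_cmult[OF DERIV_ident, of "2 * of_real p"]] by simp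
      fix s :: real assume s: "0 < s" "s < 1"
      let ?w = "?a + of_real s * (z - ?a)"
      have "dist ?w ?a = s * (?r * dl z)" using s by (simp add: dist_norm norm_mult norm_diff_eq_dl)
      also have "\<dots> \<le> 1 * (?r * dl z)" using s rad_pos dl_pos[OF z] by (intro mult_right_mono) auto
      finally have "dist (V ?w) (V ?a) < p / 2"
        using True norm_segment_less[OF z s] by (intro \<eta>) auto
      then have "norm (V ?w - of_real p) < p / 2" by (simp add: dist_norm Va)
      then have "norm (- 2 * (V ?w - of_real p)) \<le> p" unfolding norm_mult by simp
      moreover have "- 2 * V ?w + 2 * of_real p = - 2 * (V ?w - of_real p)" by (simp add: algebra_simps)
      ultimately show "norm (- 2 * V ?w + 2 * of_real p) \<le> p * (s * dl z) powr (- 0)"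
        using s dl_pos[OF z] by (simp only:) simp
    qed (use p in auto)
    then have 1: "norm ((E z)\<^sup>2 + 2 * of_real p * (z - ?a)) \<le> p * ?r * dl z"
      using dl_pos[OF z] by (simp add: E_rad algebra_simps)
    have "norm (2 * of_real p * (z - ?a)) = 2 * p * ?r * dl z"
      using p by (simp add: norm_mult norm_diff_eq_dl)
    then have "p * ?r * dl z \<le> norm ((E z)\<^sup>2)"
      using 1 norm_triangle_ineq4[of "(E z)\<^sup>2 + 2 * of_real p * (z - ?a)" "(E z)\<^sup>2"] by simp
    then have "sqrt (p * ?r * dl z) \<le> norm (E z)" by (simp add: norm_power real_le_lsqrt)
    moreover have "m * dl z powr (1/2) \<le> sqrt (p * ?r) * sqrt (dl z)"
      using dl_pos[OF z] by (auto simp: powr_half_sqrt m_def intro!: mult_right_mono)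
    ultimately show ?thesis by (simp add: real_sqrt_mult)
  next
    case False
    then have "\<eta> / ?r \<le> dl z" using rad_pos by (simp add: field_simps)
    then have "c * (\<eta> / ?r)\<^sup>2 \<le> c * (dl z)\<^sup>2" using c \<eta> rad_pos by (intro mult_left_mono power_mono) auto
    also have "\<dots> \<le> norm (E z)" using c(2)[of z] z complex_Re_le_cmod[of "E z"] by linarith
    finally have 1: "c * (\<eta> / ?r)\<^sup>2 \<le> norm (E z)" .
    have "m * dl z powr (1/2) \<le> c * (\<eta> / ?r)\<^sup>2 / 2 powr (1/2) * 2 powr (1/2)"
      using m dl_le_2[OF z] dl_pos[OF z] c by (intro mult_mono powr_mono2) (auto simp: m_def)
    with 1 show ?thesis by simp
  qed
  then show ?thesis using that m by blast
qed

lemma Ord_G: "Ord (1/2) G"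
proof -
  obtain c where c: "0 < c" "\<And>z. norm z < rad N \<Longrightarrow> c * dl z powr (1/2) \<le> norm (E z)" using E_lower by blast
  have "norm (G z) \<le> 1 / c * dl z powr (- (1/2))" if z: "norm z < rad N" for z
  proof -
    have "norm (G z) = 1 / norm (E z)" by (simp add: G_def norm_divide)
    also have "\<dots> \<le> 1 / (c * dl z powr (1/2))"
      using c dl_pos[OF z] E_nonzero[OF z] z by (intro divide_left_mono mult_pos_pos) auto
    finally show ?thesis using dl_pos[OF z] by (simp add: powr_minus field_simps)
  qed
  then show ?thesis by (rule OrdI)
qed

end

section \<open>Orders of growth of derivatives and the expansion of the third derivative\<close>

context regular_trees begin

definition der :: "(complex \<Rightarrow> complex) \<Rightarrow> (complex \<Rightarrow> complex) \<Rightarrow> bool" where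
  "der f f1 \<longleftrightarrow> (\<forall>z. norm z < rad N \<longrightarrow> (f has_field_derivative f1 z) (at z))"

text \<open>Functions behaving at the radius like a constant plus a multiple of the square root of
  the distance, as far as one derivative shows; \<open>tame2\<close> is the same for two
  derivatives. Both classes are closed under sums and products.\<close>

definition tame1 :: "(complex \<Rightarrow> complex) \<Rightarrow> bool" where
  "tame1 f \<longleftrightarrow> continuous_on (cball 0 (rad N)) f \<and> (\<exists>f1. der f f1 \<and> Ord (1/2) f1)"

definition tame2 :: "(complex \<Rightarrow> complex) \<Rightarrow> bool" where
  "tame2 f \<longleftrightarrow> continuous_on (cball 0 (rad N)) f \<and>
     (\<exists>f1 f2. der f f1 \<and> der f1 f2 \<and> Ord (1/2) f1 \<and> Ord (3/2) f2)"

lemma der_const: "der (\<lambda>_. c) (\<lambda>_. 0)" by (simp add: der_def)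
lemma der_add: "der f f1 \<Longrightarrow> der g g1 \<Longrightarrow> der (\<lambda>z. f z + g z) (\<lambda>z. f1 z + g1 z)"
  unfolding der_def by (blast intro: DERIV_add)

lemma der_mult: "der f f1 \<Longrightarrow> der g g1 \<Longrightarrow> der (\<lambda>z. f z * g z) (\<lambda>z. f1 z * g z + f z * g1 z)"
  unfolding der_def using DERIV_mult by (force simp: add.commute mult.commute)

lemma der_cong:
  assumes "der f f1" "\<And>z. norm z < rad N \<Longrightarrow> f z = g z" "\<And>z. norm z < rad N \<Longrightarrow> f1 z = g1 z"
  shows "der g g1"
  unfolding der_def
proof (intro allI impI)
  fix z :: complex assume z: "norm z < rad N"
  have "(g has_field_derivative f1 z) (at z)"
  proof (rule has_field_derivative_transform_within_open)
    show "(f has_field_derivative f1 z) (at z)" using assms z by (simp add: der_def)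
  qed (use z assms in \<open>auto intro: open_ball[of 0 "rad N"]\<close>)
  then show "(g has_field_derivative g1 z) (at z)" using assms z by simp
qed

lemma tame2_imp_tame1: "tame2 f \<Longrightarrow> tame1 f"
  unfolding tame1_def tame2_def by blast

lemma tame1_Ord: "tame1 f \<Longrightarrow> Ord 0 f"
  unfolding tame1_def by (blast intro: Ord_continuous)

lemma Ord_mult_0: "Ord e f \<Longrightarrow> Ord 0 g \<Longrightarrow> Ord e (\<lambda>z. f z * g z)" "Ord 0 g \<Longrightarrow> Ord e f \<Longrightarrow> Ord e (\<lambda>z. g z * f z)"
  using Ord_mult[of e f 0 g] Ord_mult[of 0 g e f] by simp_all

lemma Ord_0_half: "Ord 0 f \<Longrightarrow> Ord (1/2) f" by (rule Ord_mono) auto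

lemma tame1_const: "tame1 (\<lambda>_. c)"
  unfolding tame1_def using der_const[of c] Ord_0_half[OF Ord_const[of 0]] continuous_on_const by blast

lemma tame2_const: "tame2 (\<lambda>_. c)"
  unfolding tame2_def using der_const[of c] der_const[of 0] Ord_0_half[OF Ord_const[of 0]] Ord_mono[OF Ord_const[of 0], of "3/2"]
  by force

lemma tame1_add: assumes "tame1 f" "tame1 g" shows "tame1 (\<lambda>z. f z + g z)"
  using assms unfolding tame1_def by (blast intro: der_add Ord_add continuous_on_add)

lemma tame2_add: assumes "tame2 f" "tame2 g" shows "tame2 (\<lambda>z. f z + g z)"
proof -
  obtain f1 f2 where f: "continuous_on (cball 0 (rad N)) f" "der f f1" "der f1 f2" "Ord (1/2) f1" "Ord (3/2) f2"
    using assms(1) unfolding tame2_def by blast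
  obtain g1 g2 where g: "continuous_on (cball 0 (rad N)) g" "der g g1" "der g1 g2" "Ord (1/2) g1" "Ord (3/2) g2"
    using assms(2) unfolding tame2_def by blast
  show ?thesis unfolding tame2_def
    using der_add[OF f(2) g(2)] der_add[OF f(3) g(3)] Ord_add[OF f(4) g(4)] Ord_add[OF f(5) g(5)]
      continuous_on_add[OF f(1) g(1)] by blast
qed

lemma tame1_mult: assumes "tame1 f" "tame1 g" shows "tame1 (\<lambda>z. f z * g z)"
proof -
  obtain f1 where f: "continuous_on (cball 0 (rad N)) f" "der f f1" "Ord (1/2) f1"
    using assms(1) unfolding tame1_def by blast
  obtain g1 where g: "continuous_on (cball 0 (rad N)) g" "der g g1" "Ord (1/2) g1"
    using assms(2) unfolding tame1_def by blast
  have "Ord (1/2) (\<lambda>z. f1 z * g z + f z * g1 z)"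
    by (rule Ord_add[OF Ord_mult_0(1)[OF f(3) tame1_Ord[OF assms(2)]] Ord_mult_0(2)[OF tame1_Ord[OF assms(1)] g(3)]])
  then show ?thesis unfolding tame1_def using der_mult[OF f(2) g(2)] continuous_on_mult[OF f(1) g(1)] by blast
qed

lemma tame2_mult: assumes "tame2 f" "tame2 g" shows "tame2 (\<lambda>z. f z * g z)"
proof -
  obtain f1 f2 where f: "continuous_on (cball 0 (rad N)) f" "der f f1" "der f1 f2" "Ord (1/2) f1" "Ord (3/2) f2"
    using assms(1) unfolding tame2_def by blast
  obtain g1 g2 where g: "continuous_on (cball 0 (rad N)) g" "der g g1" "der g1 g2" "Ord (1/2) g1" "Ord (3/2) g2"
    using assms(2) unfolding tame2_def by blast
  have O0: "Ord 0 f" "Ord 0 g" using assms tame2_imp_tame1 tame1_Ord by auto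
  have O11: "Ord (3/2) (\<lambda>z. f1 z * g1 z)" using Ord_mono[OF Ord_mult[OF f(4) g(4)], of "3/2"] by simp
  have "Ord (3/2) (\<lambda>z. (f2 z * g z + f1 z * g1 z) + (f1 z * g1 z + f z * g2 z))"
    by (rule Ord_add[OF Ord_add[OF Ord_mult_0(1)[OF f(5) O0(2)] O11] Ord_add[OF O11 Ord_mult_0(2)[OF O0(1) g(5)]]])
  moreover have "Ord (1/2) (\<lambda>z. f1 z * g z + f z * g1 z)"
    by (rule Ord_add[OF Ord_mult_0(1)[OF f(4) O0(2)] Ord_mult_0(2)[OF O0(1) g(4)]])
  moreover have "der (\<lambda>z. f1 z * g z + f z * g1 z) (\<lambda>z. (f2 z * g z + f1 z * g1 z) + (f1 z * g1 z + f z * g2 z))"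
    using f g by (intro der_add der_mult)
  ultimately show ?thesis unfolding tame2_def using der_mult[OF f(2) g(2)] continuous_on_mult[OF f(1) g(1)] by blast
qed

lemma tame1_sum: "(\<And>i. i \<in> A \<Longrightarrow> tame1 (f i)) \<Longrightarrow> tame1 (\<lambda>z. \<Sum>i\<in>A. f i z)"
proof (induction A rule: infinite_finite_induct)
  case (insert x F)
  then show ?case using tame1_add[of "f x"] by simp
qed (auto simp: tame1_const)

lemma tame2_sum: "(\<And>i. i \<in> A \<Longrightarrow> tame2 (f i)) \<Longrightarrow> tame2 (\<lambda>z. \<Sum>i\<in>A. f i z)"
proof (induction A rule: infinite_finite_induct)
  case (insert x F)
  then show ?case using tame2_add[of "f x"] by simp
qed (auto simp: tame2_const)

lemma tame2_holomorphic:
  assumes f: "f holomorphic_on ball 0 r" and r: "rad N < r"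
  shows "tame2 f"
proof -
  have sub: "cball 0 (rad N) \<subseteq> ball 0 r" using r by auto
  have h1: "deriv f holomorphic_on ball 0 r" by (rule holomorphic_deriv[OF f open_ball])
  have h2: "deriv (deriv f) holomorphic_on ball 0 r" by (rule holomorphic_deriv[OF h1 open_ball])
  have c: "continuous_on (cball 0 (rad N)) g" if "g holomorphic_on ball 0 r" for g
    using continuous_on_subset[OF holomorphic_on_imp_continuous_on[OF that] sub] .
  have d: "der g (deriv g)" if "g holomorphic_on ball 0 r" for g
    unfolding der_def using r by (auto intro!: holomorphic_derivI[OF that open_ball])
  show ?thesis unfolding tame2_def
    using c[OF f] d[OF f] d[OF h1] Ord_0_half[OF Ord_continuous[OF c[OF h1]]]
      Ord_mono[OF Ord_continuous[OF c[OF h2]], of "3/2"] by auto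
qed

lemma tame2_id: "tame2 (\<lambda>z. z)"
  by (rule tame2_holomorphic[of _ "rad N + 1"]) (auto intro: holomorphic_intros)

text \<open>z^j stays within the disc as long as |z| is below the square root of rad, so this
  function is holomorphic across the circle of convergence of T.\<close>

lemma tame2_T'_power:
  assumes "2 \<le> j"
  shows "tame2 (\<lambda>z. z ^ (j - 1) * T' (z ^ j))"
proof (rule tame2_holomorphic)
  show "rad N < sqrt (rad N)"
    using rad_pos rad_less_1 real_less_rsqrt[of "rad N" "rad N"] rad_power_less[of 2] by simp
  have "norm (z ^ j) < rad N" if "norm z < sqrt (rad N)" for z :: complex
  proof -
    have "sqrt (rad N) \<le> 1" using rad_less_1 by (simp add: real_sqrt_le_1_iff)
    then have "norm z \<le> 1" using that by linarith
    then have "norm z ^ j \<le> norm z ^ 2" using that assms by (intro power_decreasing) auto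
    also have "\<dots> < (sqrt (rad N)) ^ 2" using that by (intro power_strict_mono) auto
    finally show ?thesis using rad_pos by (simp add: norm_power)
  qed
  then have "(T' \<circ> (\<lambda>z. z ^ j)) holomorphic_on ball 0 (sqrt (rad N))"
    by (intro holomorphic_on_compose_gen[OF _ holomorphic_T']) (auto intro!: holomorphic_intros)
  then show "(\<lambda>z. z ^ (j - 1) * T' (z ^ j)) holomorphic_on ball 0 (sqrt (rad N))"
    by (auto intro!: holomorphic_intros simp: o_def)
qed

lemma Ord_T': "Ord (1/2) T'"
  by (rule Ord_cong[OF Ord_mult_0(2)[OF Ord_continuous[OF continuous_on_S] Ord_G]]) (simp add: T'_eq_G)

lemma der_h: "1 \<le> k \<Longrightarrow> der (h k) (\<lambda>z. T' z * h (k - 1) z + K k z)"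
  unfolding der_def using h_has_field_derivative by blast

lemma tame1_h: "tame1 (h k)"
proof (cases "k = 0")
  case True
  have "h 0 = (\<lambda>_::complex. 1)" by (rule ext) simp
  then show ?thesis using tame1_const[of 1] True by simp
next
  case False
  have "Ord (1/2) (\<lambda>z. T' z * h (k - 1) z + K k z)"
    by (intro Ord_add Ord_mult_0 Ord_T' Ord_0_half Ord_continuous continuous_on_h continuous_on_K)
  then show ?thesis unfolding tame1_def using der_h[of k] continuous_on_h False by force
qed

lemma tame1_K: "tame1 (K k)"
  unfolding K_def by (intro tame1_sum tame1_mult tame1_h tame2_imp_tame1[OF tame2_T'_power]) auto

lemma tame1_S: "tame1 S"
  unfolding S_def by (intro tame1_add tame1_mult tame1_h tame1_K tame2_imp_tame1[OF tame2_id])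

lemma tame1_P: "tame1 P"
  unfolding P_def by (intro tame1_mult tame1_h tame1_S tame2_imp_tame1[OF tame2_id])

lemma tame1_Q: "tame1 Q"
  unfolding Q_def by (intro tame1_add tame1_mult tame1_h tame1_K tame2_imp_tame1[OF tame2_id])

lemma tame1_E: "tame1 E"
proof -
  have "tame1 (\<lambda>z. 1 + (-1) * (z * h (N - 1) z))"
    by (intro tame1_add tame1_mult tame1_h tame1_const tame2_imp_tame1[OF tame2_id])
  then show ?thesis unfolding E_def R_def by simp
qed

lemma tame1_V: "tame1 V"
  unfolding V_def by (intro tame1_add tame1_mult tame1_E tame1_P tame1_Q)

definition G1 where "G1 z = (G z)\<^sup>2 * (Q z + P z * G z)"

lemma der_G: "der G G1"
  unfolding der_def
proof (intro allI impI)
  fix z :: complex assume z: "norm z < rad N"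
  have "((\<lambda>z. 1 / E z) has_field_derivative G1 z) (at z)"
    using E_nonzero[OF z]
    by (auto intro!: derivative_eq_intros E_DERIV[OF z] simp: G1_def G_def power2_eq_square field_simps)
  then show "(G has_field_derivative G1 z) (at z)" unfolding G_def .
qed

lemma Ord_G2: "Ord 1 (\<lambda>z. (G z)\<^sup>2)"
  using Ord_mult[OF Ord_G Ord_G] by (simp add: power2_eq_square)

lemma Ord_QPG: "Ord (1/2) (\<lambda>z. Q z + P z * G z)"
  by (intro Ord_add Ord_mult_0 Ord_G Ord_0_half tame1_Ord[OF tame1_Q] tame1_Ord[OF tame1_P])

lemma Ord_G1: "Ord (3/2) G1"
  using Ord_mult[OF Ord_G2 Ord_QPG] by (simp add: G1_def[abs_def])

lemma der_T': obtains T2 where "der T' T2" "Ord (3/2) T2"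
proof -
  obtain S1 where S1: "der S S1" "Ord (1/2) S1" using tame1_S unfolding tame1_def by blast
  have "der T' (\<lambda>z. S1 z * G z + S z * G1 z)"
    by (rule der_cong[OF der_mult[OF S1(1) der_G]]) (auto simp: T'_eq_G)
  moreover have "Ord (3/2) (\<lambda>z. S1 z * G z + S z * G1 z)"
    using Ord_add[OF Ord_mono[OF Ord_mult[OF S1(2) Ord_G], of "3/2"] Ord_mult_0(2)[OF tame1_Ord[OF tame1_S] Ord_G1]]
    by simp
  ultimately show ?thesis using that by blast
qed

text \<open>A bootstrap: \<open>tame1\<close> for \<open>h\<close> gives \<open>tame1\<close> for
  \<open>S\<close>, \<open>P\<close> and \<open>Q\<close>, hence the order 3/2 of the derivatives of
  \<open>G\<close> and T', and these are what the second derivative of \<open>h\<close> consists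
  of.\<close>

lemma tame2_h: "tame2 (h k)"
proof (cases "k = 0")
  case True
  have "h 0 = (\<lambda>_::complex. 1)" by (rule ext) simp
  then show ?thesis using tame2_const[of 1] True by simp
next
  case False
  obtain T2 where T2: "der T' T2" "Ord (3/2) T2" using der_T' by blast
  obtain h1 where h1: "der (h (k - 1)) h1" "Ord (1/2) h1" using tame1_h unfolding tame1_def by blast
  obtain K1 where K1: "der (K k) K1" "Ord (1/2) K1" using tame1_K unfolding tame1_def by blast
  have "der (\<lambda>z. T' z * h (k - 1) z + K k z) (\<lambda>z. (T2 z * h (k - 1) z + T' z * h1 z) + K1 z)"
    by (intro der_add der_mult T2 h1 K1)
  moreover have "Ord (1/2) (\<lambda>z. T' z * h (k - 1) z + K k z)"
    by (intro Ord_add Ord_mult_0 Ord_T' Ord_0_half tame1_Ord tame1_h tame1_K)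
  moreover have "Ord (3/2) (\<lambda>z. (T2 z * h (k - 1) z + T' z * h1 z) + K1 z)"
    using Ord_add[OF Ord_add[OF Ord_mult_0(1)[OF T2(2) tame1_Ord[OF tame1_h]]
        Ord_mono[OF Ord_mult[OF Ord_T' h1(2)], of "3/2"]] Ord_mono[OF K1(2), of "3/2"]]
    by simp
  ultimately show ?thesis unfolding tame2_def using der_h[of k] continuous_on_h False by force
qed

lemma tame2_K: "tame2 (K k)"
  unfolding K_def by (intro tame2_sum tame2_mult tame2_h tame2_T'_power) auto

lemma tame2_S: "tame2 S"
  unfolding S_def by (intro tame2_add tame2_mult tame2_h tame2_K tame2_id)

lemma Ord_pow_G:
  "Ord (3/2) (\<lambda>z. G z ^ 3)" "Ord 2 (\<lambda>z. G z ^ 4)" "Ord (5/2) (\<lambda>z. G z ^ 5)"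
proof -
  show 3: "Ord (3/2) (\<lambda>z. G z ^ 3)" using Ord_mult[OF Ord_G2 Ord_G] by (simp add: eval_nat_numeral mult_ac)
  show 4: "Ord 2 (\<lambda>z. G z ^ 4)" using Ord_mult[OF Ord_G2 Ord_G2] by (simp add: eval_nat_numeral mult_ac)
  show "Ord (5/2) (\<lambda>z. G z ^ 5)" using Ord_mult[OF 4 Ord_G] by (simp add: eval_nat_numeral mult_ac)
qed

text \<open>The leading part of G' is P G^3, so that of G'' is 3 P^2 G^5. Every other term either
  contains \<open>Q\<close>, and with it one factor \<open>G\<close> less, or a derivative of
  \<open>S\<close>, \<open>P\<close> or \<open>Q\<close>; each alternative is weaker by at least
  half an order.\<close>

lemma T'_second_derivative:
  obtains T2 T3 where "der T' T2" "der T2 T3" "Ord 2 (\<lambda>z. T3 z - 3 * S z * (P z)\<^sup>2 * G z ^ 5)"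
proof -
  obtain S1 S2 where S: "der S S1" "der S1 S2" "Ord (1/2) S1" "Ord (3/2) S2"
    using tame2_S unfolding tame2_def by blast
  obtain P1 where P1: "der P P1" "Ord (1/2) P1" using tame1_P unfolding tame1_def by blast
  obtain Q1 where Q1: "der Q Q1" "Ord (1/2) Q1" using tame1_Q unfolding tame1_def by blast
  have O0: "Ord 0 S" "Ord 0 P" "Ord 0 Q" using tame1_Ord tame1_S tame1_P tame1_Q by auto
  let ?T2 = "\<lambda>z. S1 z * G z + S z * ((G z * G z) * (Q z + P z * G z))"
  let ?T3 = "\<lambda>z. (S2 z * G z + S1 z * G1 z) + (S1 z * ((G z * G z) * (Q z + P z * G z)) +
     S z * ((G1 z * G z + G z * G1 z) * (Q z + P z * G z) + (G z * G z) * (Q1 z + (P1 z * G z + P z * G1 z))))"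
  have "der T' ?T2"
    by (rule der_cong[OF der_mult[OF S(1) der_G]]) (auto simp: T'_eq_G G1_def power2_eq_square)
  moreover have "der ?T2 ?T3"
    by (intro der_add der_mult S der_G P1 Q1)
  moreover have "Ord 2 (\<lambda>z. ?T3 z - 3 * S z * (P z)\<^sup>2 * G z ^ 5)"
  proof -
    have O: "Ord 2 (\<lambda>z. S2 z * G z)" "Ord 2 (\<lambda>z. S1 z * G1 z)" "Ord 2 (\<lambda>z. P1 z * G z ^ 3)"
      "Ord 2 (\<lambda>z. G z * G1 z)"
      using Ord_mult[OF S(4) Ord_G] Ord_mult[OF S(3) Ord_G1] Ord_mult[OF P1(2) Ord_pow_G(1)]
        Ord_mult[OF Ord_G Ord_G1] by simp_all
    have OQ: "Ord 2 (\<lambda>z. Q1 z * (G z)\<^sup>2)"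
      using Ord_mono[OF Ord_mult[OF Q1(2) Ord_G2], of 2] by simp
    have "Ord 2 (\<lambda>z. (S2 z * G z + 2 * (S1 z * G1 z)) +
        S z * (2 * (Q z * (G z * G1 z)) + Q1 z * (G z)\<^sup>2 + P1 z * G z ^ 3 + 3 * (P z * (Q z * G z ^ 4))))"
      by (rule Ord_add[OF Ord_add[OF O(1) Ord_mult_0(2)[OF Ord_const O(2)]] Ord_mult_0(2)[OF O0(1)
            Ord_add[OF Ord_add[OF Ord_add[OF Ord_mult_0(2)[OF Ord_const Ord_mult_0(2)[OF O0(3) O(4)]] OQ] O(3)]
              Ord_mult_0(2)[OF Ord_const Ord_mult_0(2)[OF O0(2) Ord_mult_0(2)[OF O0(3) Ord_pow_G(2)]]]]]])
    then show ?thesis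
      by (rule Ord_cong) (simp add: G1_def algebra_simps eval_nat_numeral)
  qed
  ultimately show ?thesis using that by blast
qed

lemma tame1_Ord_diff: "tame1 f \<Longrightarrow> Ord (-1/2) (\<lambda>z. f z - f (of_real (rad N)))"
  unfolding tame1_def der_def using Ord_integrate[of f _ "1/2"] by force

text \<open>Integrating (E^2)' = -2V with V = p + O(dl^(1/2)) gives E^2 = b^2 (1 - z/rad) +
  O(dl^(3/2)), where b^2 = 2 p rad. Dividing by the sum of \<open>E\<close> and the root
  \<open>?q\<close> of the main term leaves E - q = O(dl).\<close>

lemma Ord_G5_expansion:
  obtains b where "0 < b" "Ord 2 (\<lambda>z. G z ^ 5 - 1 / (of_real b * csqrt (1 - z / of_real (rad N))) ^ 5)"
proof -
  let ?r = "rad N" and ?a = "complex_of_real (rad N)"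
  obtain p where p: "P ?a = of_real p" "0 < p" using P_rad by blast
  have Va: "V ?a = of_real p" by (simp add: V_def E_rad p)
  let ?f = "\<lambda>z. (E z)\<^sup>2 + 2 * of_real p * z"
  have df: "(?f has_field_derivative (-2) * (V z - V ?a)) (at z)" if "norm z < ?r" for z
    using DERIV_add[OF E_square_DERIV[OF that] DERIV_cmult[OF DERIV_ident, of "2 * of_real p"]]
    by (simp add: Va algebra_simps)
  have "Ord (-1/2 - 1) (\<lambda>z. ?f z - ?f ?a)"
  proof (rule Ord_integrate)
    show "continuous_on (cball 0 ?r) ?f" by (intro continuous_intros continuous_on_E)
    show "Ord (-1/2) (\<lambda>z. (-2) * (V z - V ?a))"
      by (intro Ord_mult_0(2) Ord_const tame1_Ord_diff tame1_V)
  qed (use df in auto)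
  then have O1: "Ord (-3/2) (\<lambda>z. (E z)\<^sup>2 + 2 * of_real p * (z - ?a))"
    by (simp add: E_rad algebra_simps)
  define b where "b = sqrt (2 * p * ?r)"
  have b: "0 < b" "b\<^sup>2 = 2 * p * ?r" using p rad_pos by (auto simp: b_def)
  let ?q = "\<lambda>z. of_real b * csqrt (1 - z / ?a)"
  have q2: "(?q z)\<^sup>2 = - (2 * of_real p * (z - ?a))" for z
  proof -
    have "(?q z)\<^sup>2 = of_real (b\<^sup>2) * (1 - z / ?a)" by (simp add: power_mult_distrib)
    also have "\<dots> = - (2 * of_real p * (z - ?a))" unfolding b(2) using rad_pos by (simp add: field_simps)
    finally show ?thesis .
  qed
  have q_norm: "norm (?q z) = b * dl z powr (1/2)" if "norm z < ?r" for z
    using b dl_pos[OF that] by (simp add: norm_mult norm_csqrt dl_def powr_half_sqrt)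
  \<comment> \<open>1 - z/rad lies in the right half-plane, so the argument of its principal root is
    at most \<pi>/4 in modulus.\<close>
  have Re_q: "b / sqrt 2 * dl z powr (1/2) \<le> Re (?q z)" if z: "norm z < ?r" for z
  proof -
    have "norm (z / ?a) \<le> 1" using z rad_pos by (simp add: norm_divide)
    then have "0 \<le> Re (1 - z / ?a)" using complex_Re_le_cmod[of "z / ?a"] by simp
    then have "sqrt (dl z / 2) \<le> sqrt ((dl z + Re (1 - z / ?a)) / 2)" by (intro real_sqrt_le_mono) simp
    also have "\<dots> = Re (csqrt (1 - z / ?a))" by (simp add: dl_def)
    finally have "sqrt (dl z) / sqrt 2 \<le> Re (csqrt (1 - z / ?a))" by (simp add: real_sqrt_divide)
    then have "b * (sqrt (dl z) / sqrt 2) \<le> b * Re (csqrt (1 - z / ?a))" using b by (intro mult_left_mono) auto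
    then show ?thesis using dl_pos[OF z] by (simp add: powr_half_sqrt)
  qed
  obtain C where C: "0 \<le> C" "\<And>z. norm z < ?r \<Longrightarrow> norm ((E z)\<^sup>2 + 2 * of_real p * (z - ?a)) \<le> C * dl z powr (- (-3/2))"
    using OrdE[OF O1] by blast
  have OEq: "Ord (-1) (\<lambda>z. E z - ?q z)"
  proof (rule OrdI[where C="C / (b / sqrt 2)"])
    fix z :: complex assume z: "norm z < ?r"
    have "(E z - ?q z) * (E z + ?q z) = (E z)\<^sup>2 - (?q z)\<^sup>2" by (simp add: power2_eq_square algebra_simps)
    then have 1: "norm (E z - ?q z) * norm (E z + ?q z) \<le> C * dl z powr (3/2)"
      using C(2)[OF z] unfolding q2 by (simp flip: norm_mult)
    \<comment> \<open>Both summands have positive real part, so nothing cancels; this also selects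
      the branch of the root.\<close>
    have "b / sqrt 2 * dl z powr (1/2) \<le> Re (E z + ?q z)"
      using Re_q[OF z] Re_E_pos[OF z] by simp
    also have "\<dots> \<le> norm (E z + ?q z)" by (rule complex_Re_le_cmod)
    finally have 2: "b / sqrt 2 * dl z powr (1/2) \<le> norm (E z + ?q z)" .
    have "norm (E z - ?q z) * (b / sqrt 2 * dl z powr (1/2)) \<le> C * dl z powr (3/2)"
      by (rule order_trans[OF mult_left_mono[OF 2] 1]) simp
    also have "\<dots> = C * dl z powr 1 * dl z powr (1/2)"
      using powr_add[of "dl z" 1 "1/2"] by simp
    finally have "(norm (E z - ?q z) * (b / sqrt 2)) * dl z powr (1/2) \<le> (C * dl z powr 1) * dl z powr (1/2)"
      by (simp add: mult_ac)
    then have "norm (E z - ?q z) * (b / sqrt 2) \<le> C * dl z powr 1"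
      using dl_pos[OF z] by (subst (asm) mult_le_cancel_right_pos) auto
    then show "norm (E z - ?q z) \<le> C / (b / sqrt 2) * dl z powr (- (- 1))"
      using b by (simp add: field_simps)
  qed
  have Oq: "Ord (1/2) (\<lambda>z. 1 / ?q z)"
  proof (rule OrdI[where C="1 / b"])
    fix z :: complex assume z: "norm z < ?r"
    show "norm (1 / ?q z) \<le> 1 / b * dl z powr (- (1/2))"
      using q_norm[OF z] dl_pos[OF z] b by (simp add: norm_divide powr_minus field_simps)
  qed
  have qnz: "?q z \<noteq> 0" if "norm z < ?r" for z using q_norm[OF that] b dl_pos[OF that] by (metis mult_eq_0_iff norm_zero powr_eq_0_iff less_irrefl)
  let ?u = "\<lambda>z. 1 / ?q z"
  have "Ord (-1 + (1/2 + 1/2)) (\<lambda>z. (E z - ?q z) * (G z * ?u z))"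
    by (intro Ord_mult OEq Ord_G Oq)
  then have "Ord 0 (\<lambda>z. - ((E z - ?q z) * (G z * ?u z)))" using Ord_uminus by simp
  then have OGu: "Ord 0 (\<lambda>z. G z - ?u z)"
  proof (rule Ord_cong)
    fix z :: complex assume z: "norm z < ?r"
    show "- ((E z - ?q z) * (G z * ?u z)) = G z - ?u z"
      using E_nonzero[OF z] qnz[OF z] by (simp add: G_def field_simps)
  qed
  have Ou2: "Ord 1 (\<lambda>z. (?u z)\<^sup>2)" using Ord_mult[OF Oq Oq] by (simp add: power2_eq_square)
  have Ou4: "Ord 2 (\<lambda>z. (?u z) ^ 4)" using Ord_mult[OF Ou2 Ou2] by (simp add: eval_nat_numeral mult_ac)
  have Ou3: "Ord (3/2) (\<lambda>z. (?u z) ^ 3)" using Ord_mult[OF Ou2 Oq] by (simp add: eval_nat_numeral mult_ac)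
  have a1: "Ord 2 (\<lambda>z. G z ^ 3 * ?u z)" using Ord_mult[OF Ord_pow_G(1) Oq] by simp
  have a2: "Ord 2 (\<lambda>z. (G z)\<^sup>2 * (?u z)\<^sup>2)" using Ord_mult[OF Ord_G2 Ou2] by simp
  have a3: "Ord 2 (\<lambda>z. G z * ?u z ^ 3)" using Ord_mult[OF Ord_G Ou3] by simp
  have "Ord 2 (\<lambda>z. (G z - ?u z) * (G z ^ 4 + G z ^ 3 * ?u z + (G z)\<^sup>2 * (?u z)\<^sup>2 + G z * ?u z ^ 3 + ?u z ^ 4))"
    by (rule Ord_mult_0(2)[OF OGu Ord_add[OF Ord_add[OF Ord_add[OF Ord_add[OF Ord_pow_G(2) a1] a2] a3] Ou4]])
  then have "Ord 2 (\<lambda>z. G z ^ 5 - ?u z ^ 5)"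
    by (rule Ord_cong) (simp add: algebra_simps eval_nat_numeral del: times_divide_eq_left times_divide_eq_right)
  then show ?thesis using that[OF b(1)] by (simp add: power_divide)
qed

text \<open>Freezing the factor 3 S P^2 at the radius costs half an order, since
  \<open>tame1\<close> functions vary like the square root of the distance. The order 5/2 of the
  main term is thus left with an error of order 2.\<close>

lemma T3_expansion:
  obtains T2 T3 A where "der T' T2" "der T2 T3" "0 < A"
    "Ord 2 (\<lambda>z. T3 z - of_real A * (1 - z / of_real (rad N)) powr (-5/2))"
proof -
  let ?a = "complex_of_real (rad N)"
  obtain T2 T3 where T: "der T' T2" "der T2 T3" "Ord 2 (\<lambda>z. T3 z - 3 * S z * (P z)\<^sup>2 * G z ^ 5)"
    using T'_second_derivative by blast
  obtain p where p: "P ?a = of_real p" "0 < p" using P_rad by blast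
  obtain s where s: "S ?a = of_real s" "0 < s" using S_real[of "rad N"] rad_pos by auto
  obtain b where b: "0 < b" "Ord 2 (\<lambda>z. G z ^ 5 - 1 / (of_real b * csqrt (1 - z / ?a)) ^ 5)"
    using Ord_G5_expansion by blast
  define A where "A = 3 * s * p\<^sup>2 / b ^ 5"
  let ?F = "\<lambda>z. 3 * S z * (P z * P z)"
  have Fa: "?F ?a = of_real (3 * s * p\<^sup>2)" using p s by (simp add: power2_eq_square)
  have "tame1 ?F" by (intro tame1_mult tame1_const tame1_S tame1_P)
  then have "Ord (-1/2 + 5/2) (\<lambda>z. (?F z - ?F ?a) * G z ^ 5)"
    by (intro Ord_mult tame1_Ord_diff Ord_pow_G)
  then have O1: "Ord 2 (\<lambda>z. (?F z - ?F ?a) * G z ^ 5)" by simp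
  have O2: "Ord 2 (\<lambda>z. ?F ?a * (G z ^ 5 - 1 / (of_real b * csqrt (1 - z / ?a)) ^ 5))"
    by (intro Ord_mult_0(2) Ord_const b)
  have "Ord 2 (\<lambda>z. T3 z - of_real A * (1 - z / ?a) powr (-5/2))"
  proof (rule Ord_cong[OF Ord_add[OF T(3) Ord_add[OF O1 O2]]])
    fix z :: complex assume z: "norm z < rad N"
    have nz: "1 - z / ?a \<noteq> 0" using dl_pos[OF z] by (auto simp: dl_def)
    then have "csqrt (1 - z / ?a) = (1 - z / ?a) powr (1/2)" by (simp add: csqrt_exp_Ln powr_def)
    then have "csqrt (1 - z / ?a) ^ 5 = (1 - z / ?a) powr (5/2)"
      using nz by (simp add: powr_def flip: exp_of_nat_mult)
    then have c5: "1 / csqrt (1 - z / ?a) ^ 5 = (1 - z / ?a) powr (-5/2)"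
      by (simp add: powr_minus field_simps)
    have "1 / (of_real b * csqrt (1 - z / ?a)) ^ 5 = 1 / of_real b ^ 5 * (1 / csqrt (1 - z / ?a) ^ 5)"
      by (simp add: power_mult_distrib)
    then have "?F ?a * (1 / (of_real b * csqrt (1 - z / ?a)) ^ 5) = of_real A * (1 - z / ?a) powr (-5/2)"
      unfolding Fa A_def c5 by simp
    then show "T3 z - 3 * S z * (P z)\<^sup>2 * G z ^ 5 + ((?F z - ?F ?a) * G z ^ 5 +
        ?F ?a * (G z ^ 5 - 1 / (of_real b * csqrt (1 - z / ?a)) ^ 5)) = T3 z - of_real A * (1 - z / ?a) powr (-5/2)"
      by (simp add: algebra_simps power2_eq_square)
  qed
  moreover have "0 < A" using p s b by (simp add: A_def)
  ultimately show ?thesis using that T by blast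
qed

end

section \<open>Asymptotics of the number of regular trees\<close>

text \<open>On the circle of radius r the real part of (1 + u) / (1 - u) is the Poisson kernel (1 -
  r^2) / |1 - u|^2, and the Cauchy formula gives its mean, the value 1 at the centre.\<close>

lemma poisson_integral:
  assumes r: "0 < r" "r < 1"
  shows "((\<lambda>t. 1 / (norm (1 - of_real r * cis t))\<^sup>2) has_integral 2 * pi / (1 - r\<^sup>2)) {0..2 * pi}"
proof -
  let ?g = "\<lambda>u::complex. (1 + u) / (1 - u)"
  have nz: "1 - u \<noteq> 0" if "norm u \<le> r" for u :: complex using that r by auto
  have "((\<lambda>u. ?g u / (u - 0) ^ Suc 0) has_contour_integral (2 * pi * \<i>) / fact 0 * (deriv ^^ 0) ?g 0) (circlepath 0 r)"
    using r nz by (intro Cauchy_has_contour_integral_higher_derivative_circlepath)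
      (auto intro!: continuous_intros holomorphic_intros)
  then have "((\<lambda>t. ?g (of_real r * cis t) / (of_real r * cis t) * r * \<i> * cis t) has_integral 2 * pi * \<i>) {0..2 * pi}"
    unfolding circlepath_def by (subst (asm) has_contour_integral_part_circlepath_iff) auto
  then have "((\<lambda>t. \<i> * ?g (of_real r * cis t)) has_integral 2 * pi * \<i>) {0..2 * pi}"
    using r by (simp add: mult_ac)
  from has_integral_linear[OF this bounded_linear_Im]
  have "((\<lambda>t. Re (?g (of_real r * cis t))) has_integral Im (2 * pi * \<i>)) {0..2 * pi}"
    by (simp only: o_def Im_i_times)
  then have 1: "((\<lambda>t. Re (?g (of_real r * cis t))) has_integral 2 * pi) {0..2 * pi}" by simp
  have "Re (?g (of_real r * cis t)) = (1 - r\<^sup>2) * (1 / (norm (1 - of_real r * cis t))\<^sup>2)" for t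
  proof -
    let ?u = "of_real r * cis t"
    have nu: "(norm ?u)\<^sup>2 = r\<^sup>2" using r by (simp add: norm_mult)
    have "Re (?g ?u) = ((1 + Re ?u) * (1 - Re ?u) - (Im ?u)\<^sup>2) / (norm (1 - ?u))\<^sup>2"
      unfolding Re_divide cmod_power2 by (simp add: power2_eq_square)
    also have "(1 + Re ?u) * (1 - Re ?u) - (Im ?u)\<^sup>2 = 1 - r\<^sup>2"
      unfolding nu[symmetric] cmod_power2 by (simp add: power2_eq_square algebra_simps)
    finally show ?thesis by simp
  qed
  with 1 have "((\<lambda>t. (1 - r\<^sup>2) * (1 / (norm (1 - of_real r * cis t))\<^sup>2)) has_integral 2 * pi) {0..2 * pi}"
    by simp
  from has_integral_mult_right[OF this, of "1 / (1 - r\<^sup>2)"] show ?thesis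
    using r power_strict_mono[of r 1 2] by simp
qed

text \<open>The Cauchy formula on the circle of radius n / (n + 1): there r^(-n) is at most e, and
  the Poisson integral contributes 1 / (1 - r^2) \<le> n + 1.\<close>

lemma coefficient_bound:
  fixes f :: "complex \<Rightarrow> complex"
  assumes f: "f holomorphic_on ball 0 1"
    and C: "0 \<le> C" "\<And>z. norm z < 1 \<Longrightarrow> norm (f z) \<le> C / (norm (1 - z))\<^sup>2"
    and n: "1 \<le> n"
  shows "norm ((deriv ^^ n) f 0 / fact n) \<le> exp 1 * C * (real n + 1)"
proof -
  define r where "r = real n / (real n + 1)"
  have r: "0 < r" "r < 1" using n by (auto simp: r_def)
  let ?F = "\<lambda>t. f (of_real r * cis t) / (of_real r * cis t) ^ Suc n * r * \<i> * cis t"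
  have "((\<lambda>u. f u / (u - 0) ^ Suc n) has_contour_integral (2 * pi * \<i>) / fact n * (deriv ^^ n) f 0) (circlepath 0 r)"
    using r by (intro Cauchy_has_contour_integral_higher_derivative_circlepath
        holomorphic_on_imp_continuous_on holomorphic_on_subset[OF f]) auto
  then have F: "(?F has_integral (2 * pi * \<i>) / fact n * (deriv ^^ n) f 0) {0..2 * pi}"
    unfolding circlepath_def by (subst (asm) has_contour_integral_part_circlepath_iff) auto
  have G: "((\<lambda>t. C / r ^ n * (1 / (norm (1 - of_real r * cis t))\<^sup>2)) has_integral C / r ^ n * (2 * pi / (1 - r\<^sup>2))) {0..2 * pi}"
    by (rule has_integral_mult_right[OF poisson_integral[OF r]])
  have "norm (?F t) \<le> C / r ^ n * (1 / (norm (1 - of_real r * cis t))\<^sup>2)" for t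
  proof -
    have "norm (?F t) = norm (f (of_real r * cis t)) / r ^ n"
      using r by (simp add: norm_mult norm_divide norm_power)
    also have "\<dots> \<le> C / (norm (1 - of_real r * cis t))\<^sup>2 / r ^ n"
      using r by (intro divide_right_mono C) (auto simp: norm_mult)
    finally show ?thesis by (simp add: field_simps)
  qed
  then have "norm ((2 * pi * \<i>) / fact n * (deriv ^^ n) f 0) \<le> C / r ^ n * (2 * pi / (1 - r\<^sup>2))"
    using integral_norm_bound_integral[OF has_integral_integrable[OF F] has_integral_integrable[OF G]]
    unfolding integral_unique[OF F] integral_unique[OF G] by blast
  moreover have "norm ((2 * pi * \<i>) / fact n * (deriv ^^ n) f 0) = 2 * pi * norm ((deriv ^^ n) f 0 / fact n)"
    by (simp add: norm_mult norm_divide)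
  ultimately have a: "norm ((deriv ^^ n) f 0 / fact n) \<le> C / r ^ n * (1 / (1 - r\<^sup>2))"
    using mult_le_cancel_left_pos[of "2 * pi" "norm ((deriv ^^ n) f 0 / fact n)" "C / r ^ n * (1 / (1 - r\<^sup>2))"]
    by (simp add: mult_ac)
  have b: "C / r ^ n \<le> C * exp 1"
  proof -
    have "1 / r = 1 + 1 / real n" using n by (simp add: r_def field_simps)
    also have "\<dots> \<le> exp (1 / real n)" by (rule exp_ge_add_one_self)
    finally have "(1 / r) ^ n \<le> exp (1 / real n) ^ n" using r by (intro power_mono) auto
    also have "\<dots> = exp 1" using n by (simp flip: exp_of_nat_mult)
    finally show ?thesis using mult_left_mono[OF _ C(1)] by (force simp: power_divide)
  qed
  have c: "1 / (1 - r\<^sup>2) \<le> real n + 1"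
  proof -
    have "r\<^sup>2 \<le> r" using r power_decreasing[of 1 2 r] by simp
    then have "1 / (1 - r\<^sup>2) \<le> 1 / (1 - r)" using r by (intro divide_left_mono) auto
    also have "\<dots> = real n + 1" by (simp add: r_def field_simps)
    finally show ?thesis .
  qed
  have "C / r ^ n * (1 / (1 - r\<^sup>2)) \<le> (C * exp 1) * (real n + 1)"
    using b c C(1) r power_strict_mono[of r 1 2] by (intro mult_mono) auto
  with a show ?thesis by (simp add: mult_ac)
qed

text \<open>With the sign (-1)^n these are the coefficients of (1 - t)^(-5/2), the main term of the
  third derivative.\<close>

lemma gbinomial_half_limit:
  "(\<lambda>n. (-1) ^ n * (-5/2 gchoose n) / real n powr (3/2)) \<longlonglongrightarrow> 1 / Gamma (5/2 :: real)"
proof -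
  have "(\<lambda>n. ((-5/2 :: real) gchoose n) / ((-1)^n / exp ((-5/2+1) * of_real (ln (real n))))) \<longlonglongrightarrow> inverse (Gamma (- (-5/2)))"
    by (rule gbinomial_asymptotic)
  moreover have "\<forall>\<^sub>F n in sequentially. ((-5/2 :: real) gchoose n) / ((-1)^n / exp ((-5/2+1) * of_real (ln (real n))))
      = (-1) ^ n * (-5/2 gchoose n) / real n powr (3/2)"
    using eventually_gt_at_top[of 0]
  proof eventually_elim
    case (elim n)
    have "exp ((-5/2+1) * of_real (ln (real n))) = 1 / real n powr (3/2)"
      using elim by (simp add: powr_def field_simps exp_minus_inverse)
    then show ?case by (cases "even n") (auto simp: field_simps)
  qed
  ultimately show ?thesis by (simp add: inverse_eq_divide filterlim_cong)
qed

context regular_trees begin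

text \<open>The coefficients of the third derivative, rescaled to the unit disc, against those of
  the singular term. The shift by 3 and the three linear factors come from differentiating three
  times.\<close>

lemma tcount_coefficient:
  obtains A C where "0 < A" "0 \<le> C"
    "\<And>n. 1 \<le> n \<Longrightarrow> \<bar>real (tcount N (n + 3)) * rad N ^ n * ((real n + 1) * (real n + 2) * (real n + 3))
       - A * ((-1) ^ n * (-5/2 gchoose n))\<bar> \<le> C * (real n + 1)"
proof -
  let ?r = "rad N" and ?a = "complex_of_real (rad N)"
  obtain T2 T3 A where T: "der T' T2" "der T2 T3" "0 < A"
    "Ord 2 (\<lambda>z. T3 z - of_real A * (1 - z / ?a) powr (-5/2))"
    using T3_expansion by blast
  obtain C where C: "0 \<le> C" "\<And>z. norm z < ?r \<Longrightarrow> norm (T3 z - of_real A * (1 - z / ?a) powr (-5/2)) \<le> C * dl z powr (- 2)"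
    using OrdE[OF T(4)] by blast
  let ?c = "\<lambda>n. of_nat (tcount N n) :: complex"
  have s0: "summable (\<lambda>n. ?c n * z ^ n)" if "norm z < ?r" for z
    using summable_below_rad[of "norm z"] that
    by (intro summable_norm_cancel[of "\<lambda>n. ?c n * z ^ n"]) (simp add: norm_mult norm_power)
  have s1: "summable (\<lambda>n. diffs ?c n * z ^ n)" if "norm z < ?r" for z
    by (rule termdiff_converges[OF that s0])
  have s2: "summable (\<lambda>n. diffs (diffs ?c) n * z ^ n)" if "norm z < ?r" for z
    by (rule termdiff_converges[OF that s1])
  have s3: "summable (\<lambda>n. diffs (diffs (diffs ?c)) n * z ^ n)" if "norm z < ?r" for z
    by (rule termdiff_converges[OF that s2])
  have T'_ser: "T' z = (\<Sum>n. diffs ?c n * z ^ n)" if "norm z < ?r" for z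
    unfolding T'_def by (rule DERIV_imp_deriv[OF tgf_DERIV_series[OF that]])
  have step: "g z = (\<Sum>n. diffs c n * z ^ n)"
    if "der f g" "\<And>z. norm z < ?r \<Longrightarrow> f z = (\<Sum>n. c n * z ^ n)" "\<And>z. norm z < ?r \<Longrightarrow> summable (\<lambda>n. c n * z ^ n)" "norm z < ?r"
    for f g c z
  proof (rule DERIV_unique)
    show "(f has_field_derivative g z) (at z)" using that by (simp add: der_def)
    have "((\<lambda>z. \<Sum>n. c n * z ^ n) has_field_derivative (\<Sum>n. diffs c n * z ^ n)) (at z)"
      by (rule termdiffs_strong'[OF that(3,4)])
    then show "(f has_field_derivative (\<Sum>n. diffs c n * z ^ n)) (at z)"
      by (rule has_field_derivative_transform_within_open[of _ _ _ "ball 0 ?r"]) (use that in auto)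
  qed
  have T2_ser: "T2 z = (\<Sum>n. diffs (diffs ?c) n * z ^ n)" if "norm z < ?r" for z
    by (rule step[OF T(1) T'_ser s1 that])
  have T3_ser: "T3 z = (\<Sum>n. diffs (diffs (diffs ?c)) n * z ^ n)" if "norm z < ?r" for z
    by (rule step[OF T(2) T2_ser s2 that])
  let ?e = "\<lambda>n. real (tcount N (n + 3)) * ?r ^ n * ((real n + 1) * (real n + 2) * (real n + 3))
       - A * ((-1) ^ n * (-5/2 gchoose n))"
  define F where "F = Abs_fps (\<lambda>n. complex_of_real (?e n))"
  have gb: "((-5/2 :: complex) gchoose n) = of_real (-5/2 gchoose n)" for n
    by (simp add: gbinomial_prod_rev)
  have F: "(\<lambda>n. fps_nth F n * t ^ n) sums (T3 (?a * t) - of_real A * (1 - t) powr (-5/2))" if t: "norm t < 1" for t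
  proof -
    have at: "norm (?a * t) < ?r" using t rad_pos by (simp add: norm_mult)
    have "(\<lambda>n. diffs (diffs (diffs ?c)) n * (?a * t) ^ n) sums T3 (?a * t)"
      unfolding T3_ser[OF at] by (rule summable_sums[OF s3[OF at]])
    moreover have "(\<lambda>n. of_real A * (((-5/2) gchoose n) * (- t) ^ n)) sums (of_real A * (1 + - t) powr (-5/2))"
      by (rule sums_mult[OF gen_binomial_complex]) (use t in simp)
    ultimately have "(\<lambda>n. diffs (diffs (diffs ?c)) n * (?a * t) ^ n - of_real A * (((-5/2) gchoose n) * (- t) ^ n))
        sums (T3 (?a * t) - of_real A * (1 + - t) powr (-5/2))"
      by (rule sums_diff)
    moreover have "diffs (diffs (diffs ?c)) n * (?a * t) ^ n - of_real A * (((-5/2) gchoose n) * (- t) ^ n)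
        = fps_nth F n * t ^ n" for n
    proof -
      have "diffs (diffs (diffs ?c)) n = of_real (real (tcount N (n + 3)) * ((real n + 1) * (real n + 2) * (real n + 3)))"
        by (simp add: diffs_def eval_nat_numeral algebra_simps)
      then show ?thesis unfolding F_def gb
        by (simp add: power_mult_distrib power_minus[of t] algebra_simps)
    qed
    ultimately show ?thesis by simp
  qed
  have "fps_conv_radius F \<ge> 1"
    unfolding fps_conv_radius_def by (rule conv_radius_geI_ex') (use F[THEN sums_summable] in auto)
  then have conv: "fps_conv_radius F > 0" by (rule less_le_trans[rotated]) simp
  have eval: "eval_fps F t = T3 (?a * t) - of_real A * (1 - t) powr (-5/2)" if "norm t < 1" for t
    using F[OF that] by (simp add: eval_fps_def sums_iff)
  have hol: "eval_fps F holomorphic_on ball 0 1"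
    using \<open>fps_conv_radius F \<ge> 1\<close> by (intro holomorphic_on_eval_fps) (auto simp: ball_eball_mono one_ereal_def)
  have bound: "norm (eval_fps F t) \<le> C / (norm (1 - t))\<^sup>2" if t: "norm t < 1" for t
  proof -
    have at: "norm (?a * t) < ?r" using t rad_pos by (simp add: norm_mult)
    have "dl (?a * t) = norm (1 - t)" using rad_pos by (simp add: dl_def)
    moreover have "0 < norm (1 - t)" using t by auto
    moreover have "?a * t / ?a = t" using rad_pos by simp
    ultimately have "norm (eval_fps F t) \<le> C * norm (1 - t) powr (- 2)"
      using C(2)[OF at] unfolding eval[OF t] by (simp only:)
    also have "norm (1 - t) powr (- 2) = 1 / (norm (1 - t))\<^sup>2"
      using \<open>0 < norm (1 - t)\<close> by (simp add: powr_minus divide_inverse)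
    finally show ?thesis by simp
  qed
  have "\<bar>?e n\<bar> \<le> (exp 1 * C) * (real n + 1)" if "1 \<le> n" for n
  proof -
    have "norm ((deriv ^^ n) (eval_fps F) 0 / fact n) \<le> exp 1 * C * (real n + 1)"
      by (rule coefficient_bound[OF hol C(1) bound that])
    also have "(deriv ^^ n) (eval_fps F) 0 / fact n = fps_nth F n"
      using fps_nth_conv_deriv[OF conv] by simp
    also have "norm (fps_nth F n) = \<bar>?e n\<bar>" by (simp only: F_def fps_nth_Abs_fps norm_of_real)
    finally show ?thesis .
  qed
  then show ?thesis using that[OF T(3), of "exp 1 * C"] C(1) by auto
qed

lemma tcount_limit:
  obtains L where "0 < L" "(\<lambda>n. real (tcount N n) * rad N ^ n * real n powr (3/2)) \<longlonglongrightarrow> L"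
proof -
  let ?r = "rad N"
  obtain A C where A: "0 < A" "0 \<le> C" and
    e: "\<And>n. 1 \<le> n \<Longrightarrow> \<bar>real (tcount N (n + 3)) * ?r ^ n * ((real n + 1) * (real n + 2) * (real n + 3))
       - A * ((-1) ^ n * (-5/2 gchoose n))\<bar> \<le> C * (real n + 1)"
    using tcount_coefficient by blast
  let ?u = "\<lambda>n. real (tcount N (n + 3)) * ?r ^ n * ((real n + 1) * (real n + 2) * (real n + 3))"
  let ?b = "\<lambda>n. A * ((-1) ^ n * (-5/2 gchoose n))"
  have "(\<lambda>n. (?u n - ?b n) / real n powr (3/2)) \<longlonglongrightarrow> 0"
  proof (rule Lim_null_comparison)
    show "\<forall>\<^sub>F n in sequentially. norm ((?u n - ?b n) / real n powr (3/2)) \<le> C * ((real n + 1) / real n powr (3/2))"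
      using eventually_ge_at_top[of 1]
      by eventually_elim (use e in \<open>auto simp: divide_right_mono\<close>)
    have "(\<lambda>n. (real n + 1) / real n powr (3/2)) \<longlonglongrightarrow> 0" by real_asymp
    then show "(\<lambda>n. C * ((real n + 1) / real n powr (3/2))) \<longlonglongrightarrow> 0" by (rule tendsto_mult_right_zero)
  qed
  from tendsto_add[OF this tendsto_mult[OF tendsto_const[of A] gbinomial_half_limit]]
  have "(\<lambda>n. ?u n / real n powr (3/2)) \<longlonglongrightarrow> A * (1 / Gamma (5/2))"
    by (simp add: diff_divide_distrib)
  \<comment> \<open>Exchanges the cubic factor for the powers 3/2 of n and n + 3, which leaves the
    claimed sequence shifted by 3.\<close>
  moreover have "(\<lambda>n. (real n + 3) powr (3/2) * real n powr (3/2) / ((real n + 1) * (real n + 2) * (real n + 3))) \<longlonglongrightarrow> 1"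
    by real_asymp
  ultimately have "(\<lambda>n. ?r ^ 3 * ((?u n / real n powr (3/2)) *
      ((real n + 3) powr (3/2) * real n powr (3/2) / ((real n + 1) * (real n + 2) * (real n + 3))))) \<longlonglongrightarrow>
      ?r ^ 3 * (A * (1 / Gamma (5/2)) * 1)"
    by (intro tendsto_mult tendsto_const)
  moreover have "\<forall>\<^sub>F n in sequentially. ?r ^ 3 * ((?u n / real n powr (3/2)) *
      ((real n + 3) powr (3/2) * real n powr (3/2) / ((real n + 1) * (real n + 2) * (real n + 3))))
      = real (tcount N (n + 3)) * ?r ^ (n + 3) * real (n + 3) powr (3/2)"
    using eventually_gt_at_top[of 0]
  proof eventually_elim
    case (elim n)
    let ?p = "(real n + 1) * (real n + 2) * (real n + 3)" and ?q = "real n powr (3/2)"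
    have "0 < ?p" by (intro mult_pos_pos) auto
    then have nz: "?p \<noteq> 0" "?q \<noteq> 0" using elim by auto
    have "r * ((x * p / q) * (y * q / p)) = x * r * y" if "p \<noteq> 0" "q \<noteq> 0" for x y p q r :: real
      using that by (simp add: field_simps)
    from this[OF nz, of "?r ^ 3" "real (tcount N (n + 3)) * ?r ^ n" "(real n + 3) powr (3/2)"]
    show ?case by (simp add: power_add mult_ac)
  qed
  ultimately have "(\<lambda>n. real (tcount N (n + 3)) * ?r ^ (n + 3) * real (n + 3) powr (3/2)) \<longlonglongrightarrow> ?r ^ 3 * (A * (1 / Gamma (5/2)) * 1)"
    by (rule Lim_transform_eventually)
  then have "(\<lambda>n. real (tcount N n) * ?r ^ n * real n powr (3/2)) \<longlonglongrightarrow> ?r ^ 3 * (A * (1 / Gamma (5/2)) * 1)"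
    by (rule LIMSEQ_offset)
  moreover have "0 < ?r ^ 3 * (A * (1 / Gamma (5/2)) * 1)" using A(1) rad_pos Gamma_real_pos[of "5/2"] by simp
  ultimately show ?thesis using that by blast
qed

theorem tcount_theta:
  obtains c C where "0 < c" "0 < C"
    "\<And>n. 1 \<le> n \<Longrightarrow> c * real n powr (-3/2) * (1 / rad N) ^ n \<le> real (tcount N n)"
    "\<And>n. 1 \<le> n \<Longrightarrow> real (tcount N n) \<le> C * real n powr (-3/2) * (1 / rad N) ^ n"
proof -
  let ?u = "\<lambda>n. real (tcount N n) * rad N ^ n * real n powr (3/2)"
  obtain L where L: "0 < L" "?u \<longlonglongrightarrow> L" using tcount_limit by blast
  have pos: "0 < ?u n" if "1 \<le> n" for n
    using tcount_pos[of N n] N2 rad_pos that by (intro mult_pos_pos zero_less_power) auto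
  obtain C where C: "0 < C" "\<And>n. \<bar>?u n\<bar> \<le> C"
    using convergent_imp_Bseq[OF convergentI[OF L(2)]] by (auto simp: Bseq_def)
  have "\<forall>\<^sub>F n in sequentially. L / 2 < ?u n" using L by (intro order_tendstoD(1)[OF L(2)]) simp
  then obtain n0 where n0: "\<And>n. n0 \<le> n \<Longrightarrow> L / 2 < ?u n" by (auto simp: eventually_sequentially)
  \<comment> \<open>The limit controls only large n; the finitely many earlier values are positive
    and enter through a minimum.\<close>
  define c where "c = Min (insert (L / 2) (?u ` {1..n0}))"
  have c0: "0 < c" unfolding c_def using L pos by (subst Min_gr_iff) auto
  have c: "c \<le> ?u n" if "1 \<le> n" for n
  proof (cases "n0 \<le> n")
    case True
    have "c \<le> L / 2" unfolding c_def by (rule Min_le) auto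
    then show ?thesis using n0[OF True] by simp
  next
    case False
    then show ?thesis unfolding c_def using that by (intro Min_le) auto
  qed
  have inv: "real (tcount N n) = ?u n * (real n powr (-3/2) * (1 / rad N) ^ n)" if "1 \<le> n" for n
    using that rad_pos by (simp add: powr_minus power_divide field_simps)
  have nn: "0 \<le> real n powr (-3/2) * (1 / rad N) ^ n" for n using rad_pos by simp
  show ?thesis
  proof (rule that[OF c0 C(1)])
    fix n :: nat assume n: "1 \<le> n"
    show "c * real n powr (-3/2) * (1 / rad N) ^ n \<le> real (tcount N n)"
      by (subst inv[OF n]) (use mult_right_mono[OF c[OF n] nn[of n]] in \<open>simp add: mult.assoc\<close>)
    show "real (tcount N n) \<le> C * real n powr (-3/2) * (1 / rad N) ^ n"
    proof (subst inv[OF n])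
      have "?u n \<le> C" using C(2)[of n] by linarith
      from mult_right_mono[OF this nn[of n]]
      show "?u n * (real n powr (-3/2) * (1 / rad N) ^ n) \<le> C * real n powr (-3/2) * (1 / rad N) ^ n"
        by (simp only: mult.assoc)
    qed
  qed
qed

end

section \<open>Symbols as defective regular trees\<close>

text \<open>\<open>shape d N \<tau> t D K\<close>: filling the \<open>D\<close> empty slots of the symbol \<open>\<tau>\<close> by leaves and erasing its
  \<open>K\<close> polynomial factors yields the regular tree \<open>t\<close>, whose leaves are the noises.\<close>

inductive shape :: "nat \<Rightarrow> nat \<Rightarrow> symb \<Rightarrow> utree \<Rightarrow> nat \<Rightarrow> nat \<Rightarrow> bool"
  and fshape :: "nat \<Rightarrow> nat \<Rightarrow> symb \<Rightarrow> utree multiset \<Rightarrow> nat \<Rightarrow> nat \<Rightarrow> bool"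
  for d N :: nat where
  noise: "shape d N {#Xi#} (Node {#}) 0 0"
| node: "fshape d N \<mu> M D K \<Longrightarrow> size M = N \<Longrightarrow> shape d N (Xpow d k + \<mu>) (Node M) D (K + (\<Sum>i\<le>d. k i))"
| empty: "fshape d N {#} {#} 0 0"
| child: "shape d N \<tau> t D K \<Longrightarrow> fshape d N \<mu> M D' K' \<Longrightarrow>
    fshape d N (add_mset (I \<tau>) \<mu>) (add_mset t M) (D + D') (K + K')"
| slot: "fshape d N \<mu> M D K \<Longrightarrow> fshape d N \<mu> (add_mset (Node {#}) M) (Suc D) K"

lemma replicate_mset_add: "replicate_mset (m + n) x = replicate_mset m x + replicate_mset n x"
  by (rule multiset_eqI) simp

lemma Xpow_add: "Xpow d k + Xpow d k' = Xpow d (\<lambda>i. k i + k' i)"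
  unfolding Xpow_def by (simp add: sum.distrib replicate_mset_add)

lemma Xpow_0: "Xpow d (\<lambda>_. 0) = {#}"
  unfolding Xpow_def by simp

lemma fshape_fill: "fshape d N \<mu> M D K \<Longrightarrow> fshape d N \<mu> (M + replicate_mset j (Node {#})) (D + j) K"
  by (induction j) (auto intro: slot)

text \<open>Powers of X are merged into a single one and planted factors become children. At most
  \<open>n\<close> children result; the deficit up to \<open>N\<close> is filled with slots
  afterwards.\<close>

lemma UU_sum:
  assumes "\<forall>i\<in>{1..n}. \<tau> i \<in> range (Xpow d) \<or> (\<exists>\<sigma> t D K. \<tau> i = {#I \<sigma>#} \<and> shape d N \<sigma> t D K)"
  shows "\<exists>k \<mu> M D K. (\<Sum>i=1..n. \<tau> i) = Xpow d k + \<mu> \<and> fshape d N \<mu> M D K \<and> size M \<le> n"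
  using assms
proof (induction n)
  case 0
  show ?case using Xpow_0[of d] by (auto intro!: exI[of _ "\<lambda>_. 0"] exI[of _ "{#}"] exI[of _ "0::nat"] empty)
next
  case (Suc n)
  then obtain k \<mu> M D K where IH: "(\<Sum>i=1..n. \<tau> i) = Xpow d k + \<mu>" "fshape d N \<mu> M D K" "size M \<le> n"
    by (metis atLeastAtMost_iff le_SucI)
  have sum: "(\<Sum>i=1..Suc n. \<tau> i) = Xpow d k + \<mu> + \<tau> (Suc n)" using IH by simp
  have "Suc n \<in> {1..Suc n}" by simp
  then have "\<tau> (Suc n) \<in> range (Xpow d) \<or> (\<exists>\<sigma> t D K. \<tau> (Suc n) = {#I \<sigma>#} \<and> shape d N \<sigma> t D K)"
    using Suc.prems by blast
  then show ?case
  proof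
    assume "\<tau> (Suc n) \<in> range (Xpow d)"
    then obtain k' where "\<tau> (Suc n) = Xpow d k'" by auto
    then have "(\<Sum>i=1..Suc n. \<tau> i) = Xpow d (\<lambda>i. k i + k' i) + \<mu>" unfolding sum Xpow_add[symmetric] by simp
    then show ?thesis using IH le_SucI by blast
  next
    assume "\<exists>\<sigma> t D K. \<tau> (Suc n) = {#I \<sigma>#} \<and> shape d N \<sigma> t D K"
    then obtain \<sigma> t D' K' where s: "\<tau> (Suc n) = {#I \<sigma>#}" "shape d N \<sigma> t D' K'" by blast
    have "(\<Sum>i=1..Suc n. \<tau> i) = Xpow d k + add_mset (I \<sigma>) \<mu>" unfolding sum s by simp
    moreover have "fshape d N (add_mset (I \<sigma>) \<mu>) (add_mset t M) (D' + D) (K' + K)" by (rule child[OF s(2) IH(2)])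
    moreover have "size (add_mset t M) \<le> Suc n" using IH by simp
    ultimately show ?thesis by blast
  qed
qed

lemma UU_shape:
  assumes W: "\<And>\<tau>. \<tau> \<in> WW d N m \<Longrightarrow> \<tau> \<in> range (Xpow d) \<or> (\<exists>t D K. shape d N \<tau> t D K)"
    and "\<sigma> \<in> UU d N m"
  shows "\<sigma> \<in> range (Xpow d) \<or> (\<exists>\<tau> t D K. \<sigma> = {#I \<tau>#} \<and> shape d N \<tau> t D K)"
proof (cases m)
  case (Suc n)
  then consider "\<sigma> \<in> range (Xpow d)" | \<tau> where "\<sigma> = {#I \<tau>#}" "\<tau> \<in> WW d N m" "\<tau> \<notin> range (Xpow d)"
    using assms(2) by (auto simp del: WW.simps)
  then show ?thesis using W by cases blast+
qed (use assms(2) in simp)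

lemma WW_shape: "\<tau> \<in> WW d N m \<Longrightarrow> \<tau> \<in> range (Xpow d) \<or> (\<exists>t D K. shape d N \<tau> t D K)"
proof (induction m arbitrary: \<tau>)
  case (Suc m)
  from Suc.prems consider "\<tau> \<in> WW d N m" | "\<tau> = {#Xi#}"
    | n \<sigma> where "n \<in> {1..N}" "\<tau> = (\<Sum>i=1..n. \<sigma> i)" "\<forall>i\<in>{1..n}. \<sigma> i \<in> UU d N m"
    by auto
  then show ?case
  proof cases
    case 1
    then show ?thesis by (rule Suc.IH)
  next
    case 2
    then show ?thesis using noise by blast
  next
    case 3
    have "\<forall>i\<in>{1..n}. \<sigma> i \<in> range (Xpow d) \<or> (\<exists>\<tau> t D K. \<sigma> i = {#I \<tau>#} \<and> shape d N \<tau> t D K)"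
      using UU_shape[OF Suc.IH] 3(3) by blast
    from UU_sum[OF this] obtain k \<mu> M D K where M: "\<tau> = Xpow d k + \<mu>" "fshape d N \<mu> M D K" "size M \<le> n"
      unfolding 3(2) by blast
    have "shape d N \<tau> (Node (M + replicate_mset (N - size M) (Node {#}))) (D + (N - size M)) (K + (\<Sum>i\<le>d. k i))"
      unfolding M(1) using M 3(1) by (intro node fshape_fill) auto
    then show ?thesis by blast
  qed
qed simp

lemma FF_shape:
  assumes "\<tau> \<in> FF d N" "N \<ge> 1"
  shows "\<tau> \<in> range (Xpow d) \<or> (\<exists>t D K. shape d N \<tau> t D K)"
proof -
  from assms obtain m where "\<tau> \<in> WW d N m \<or> \<tau> \<in> UU d N m" by (auto simp: FF_def)
  then show ?thesis
  proof
    assume "\<tau> \<in> UU d N m"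
    then consider "\<tau> \<in> range (Xpow d)" | \<sigma> t D K where "\<tau> = {#I \<sigma>#}" "shape d N \<sigma> t D K"
      using UU_shape[of d N m \<tau>] WW_shape[of _ d N m] by blast
    then show ?thesis
    proof cases
      case 2
      \<comment> \<open>A lone planted symbol is a product with one factor: \<open>N - 1\<close>
        slots are empty.\<close>
      have "fshape d N {#I \<sigma>#} ({#t#} + replicate_mset (N - 1) (Node {#})) (D + 0 + (N - 1)) (K + 0)"
        by (rule fshape_fill[OF child[OF 2(2) empty]])
      then have "shape d N (Xpow d (\<lambda>_. 0) + {#I \<sigma>#}) (Node ({#t#} + replicate_mset (N - 1) (Node {#}))) (D + 0 + (N - 1)) (K + 0 + (\<Sum>i\<le>d. 0))"
        using assms(2) by (intro node) auto
      then show ?thesis unfolding 2(1) Xpow_0 by force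
    qed auto
  qed (rule WW_shape)
qed

lemma shape_regular:
  "shape d N \<tau> t D K \<Longrightarrow> regular N t"
  "fshape d N \<mu> M D K \<Longrightarrow> \<forall>t\<in>#M. regular N t"
  by (induction rule: shape_fshape.inducts) (auto simp: regular_Node_iff)

lemma homog_Xpow:
  assumes "\<rho> > 0"
  shows "homog d \<rho> \<kappa> (Xpow d k) \<ge> min \<rho> 1 * real (\<Sum>i\<le>d. k i)"
proof -
  have "(\<Sum>g\<in>#(\<Sum>i\<le>n. replicate_mset (k i) (X i)). gen_hom d \<rho> \<kappa> g)
      = (\<Sum>i\<le>n. real (k i) * gen_hom d \<rho> \<kappa> (X i))" for n
    by (induction n) simp_all
  then have "homog d \<rho> \<kappa> (Xpow d k) = (\<Sum>i\<le>d. real (k i) * gen_hom d \<rho> \<kappa> (X i))"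
    unfolding homog_def Xpow_def .
  also have "\<dots> \<ge> (\<Sum>i\<le>d. real (k i) * min \<rho> 1)"
    by (intro sum_mono mult_left_mono) auto
  finally show ?thesis by (simp add: sum_distrib_left mult.commute)
qed

lemma homog_add: "homog d \<rho> \<kappa> (\<sigma> + \<tau>) = homog d \<rho> \<kappa> \<sigma> + homog d \<rho> \<kappa> \<tau>"
  by (simp add: homog_def)

text \<open>\<alpha> is the gain of one non-leaf vertex, \<beta> the homogeneity of a noise, and
  \<delta> = - (\<beta> + \<rho>) the cost of erasing a planted noise; the bookkeeping rests on N
  (\<beta> + \<rho>) = \<alpha> + \<beta>. The second conjunct expresses that empty slots are
  leaves, of which there are (N - 1) i + 1; it is what helps when \<delta> is negative.\<close>

lemma shape_homog:
  fixes d N :: nat and \<rho> \<kappa> :: real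
  assumes "\<rho> > 0" "N \<ge> 1"
  defines "\<alpha> \<equiv> ((real N + 1) * \<rho> - (real N - 1) * real d) / 2 - (real N - 1) * \<kappa>"
    and "\<beta> \<equiv> - (\<rho> + real d) / 2 - \<kappa>" and "\<delta> \<equiv> (real d - \<rho>) / 2 + \<kappa>"
  shows "shape d N \<tau> t D K \<Longrightarrow>
      homog d \<rho> \<kappa> \<tau> \<ge> real (inodes t) * \<alpha> + \<beta> + real D * \<delta> + min \<rho> 1 * real K \<and> real D \<le> (real N - 1) * real (inodes t) + 1"
    and "fshape d N \<mu> M D K \<Longrightarrow>
      homog d \<rho> \<kappa> \<mu> \<ge> real (weight M) * \<alpha> + real (size M) * (\<beta> + \<rho>) + real D * \<delta> + min \<rho> 1 * real K \<and> real D \<le> (real N - 1) * real (weight M) + real (size M)"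
proof (induction rule: shape_fshape.inducts)
  case noise
  then show ?case by (simp add: homog_def \<beta>_def alpha0_def)
next
  case (node \<mu> M D K k)
  have \<alpha>: "real N * (\<beta> + \<rho>) = \<alpha> + \<beta>" unfolding \<alpha>_def \<beta>_def by (simp add: field_simps)
  have "M \<noteq> {#}" using node assms(2) by auto
  then have i: "inodes (Node M) = Suc (weight M)" by (simp add: weight_def)
  show ?case using node homog_Xpow[OF assms(1), where d=d and k=k and \<kappa>=\<kappa>] \<alpha> unfolding i
    by (auto simp: homog_add distrib_left distrib_right)
next
  case empty
  then show ?case by (simp add: homog_def weight_def)
next
  case (child \<tau> t D K \<mu> M D' K')
  have "homog d \<rho> \<kappa> (add_mset (I \<tau>) \<mu>) = homog d \<rho> \<kappa> \<tau> + \<rho> + homog d \<rho> \<kappa> \<mu>" by (simp add: homog_def)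
  moreover have "weight (add_mset t M) = inodes t + weight M" by (simp add: weight_def)
  ultimately show ?case using child by (auto simp: distrib_left distrib_right)
next
  case (slot \<mu> M D K)
  have "weight (add_mset (Node {#}) M) = weight M" by (simp add: weight_def)
  moreover have "\<beta> + \<rho> + \<delta> = 0" by (simp add: \<beta>_def \<delta>_def field_simps)
  ultimately show ?case using slot by (auto simp: distrib_left distrib_right)
qed

section \<open>Weighted count of the symbols on a given tree\<close>

lemma fshape_empty: "fshape d N \<mu> {#} D K \<Longrightarrow> \<mu> = {#} \<and> D = 0 \<and> K = 0"
  by (erule fshape.cases) auto

text \<open>The rules attach children in some order, whereas the count peels off a prescribed child
  \<open>t\<close>. The induction moves the rule for \<open>t\<close> past the rules applied after
  it.\<close>

lemma fshape_split:
  assumes "fshape d N \<mu> M0 D K" "t \<in># M0"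
  shows "(\<exists>\<tau> D1 K1 \<mu>' D2 K2. shape d N \<tau> t D1 K1 \<and> fshape d N \<mu>' (M0 - {#t#}) D2 K2 \<and>
            \<mu> = add_mset (I \<tau>) \<mu>' \<and> D = D1 + D2 \<and> K = K1 + K2) \<or>
         (\<exists>D2. fshape d N \<mu> (M0 - {#t#}) D2 K \<and> D = Suc D2)"
proof -
  \<comment> \<open>The two predicates are defined together, so the induction also needs a claim
    about \<open>shape\<close>; a trivial one suffices.\<close>
  have "shape d N \<tau> t' D' K' \<Longrightarrow> True" and "fshape d N \<mu> M0 D K \<Longrightarrow> t \<in># M0 \<Longrightarrow> ?thesis" for \<tau> t' D' K'
  proof (induction rule: shape_fshape.inducts)
    case (child \<tau> s D K \<mu> M D' K')
    show ?case
    proof (cases "t = s")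
      case True
      then show ?thesis using child(1,3)
        by (intro disjI1 exI[of _ \<tau>] exI[of _ D] exI[of _ K] exI[of _ \<mu>] exI[of _ D'] exI[of _ K']) simp
    next
      case False
      then have t: "t \<in># M" using child by auto
      have rem: "add_mset s M - {#t#} = add_mset s (M - {#t#})" using False t by simp
      from child(4)[OF t] show ?thesis
      proof (elim disjE exE conjE)
        fix \<sigma> D1 K1 \<mu>' D2 K2
        assume a: "shape d N \<sigma> t D1 K1" "fshape d N \<mu>' (M - {#t#}) D2 K2" "\<mu> = add_mset (I \<sigma>) \<mu>'" "D' = D1 + D2" "K' = K1 + K2"
        have "fshape d N (add_mset (I \<tau>) \<mu>') (add_mset s (M - {#t#})) (D + D2) (K + K2)"
          by (rule shape_fshape.child[OF child(1) a(2)])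
        then show ?thesis unfolding rem using a
          by (intro disjI1 exI[of _ \<sigma>] exI[of _ D1] exI[of _ K1] exI[of _ "add_mset (I \<tau>) \<mu>'"] exI[of _ "D + D2"] exI[of _ "K + K2"]) auto
      next
        fix D2 assume a: "fshape d N \<mu> (M - {#t#}) D2 K'" "D' = Suc D2"
        have "fshape d N (add_mset (I \<tau>) \<mu>) (add_mset s (M - {#t#})) (D + D2) (K + K')"
          by (rule shape_fshape.child[OF child(1) a(1)])
        then show ?thesis unfolding rem using a by auto
      qed
    qed
  next
    case (slot \<mu> M D K)
    show ?case
    proof (cases "t = Node {#}")
      case True
      then show ?thesis using slot by auto
    next
      case False
      then have t: "t \<in># M" using slot by auto
      have rem: "add_mset (Node {#}) M - {#t#} = add_mset (Node {#}) (M - {#t#})" using False t by simp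
      from slot(2)[OF t] show ?thesis
      proof (elim disjE exE conjE)
        fix \<sigma> D1 K1 \<mu>' D2 K2
        assume a: "shape d N \<sigma> t D1 K1" "fshape d N \<mu>' (M - {#t#}) D2 K2" "\<mu> = add_mset (I \<sigma>) \<mu>'" "D = D1 + D2" "K = K1 + K2"
        have "fshape d N \<mu>' (add_mset (Node {#}) (M - {#t#})) (Suc D2) K2"
          by (rule shape_fshape.slot[OF a(2)])
        then show ?thesis unfolding rem using a
          by (intro disjI1 exI[of _ \<sigma>] exI[of _ D1] exI[of _ K1] exI[of _ \<mu>'] exI[of _ "Suc D2"] exI[of _ K2]) auto
      next
        fix D2 assume a: "fshape d N \<mu> (M - {#t#}) D2 K" "D = Suc D2"
        have "fshape d N \<mu> (add_mset (Node {#}) (M - {#t#})) (Suc D2) K"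
          by (rule shape_fshape.slot[OF a(1)])
        then show ?thesis unfolding rem using a by auto
      qed
    qed
  qed auto
  then show ?thesis using assms by blast
qed

text \<open>The cut-off \<open>B\<close> keeps the set finite; the weighted estimate below does not
  depend on it. \<open>D\<close> and \<open>K\<close> are recorded because the weight is a function
  of them.\<close>

definition fibre :: "nat \<Rightarrow> nat \<Rightarrow> nat \<Rightarrow> utree \<Rightarrow> (symb \<times> nat \<times> nat) set" where
  "fibre d N B t = {(\<tau>, D, K). shape d N \<tau> t D K \<and> D \<le> B \<and> K \<le> B}"

definition ffibre :: "nat \<Rightarrow> nat \<Rightarrow> nat \<Rightarrow> utree multiset \<Rightarrow> (symb \<times> nat \<times> nat) set" where
  "ffibre d N B M = {(\<mu>, D, K). fshape d N \<mu> M D K \<and> D \<le> B \<and> K \<le> B}"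

definition defect :: "real \<Rightarrow> symb \<times> nat \<times> nat \<Rightarrow> real" where
  "defect u = (\<lambda>(\<tau>, D, K). u ^ (D + K))"

text \<open>The price of one vertex: each of its \<open>N\<close> children may be replaced by an
  empty slot of weight \<open>u\<close>, and summing \<open>u\<close> to the total degree over all
  exponents of X^k gives \<open>d + 1\<close> geometric series. It tends to 1 with
  \<open>u\<close>.\<close>

definition vfac :: "nat \<Rightarrow> nat \<Rightarrow> real \<Rightarrow> real" where
  "vfac d N u = (1 + u) ^ N * (1 / (1 - u)) ^ (d + 1)"

lemma defect_nonneg: "0 \<le> u \<Longrightarrow> 0 \<le> defect u x"
  by (cases x) (simp add: defect_def)

lemma vfac_ge_1: "0 \<le> u \<Longrightarrow> u < 1 \<Longrightarrow> 1 \<le> vfac d N u"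
  unfolding vfac_def using mult_mono[of 1 "(1 + u) ^ N" 1 "(1 / (1 - u)) ^ (d + 1)"]
  by (simp add: one_le_power del: power_Suc)

lemma sum_Un_le_nonneg:
  fixes f :: "'a \<Rightarrow> real"
  assumes "finite A" "finite B" "\<And>x. 0 \<le> f x"
  shows "sum f (A \<union> B) \<le> sum f A + sum f B"
proof -
  have "0 \<le> sum f (A \<inter> B)" by (rule sum_nonneg) (use assms in auto)
  then show ?thesis using sum.union_inter[OF assms(1,2), of f] by linarith
qed

lemma ffibre_sum:
  assumes u: "0 < u" "u < 1"
    and "\<And>t. t \<in># M \<Longrightarrow> finite (fibre d N B t) \<and> sum (defect u) (fibre d N B t) \<le> vfac d N u ^ vertices t"
  shows "finite (ffibre d N B M) \<and> sum (defect u) (ffibre d N B M) \<le> (1 + u) ^ size M * vfac d N u ^ (\<Sum>t\<in>#M. vertices t)"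
  using assms(3)
proof (induction M)
  case empty
  have "ffibre d N B {#} \<subseteq> {({#}, 0, 0)}" using fshape_empty by (fastforce simp: ffibre_def)
  moreover from this have "sum (defect u) (ffibre d N B {#}) \<le> sum (defect u) {({#}, 0, 0)}"
    by (rule sum_mono2[rotated]) (use u in \<open>auto intro: defect_nonneg\<close>)
  ultimately have "finite (ffibre d N B {#})" "sum (defect u) (ffibre d N B {#}) \<le> sum (defect u) {({#}, 0, 0)}"
    by (auto intro: finite_subset)
  then show ?case by (simp add: defect_def)
next
  case (add t M)
  let ?c = "vfac d N u"
  let ?f1 = "\<lambda>((\<tau>, D1, K1), (\<mu>, D2, K2)). (add_mset (I \<tau>) \<mu>, D1 + D2, K1 + K2) :: symb \<times> nat \<times> nat"
  let ?f2 = "\<lambda>(\<mu>, D, K). (\<mu>, Suc D, K) :: symb \<times> nat \<times> nat"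
  let ?A = "fibre d N B t" and ?F = "ffibre d N B M"
  have A: "finite ?A" "sum (defect u) ?A \<le> ?c ^ vertices t" using add.prems[of t] by auto
  have F: "finite ?F" "sum (defect u) ?F \<le> (1 + u) ^ size M * ?c ^ (\<Sum>t\<in>#M. vertices t)"
    using add by auto
  have sub: "ffibre d N B (add_mset t M) \<subseteq> ?f1 ` (?A \<times> ?F) \<union> ?f2 ` ?F"
  proof
    fix x assume "x \<in> ffibre d N B (add_mset t M)"
    then obtain \<mu> D K where x: "x = (\<mu>, D, K)" "fshape d N \<mu> (add_mset t M) D K" "D \<le> B" "K \<le> B"
      by (auto simp: ffibre_def)
    have "t \<in># add_mset t M" by simp
    from fshape_split[OF x(2) this] show "x \<in> ?f1 ` (?A \<times> ?F) \<union> ?f2 ` ?F"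
    proof (elim disjE exE conjE)
      fix \<sigma> D1 K1 \<mu>' D2 K2
      assume a: "shape d N \<sigma> t D1 K1" "fshape d N \<mu>' (add_mset t M - {#t#}) D2 K2" "\<mu> = add_mset (I \<sigma>) \<mu>'" "D = D1 + D2" "K = K1 + K2"
      then have "((\<sigma>, D1, K1), (\<mu>', D2, K2)) \<in> ?A \<times> ?F" using x by (auto simp: fibre_def ffibre_def)
      moreover have "x = ?f1 ((\<sigma>, D1, K1), (\<mu>', D2, K2))" using a x by simp
      ultimately show ?thesis by blast
    next
      fix D2 assume a: "fshape d N \<mu> (add_mset t M - {#t#}) D2 K" "D = Suc D2"
      then have "(\<mu>, D2, K) \<in> ?F" using x by (auto simp: ffibre_def)
      moreover have "x = ?f2 (\<mu>, D2, K)" using a x by simp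
      ultimately show ?thesis by blast
    qed
  qed
  have fin: "finite (?f1 ` (?A \<times> ?F))" "finite (?f2 ` ?F)" using A F by auto
  have nn: "0 \<le> defect u x" for x using u by (simp add: defect_nonneg)
  have "sum (defect u) (ffibre d N B (add_mset t M)) \<le> sum (defect u) (?f1 ` (?A \<times> ?F) \<union> ?f2 ` ?F)"
    using sub fin nn by (intro sum_mono2) auto
  also have "\<dots> \<le> sum (defect u) (?f1 ` (?A \<times> ?F)) + sum (defect u) (?f2 ` ?F)"
    by (rule sum_Un_le_nonneg[OF fin nn])
  finally have le: "sum (defect u) (ffibre d N B (add_mset t M))
      \<le> sum (defect u) (?f1 ` (?A \<times> ?F)) + sum (defect u) (?f2 ` ?F)" .
  have "sum (defect u) (?f1 ` (?A \<times> ?F)) \<le> (\<Sum>p\<in>?A \<times> ?F. defect u (?f1 p))"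
    using A F nn by (intro order_trans[OF sum_image_le]) (auto simp: o_def)
  also have "\<dots> = sum (defect u) ?A * sum (defect u) ?F"
    unfolding sum_product sum.cartesian_product by (intro sum.cong) (auto simp: defect_def power_add)
  finally have le1: "sum (defect u) (?f1 ` (?A \<times> ?F)) \<le> sum (defect u) ?A * sum (defect u) ?F" .
  have "sum (defect u) (?f2 ` ?F) \<le> (\<Sum>p\<in>?F. defect u (?f2 p))"
    using A F nn by (intro order_trans[OF sum_image_le]) (auto simp: o_def)
  also have "\<dots> = u * sum (defect u) ?F"
    unfolding sum_distrib_left by (intro sum.cong) (auto simp: defect_def)
  finally have "sum (defect u) (ffibre d N B (add_mset t M)) \<le> (sum (defect u) ?A + u) * sum (defect u) ?F"
    using le le1 by (simp add: distrib_right)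
  also have "\<dots> \<le> ((1 + u) * ?c ^ vertices t) * ((1 + u) ^ size M * ?c ^ (\<Sum>t\<in>#M. vertices t))"
  proof (intro mult_mono F)
    have "1 \<le> ?c ^ vertices t" using vfac_ge_1[of u d N] u by (intro one_le_power) auto
    then have "u * 1 \<le> u * ?c ^ vertices t" using u by (intro mult_left_mono) auto
    then show "sum (defect u) ?A + u \<le> (1 + u) * ?c ^ vertices t" using A by (simp add: distrib_right)
    show "0 \<le> (1 + u) * ?c ^ vertices t" using u vfac_ge_1[of u d N] by simp
    show "0 \<le> sum (defect u) ?F" by (rule sum_nonneg) (rule nn)
  qed
  also have "\<dots> = (1 + u) ^ size (add_mset t M) * ?c ^ (\<Sum>t\<in>#add_mset t M. vertices t)"
    by (simp add: power_add)
  finally show ?case using finite_subset[OF sub] fin by blast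
qed

text \<open>Induction on the tree: the weights are multiplicative over the children and over the
  exponents of X^k at the root, and one factor \<open>vfac\<close> per vertex pays for the slots and
  the powers.\<close>

lemma fibre_sum:
  assumes u: "0 < u" "u < 1" and N: "1 \<le> N"
  shows "finite (fibre d N B t) \<and> sum (defect u) (fibre d N B t) \<le> vfac d N u ^ vertices t"
proof (induction t)
  case (Node M)
  let ?c = "vfac d N u"
  have nn: "0 \<le> defect u x" for x using u by (simp add: defect_nonneg)
  show ?case
  proof (cases "size M = N")
    case False
    have "fibre d N B (Node M) \<subseteq> {({#Xi#}, 0, 0)}"
      using False by (auto simp: fibre_def elim: shape.cases)
    moreover from this have "sum (defect u) (fibre d N B (Node M)) \<le> sum (defect u) {({#Xi#}, 0, 0)}"
      by (rule sum_mono2[rotated]) (use nn in auto)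
    ultimately have "finite (fibre d N B (Node M))" "sum (defect u) (fibre d N B (Node M)) \<le> sum (defect u) {({#Xi#}, 0, 0)}"
      by (auto intro: finite_subset)
    moreover have "1 \<le> ?c ^ vertices (Node M)" using vfac_ge_1[of u d N] u by (intro one_le_power) auto
    ultimately show ?thesis by (simp add: defect_def)
  next
    case True
    let ?F = "ffibre d N B M" and ?K = "PiE {..d} (\<lambda>_. {..B})"
    let ?g = "\<lambda>(k, (\<mu>, D, K)). (Xpow d k + \<mu>, D, K + (\<Sum>i\<le>d. k i)) :: symb \<times> nat \<times> nat"
    have F: "finite ?F" "sum (defect u) ?F \<le> (1 + u) ^ size M * ?c ^ (\<Sum>t\<in>#M. vertices t)"
      using ffibre_sum[OF u, of M d N B] Node.IH by auto
    have K: "finite ?K" by (intro finite_PiE) auto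
    have sub: "fibre d N B (Node M) \<subseteq> ?g ` (?K \<times> ?F)"
    proof
      fix x assume "x \<in> fibre d N B (Node M)"
      then obtain \<tau> D K where x: "x = (\<tau>, D, K)" "shape d N \<tau> (Node M) D K" "D \<le> B" "K \<le> B"
        by (auto simp: fibre_def)
      have "M \<noteq> {#}" using True N by auto
      with x(2) obtain \<mu> K' k where s: "fshape d N \<mu> M D K'" "\<tau> = Xpow d k + \<mu>" "K = K' + (\<Sum>i\<le>d. k i)"
        by (auto elim: shape.cases)
      let ?k = "restrict k {..d}"
      have "k i \<le> B" if "i \<le> d" for i
      proof -
        have "k i \<le> (\<Sum>i\<le>d. k i)" using that by (intro member_le_sum) auto
        then show ?thesis using s x by simp
      qed
      then have "(?k, (\<mu>, D, K')) \<in> ?K \<times> ?F" using s x by (auto simp: ffibre_def)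
      moreover have "x = ?g (?k, (\<mu>, D, K'))" using s x by (simp add: Xpow_def)
      ultimately show "x \<in> ?g ` (?K \<times> ?F)" by blast
    qed
    have fin: "finite (?g ` (?K \<times> ?F))" using K F by auto
    have "sum (defect u) (fibre d N B (Node M)) \<le> sum (defect u) (?g ` (?K \<times> ?F))"
      using sub fin nn by (intro sum_mono2) auto
    also have "\<dots> \<le> (\<Sum>p\<in>?K \<times> ?F. defect u (?g p))"
      using K F nn by (intro order_trans[OF sum_image_le]) (auto simp: o_def)
    also have "\<dots> = (\<Sum>k\<in>?K. \<Prod>i\<in>{..d}. u ^ k i) * sum (defect u) ?F"
      unfolding sum_product sum.cartesian_product
      by (intro sum.cong) (auto simp: defect_def power_add power_sum)
    also have "(\<Sum>k\<in>?K. \<Prod>i\<in>{..d}. u ^ k i) = (\<Prod>i\<in>{..d}. \<Sum>j\<le>B. u ^ j)"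
      by (rule prod_sum_PiE[symmetric]) auto
    also have "\<dots> = (\<Sum>j\<le>B. u ^ j) ^ (d + 1)" by simp
    also have "\<dots> * sum (defect u) ?F \<le> (1 / (1 - u)) ^ (d + 1) * ((1 + u) ^ size M * ?c ^ (\<Sum>t\<in>#M. vertices t))"
    proof (intro mult_mono F power_mono)
      have "(\<Sum>j\<le>B. u ^ j) = (1 - u ^ Suc B) / (1 - u)" using u sum_gp0[of u B] by simp
      also have "\<dots> \<le> 1 / (1 - u)" using u by (intro divide_right_mono) auto
      finally show "(\<Sum>j\<le>B. u ^ j) \<le> 1 / (1 - u)" .
    qed (use u nn in \<open>auto intro: sum_nonneg\<close>)
    also have "\<dots> = ?c ^ vertices (Node M)" using True by (simp add: vfac_def)
    finally show ?thesis using finite_subset[OF sub fin] by blast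
  qed
qed

text \<open>For \<open>B = 0\<close> all weights are 1, while the bound of \<open>fibre_sum\<close>
  tends to 1 as u tends to 0. So a symbol without defects is determined by its tree, and no separate
  induction is needed.\<close>

lemma fibre_0_card:
  assumes N: "1 \<le> N"
  shows "finite (fibre d N 0 t) \<and> card (fibre d N 0 t) \<le> 1"
proof -
  have fin: "finite (fibre d N 0 t)" using fibre_sum[of "1/2" N d 0 t] N by simp
  have "real (card (fibre d N 0 t)) \<le> vfac d N u ^ vertices t" if "0 < u" "u < 1" for u
  proof -
    have "sum (defect u) (fibre d N 0 t) = (\<Sum>x\<in>fibre d N 0 t. 1)"
      by (intro sum.cong) (auto simp: fibre_def defect_def)
    then show ?thesis using fibre_sum[OF that N, of d 0 t] by simp
  qed
  then have "\<forall>\<^sub>F u in at_right 0. real (card (fibre d N 0 t)) \<le> vfac d N u ^ vertices t"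
    using eventually_at_right_real[of 0 1] by (auto elim!: eventually_mono)
  moreover have "((\<lambda>u. vfac d N u ^ vertices t) \<longlongrightarrow> vfac d N 0 ^ vertices t) (at_right 0)"
    unfolding vfac_def by (intro tendsto_intros) auto
  ultimately have "real (card (fibre d N 0 t)) \<le> vfac d N 0 ^ vertices t"
    by (intro tendsto_lowerbound) auto
  then show ?thesis using fin by (simp add: vfac_def)
qed

lemma card_UN_trees_le:
  assumes "\<And>t. regular N t \<Longrightarrow> finite (f t) \<and> real (card (f t)) \<le> b (inodes t)"
  shows "finite (\<Union>i<n. \<Union>t\<in>trees N i. f t) \<and>
         real (card (\<Union>i<n. \<Union>t\<in>trees N i. f t)) \<le> (\<Sum>i<n. real (tcount N i) * b i)"
proof -
  have fin: "finite (\<Union>t\<in>trees N i. f t)" for i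
    using assms finite_trees by (intro finite_UN_I) (auto simp: trees_def)
  have "real (card (\<Union>i<n. \<Union>t\<in>trees N i. f t)) \<le> real (\<Sum>i<n. card (\<Union>t\<in>trees N i. f t))"
    unfolding of_nat_le_iff by (rule card_UN_le) simp
  also have "\<dots> \<le> (\<Sum>i<n. real (tcount N i) * b i)"
    unfolding of_nat_sum
  proof (rule sum_mono)
    fix i
    have "real (card (\<Union>t\<in>trees N i. f t)) \<le> real (\<Sum>t\<in>trees N i. card (f t))"
      unfolding of_nat_le_iff by (rule card_UN_le[OF finite_trees])
    also have "\<dots> \<le> (\<Sum>t\<in>trees N i. b i)"
      unfolding of_nat_sum using assms by (intro sum_mono) (auto simp: trees_def)
    finally show "real (card (\<Union>t\<in>trees N i. f t)) \<le> real (tcount N i) * b i"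
      by (simp add: tcount_def)
  qed
  finally show ?thesis using fin by auto
qed

text \<open>Every weight is at least \<open>u ^ (2 * B)\<close>, which turns the weighted estimate
  into one of cardinalities; \<open>N * i + 1\<close> is the number of vertices.\<close>

lemma card_shapes_le:
  assumes N: "1 \<le> N" and u: "0 < u" "u < 1"
    and S: "\<And>\<tau>. \<tau> \<in> S \<Longrightarrow> \<exists>t D K. shape d N \<tau> t D K \<and> D \<le> B \<and> K \<le> B \<and> inodes t < n"
  shows "finite S \<and> real (card S) \<le> (\<Sum>i<n. real (tcount N i) * ((1 / u) ^ (2 * B) * vfac d N u ^ (N * i + 1)))"
proof -
  let ?U = "\<Union>i<n. \<Union>t\<in>trees N i. fst ` fibre d N B t"
  have sub: "S \<subseteq> ?U"
  proof
    fix \<tau> assume "\<tau> \<in> S"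
    then obtain t D K where "shape d N \<tau> t D K" "D \<le> B" "K \<le> B" "inodes t < n" using S by blast
    then show "\<tau> \<in> ?U" using shape_regular(1)[of d N \<tau> t D K]
      by (auto simp: trees_def fibre_def image_iff)
  qed
  have "finite (fst ` fibre d N B t) \<and> real (card (fst ` fibre d N B t)) \<le> (1 / u) ^ (2 * B) * vfac d N u ^ (N * inodes t + 1)"
    if t: "regular N t" for t
  proof -
    have fs: "finite (fibre d N B t)" "sum (defect u) (fibre d N B t) \<le> vfac d N u ^ (N * inodes t + 1)"
      using fibre_sum[OF u N, of d B t] vertices_eq_inodes[OF t] by auto
    have "u ^ (2 * B) * real (card (fst ` fibre d N B t)) \<le> u ^ (2 * B) * real (card (fibre d N B t))"
      using card_image_le[OF fs(1), of fst] u by (intro mult_left_mono) auto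
    also have "\<dots> = (\<Sum>x\<in>fibre d N B t. u ^ (2 * B))" by simp
    also have "\<dots> \<le> sum (defect u) (fibre d N B t)"
      using u by (intro sum_mono) (auto simp: fibre_def defect_def intro!: power_decreasing)
    finally have "u ^ (2 * B) * real (card (fst ` fibre d N B t)) \<le> vfac d N u ^ (N * inodes t + 1)"
      using fs by linarith
    then show ?thesis using fs(1) u by (simp add: power_divide field_simps)
  qed
  from card_UN_trees_le[of N "\<lambda>t. fst ` fibre d N B t"
      "\<lambda>i. (1 / u) ^ (2 * B) * vfac d N u ^ (N * i + 1)" n, OF this] have "finite ?U" "real (card ?U) \<le> (\<Sum>i<n. real (tcount N i) * ((1 / u) ^ (2 * B) * vfac d N u ^ (N * i + 1)))"
    by auto
  moreover from this have "real (card S) \<le> real (card ?U)"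
    unfolding of_nat_le_iff by (intro card_mono sub)
  ultimately show ?thesis using finite_subset[OF sub] by linarith
qed

lemma card_perfect_shapes_le:
  assumes N: "1 \<le> N"
    and S: "\<And>\<tau>. \<tau> \<in> S \<Longrightarrow> \<exists>t. shape d N \<tau> t 0 0 \<and> inodes t < n"
  shows "finite S \<and> real (card S) \<le> (\<Sum>i<n. real (tcount N i))"
proof -
  let ?U = "\<Union>i<n. \<Union>t\<in>trees N i. fst ` fibre d N 0 t"
  have sub: "S \<subseteq> ?U"
  proof
    fix \<tau> assume "\<tau> \<in> S"
    then obtain t where "shape d N \<tau> t 0 0" "inodes t < n" using S by blast
    then show "\<tau> \<in> ?U" using shape_regular(1)[of d N \<tau> t 0 0]
      by (auto simp: trees_def fibre_def image_iff)
  qed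
  have "finite (fst ` fibre d N 0 t) \<and> real (card (fst ` fibre d N 0 t)) \<le> 1" for t
    using fibre_0_card[OF N, of d t] card_image_le[of "fibre d N 0 t" fst] by auto
  from card_UN_trees_le[of N "\<lambda>t. fst ` fibre d N 0 t" "\<lambda>_. 1" n, OF this] have "finite ?U" "real (card ?U) \<le> (\<Sum>i<n. real (tcount N i) * 1)"
    by auto
  moreover from this have "real (card S) \<le> real (card ?U)"
    unfolding of_nat_le_iff by (intro card_mono sub)
  ultimately show ?thesis using finite_subset[OF sub] by auto
qed

section \<open>Regular trees as symbols without defects\<close>

primrec emb :: "utree \<Rightarrow> symb" where
  "emb (Node M) = (if M = {#} then {#Xi#} else image_mset I (image_mset emb M))"

text \<open>A chosen preimage under \<open>emb\<close> inverts it on \<open>M\<close> by the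
  induction hypothesis, and also on \<open>M'\<close>, because each child of the second tree has the
  same image as some child of the first.\<close>

lemma emb_inject: "emb s = emb t \<Longrightarrow> s = t"
proof (induction s arbitrary: t)
  case (Node M)
  obtain M' where t: "t = Node M'" by (cases t)
  show ?case
  proof (cases "M = {#} \<or> M' = {#}")
    case True
    have "image_mset I A \<noteq> {#Xi#}" for A
    proof
      assume "image_mset I A = {#Xi#}"
      then have "Xi \<in># image_mset I A" by simp
      then show False by auto
    qed
    then show ?thesis using Node.prems True t by (auto split: if_splits)
  next
    case False
    then have eq: "image_mset I (image_mset emb M) = image_mset I (image_mset emb M')"
      using Node.prems t by simp
    let ?un = "\<lambda>g. case g of I \<tau> \<Rightarrow> \<tau> | _ \<Rightarrow> {#}"
    have "image_mset ?un (image_mset I A) = A" for A by (simp add: multiset.map_comp o_def)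
    then have eq': "image_mset emb M = image_mset emb M'" using eq by metis
    let ?g = "\<lambda>\<sigma>. SOME t. emb t = \<sigma>"
    have g: "?g (emb x) = x" if "x \<in># M" for x
      using Node.IH[OF that] by (metis (mono_tags, lifting) someI)
    have g': "?g (emb y) = y" if "y \<in># M'" for y
    proof -
      have "emb y \<in># image_mset emb M" unfolding eq' using that by simp
      then obtain x where "x \<in># M" "emb x = emb y" by auto
      then show ?thesis using Node.IH[of x y] g by auto
    qed
    have "M = image_mset ?g (image_mset emb M)"
      using g by (simp add: multiset.map_comp o_def multiset.map_ident_strong)
    also have "\<dots> = image_mset ?g (image_mset emb M')" by (simp only: eq')
    also have "\<dots> = M'"
      using g' by (simp add: multiset.map_comp o_def multiset.map_ident_strong)
    finally show ?thesis using t by (simp only:)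
  qed
qed

text \<open>Called for by the convention I(X^k) = 0: a symbol may be planted once it contains
  another generator than the X.\<close>

lemma not_Xpow: "g \<in># \<tau> \<Longrightarrow> (\<And>i. g \<noteq> X i) \<Longrightarrow> \<tau> \<notin> range (Xpow d)"
proof -
  have "g \<in># (\<Sum>i\<le>n. replicate_mset (k i) (X i)) \<Longrightarrow> \<exists>i. g = X i" for n k
    by (induction n) (auto split: if_splits)
  then show "g \<in># \<tau> \<Longrightarrow> (\<And>i. g \<noteq> X i) \<Longrightarrow> \<tau> \<notin> range (Xpow d)"
    unfolding Xpow_def by blast
qed

lemma WW_mono: "m \<le> m' \<Longrightarrow> WW d N m \<subseteq> WW d N m'"
  by (rule lift_Suc_mono_le[where f="WW d N"]) auto

lemma image_mset_eq_sum_nth: "image_mset f (mset ts) = (\<Sum>i=1..length ts. {#f (ts ! (i - 1))#})"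
  by (induction ts rule: rev_induct) (auto simp: nth_append intro!: sum.cong)

lemma emb_not_Xpow: "emb t \<notin> range (Xpow d)"
proof (cases t)
  case (Node M)
  show ?thesis
  proof (cases "M = {#}")
    case True
    then show ?thesis using not_Xpow[of Xi "emb t" d] Node by simp
  next
    case False
    then obtain s where "s \<in># M" by auto
    then have "I (emb s) \<in># emb t" using Node False by simp
    then show ?thesis by (rule not_Xpow) simp
  qed
qed

lemma emb_WW: "1 \<le> N \<Longrightarrow> regular N t \<Longrightarrow> \<exists>m. emb t \<in> WW d N m"
proof (induction t)
  case (Node M)
  show ?case
  proof (cases "M = {#}")
    case True
    then show ?thesis by (intro exI[of _ "Suc 0"]) simp
  next
    case False
    then have M: "size M = N" "\<forall>t\<in>#M. regular N t" using Node.prems by (auto simp: regular_Node_iff)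
    then have "\<forall>t\<in>#M. \<exists>m. emb t \<in> WW d N m" using Node.IH Node.prems by blast
    then obtain f where f: "\<And>t. t \<in># M \<Longrightarrow> emb t \<in> WW d N (f t)" by metis
    \<comment> \<open>A product takes its factors from one level, hence the maximum over the
      children; the successor makes the level positive, as \<open>UU d N 0\<close> is empty.\<close>
    define m where "m = Suc (Max (f ` set_mset M))"
    have fm: "emb t \<in> WW d N m" if "t \<in># M" for t
    proof -
      have "f t \<le> m" using that unfolding m_def by (simp add: le_SucI)
      then show ?thesis using f[OF that] WW_mono by blast
    qed
    obtain ts where ts: "M = mset ts" using ex_mset by metis
    have "emb (Node M) = image_mset (\<lambda>t. I (emb t)) (mset ts)"
      using False by (simp add: ts multiset.map_comp o_def)
    also have "\<dots> = (\<Sum>i=1..N. {#I (emb (ts ! (i - 1)))#})"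
      unfolding image_mset_eq_sum_nth using M ts by simp
    finally have eq: "emb (Node M) = (\<Sum>i=1..N. {#I (emb (ts ! (i - 1)))#})" .
    have "{#I (emb (ts ! (i - 1)))#} \<in> UU d N m" if "i \<in> {1..N}" for i
    proof -
      have "ts ! (i - 1) \<in># M" using that M ts by (auto simp: nth_mem)
      then show ?thesis using fm emb_not_Xpow[of _ d] unfolding m_def UU.simps by blast
    qed
    then have "emb (Node M) \<in> WW d N (Suc m)"
      unfolding WW.simps(2) eq using Node.prems by (intro UnI2 UN_I[of N]) auto
    then show ?thesis by blast
  qed
qed

lemma homog_emb:
  fixes d N :: nat and \<rho> \<kappa> :: real
  defines "\<alpha> \<equiv> ((real N + 1) * \<rho> - (real N - 1) * real d) / 2 - (real N - 1) * \<kappa>"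
    and "\<beta> \<equiv> - (\<rho> + real d) / 2 - \<kappa>"
  shows "regular N t \<Longrightarrow> homog d \<rho> \<kappa> (emb t) = real (inodes t) * \<alpha> + \<beta>"
proof (induction t)
  case (Node M)
  show ?case
  proof (cases "M = {#}")
    case True
    then show ?thesis by (simp add: homog_def \<beta>_def alpha0_def)
  next
    case False
    have \<alpha>: "real N * (\<beta> + \<rho>) = \<alpha> + \<beta>" unfolding \<alpha>_def \<beta>_def by (simp add: field_simps)
    have M: "size M = N" "\<forall>t\<in>#M. regular N t" using Node.prems False by (auto simp: regular_Node_iff)
    have "homog d \<rho> \<kappa> (emb (Node M)) = (\<Sum>t\<in>#M. homog d \<rho> \<kappa> (emb t) + \<rho>)"
      using False by (simp add: homog_def multiset.map_comp o_def)
    also have "\<dots> = (\<Sum>t\<in>#M. real (inodes t) * \<alpha> + \<beta> + \<rho>)"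
      using Node.IH M by (intro arg_cong[of _ _ sum_mset] image_mset_cong) auto
    also have "\<dots> = real (weight M) * \<alpha> + real (size M) * (\<beta> + \<rho>)"
      unfolding weight_def by (induction M) (simp_all add: algebra_simps)
    also have "\<dots> = real (inodes (Node M)) * \<alpha> + \<beta>"
      using False \<alpha> M by (simp add: weight_def algebra_simps)
    finally show ?thesis .
  qed
qed

text \<open>Finiteness has to be known beforehand, as \<open>card\<close> is 0 on infinite sets. The
  left-hand side of \<open>neg\<close> is the homogeneity of \<open>emb t\<close> for a tree with
  \<open>i\<close> non-leaf vertices.\<close>

lemma tcount_le_c_F:
  assumes N: "1 \<le> N" and fin: "finite (neg_symbols N d \<rho> \<kappa>)"
    and neg: "real i * (((real N + 1) * \<rho> - (real N - 1) * real d) / 2 - (real N - 1) * \<kappa>) - (\<rho> + real d) / 2 - \<kappa> < 0"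
  shows "tcount N i \<le> c_F N d \<rho> \<kappa>"
proof -
  have "emb t \<in> neg_symbols N d \<rho> \<kappa>" if t: "t \<in> trees N i" for t
  proof -
    have r: "regular N t" "inodes t = i" using t by (auto simp: trees_def)
    then obtain m where "emb t \<in> WW d N m" using emb_WW[OF N] by blast
    then have "emb t \<in> FF d N" by (auto simp: FF_def)
    moreover have "homog d \<rho> \<kappa> (emb t) < 0" using homog_emb[OF r(1), of d \<rho> \<kappa>] neg unfolding r(2) by linarith
    ultimately show ?thesis by (simp add: neg_symbols_def)
  qed
  then have "card (emb ` trees N i) \<le> c_F N d \<rho> \<kappa>" unfolding c_F_def by (intro card_mono fin) auto
  moreover have "inj_on emb (trees N i)" by (rule inj_onI) (rule emb_inject)
  ultimately show ?thesis by (simp add: card_image tcount_def)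
qed

section \<open>The radius of convergence for ternary trees\<close>

text \<open>Substituting n = N i + 1 turns the series of \<open>w\<close> at r into r times the tree
  series at r^N, so the two radii differ by an N-th root.\<close>

lemma (in regular_trees) alphaR_eq: "alphaR N = root N (rad N)"
proof -
  let ?r = "root N (rad N)"
  have N: "N > 0" using N2 by simp
  have mono: "strict_mono (\<lambda>i. N * i + 1)" using N by (auto simp: strict_mono_def)
  have off: "real (w N n) * r ^ n = 0" if "n \<notin> range (\<lambda>i. N * i + 1)" for n r
  proof -
    have "w N n = 0" by (rule w_eq_0) (use that in auto)
    then show ?thesis by simp
  qed
  have iff: "summable (\<lambda>n. real (w N n) * r ^ n) \<longleftrightarrow> r ^ N \<le> rad N" if "0 < r" for r
  proof -
    have eq: "real (w N (N * i + 1)) * r ^ (N * i + 1) = r * (real (tcount N i) * (r ^ N) ^ i)" for i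
      using w_tcount[of N i] N by (simp add: power_mult)
    have "summable (\<lambda>n. real (w N n) * r ^ n) \<longleftrightarrow> summable (\<lambda>i. real (w N (N * i + 1)) * r ^ (N * i + 1))"
      by (rule summable_mono_reindex[OF mono off, symmetric])
    also have "\<dots> \<longleftrightarrow> summable (\<lambda>i. real (tcount N i) * (r ^ N) ^ i)"
      unfolding eq using that by (simp add: summable_cmult_iff)
    also have "\<dots> \<longleftrightarrow> r ^ N \<le> rad N" using that by (intro summable_iff_le_rad) simp
    finally show ?thesis .
  qed
  have r: "0 < ?r" "?r ^ N = rad N" using N rad_pos by (auto simp: real_root_pow_pos2)
  have "conv_radius (\<lambda>n. real (w N n)) = ereal ?r"
  proof (rule antisym)
    have "summable (\<lambda>n. real (w N n) * ?r ^ n)" using iff[OF r(1)] r by simp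
    from conv_radius_geI[OF this] show "ereal ?r \<le> conv_radius (\<lambda>n. real (w N n))" using r by simp
    show "conv_radius (\<lambda>n. real (w N n)) \<le> ereal ?r"
    proof (rule conv_radius_leI_ex')
      fix s :: real assume s: "0 < s" "ereal ?r < ereal s"
      then have "?r ^ N < s ^ N" using r N by (intro power_strict_mono) auto
      then show "\<not> summable (\<lambda>n. real (w N n) * of_real s ^ n)" using iff[OF s(1)] r by simp
    qed (use r in simp)
  qed
  then show ?thesis by (simp add: alphaR_def)
qed

lemma (in regular_trees) ln_alphaR: "ln (1 / alphaR N) = ln (1 / rad N) / real N"
  unfolding alphaR_eq using N2 rad_pos by (simp add: ln_div ln_root)

section \<open>Enclosure of the radius for N = 3\<close>

lemma newton_3: "newton s 3 = s 1 ^ 3 / 6 + s 1 * s 2 / 2 + s 3 / (3 :: real)"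
  by (simp add: eval_nat_numeral newton.simps(2) field_simps)

interpretation T3: regular_trees 3 by unfold_locales simp

text \<open>\<open>1 + q + q\<^sup>2 + 2 q\<^sup>3 + 5 q\<^sup>4\<close> dominates the series at the small arguments \<open>q\<close>, its
  coefficients being those of the series except for the last one, which is one too large.\<close>

lemma small_supersolution:
  fixes q :: real
  assumes "0 \<le> q" "q \<le> 1 / 50"
  defines "f \<equiv> \<lambda>q::real. 1 + q + q\<^sup>2 + 2 * q ^ 3 + 5 * q ^ 4"
  shows "1 + q * (f q ^ 3 / 6 + f q * f (q\<^sup>2) / 2 + f (q ^ 3) / 3) \<le> f q"
proof -
  have p: "q ^ k \<le> q / 50" if "2 \<le> k" for k
  proof -
    have "q ^ k \<le> q ^ 2" using assms that by (intro power_decreasing) auto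
    also have "\<dots> \<le> q * (1 / 50)" using assms unfolding power2_eq_square by (intro mult_left_mono) auto
    finally show ?thesis by simp
  qed
  \<comment> \<open>The slack of the inequality is q^4 times this polynomial; its constant term 1 is
    the excess of the last coefficient of \<open>f\<close>.\<close>
  let ?r = "1 - 9 * q - 10 * q ^ 2 - 16 * q ^ 3 - 20 * q ^ 4 - 33 * q ^ 5 - 29 * q ^ 6 - 30 * q ^ 7 - 30 * q ^ 8 - 35 * q ^ 9"
  have "0 \<le> ?r"
    using p[of 2] p[of 3] p[of 4] p[of 5] p[of 6] p[of 7] p[of 8] p[of 9] assms by simp
  then have "0 \<le> q ^ 4 * ?r" using assms by simp
  also have "q ^ 4 * ?r = f q - (1 + q * (f q ^ 3 / 6 + f q * f (q\<^sup>2) / 2 + f (q ^ 3) / 3))"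
    unfolding f_def by (simp add: eval_nat_numeral field_simps)
  finally show ?thesis by simp
qed

text \<open>Only the series at x, x^2 and x^3 needs explicit numerical bounds; from x^4 on the
  arguments are below 1/50 and the polynomial applies. So close to the critical point the admissible
  values of \<open>Y 1\<close> form a narrow interval, which accounts for the digits. An enclosure
  of width 4 / 10^7 is what six decimals of the final constant demand.\<close>

lemma rad_3_lower: "3551814 / 10 ^ 7 \<le> rad 3"
proof -
  define x :: real where "x = 3551814 / 10 ^ 7"
  let ?f = "\<lambda>q::real. 1 + q + q\<^sup>2 + 2 * q ^ 3 + 5 * q ^ 4"
  define Y where "Y j = (if j = 1 then 21174 / 10 ^ 4 else if j = 2 then 11474494 / 10 ^ 7
     else if j = 3 then 10470130 / 10 ^ 7 else ?f (x ^ j))" for j :: nat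
  have x: "0 \<le> x" "x \<le> 1" "x ^ 4 \<le> 1 / 50" by (simp_all add: x_def power_divide)
  have Y_large: "Y j = ?f (x ^ j)" if "4 \<le> j" for j using that by (simp add: Y_def)
  have Y_small: "Y 1 = 21174 / 10 ^ 4" "Y 2 = 11474494 / 10 ^ 7" "Y 3 = 10470130 / 10 ^ 7"
    by (simp_all add: Y_def)
  have xp: "x ^ 2 \<le> 1261538270 / 10 ^ 10" "x ^ 3 \<le> 448074929 / 10 ^ 10" "x ^ 4 \<le> 159147881 / 10 ^ 10"
      "x ^ 6 \<le> 20077115 / 10 ^ 10" "x ^ 9 \<le> 899606 / 10 ^ 10"
    by (simp_all add: x_def power_divide)
  note x2 = xp(1) and x3 = xp(2)
  have f: "?f (x ^ j) \<le> ?f b" if "x ^ j \<le> b" for j b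
    using that x by (intro add_mono mult_left_mono power_mono) auto
  have f4: "?f (x ^ 4) \<le> 10161764512 / 10 ^ 10" by (rule order_trans[OF f[OF xp(3)]]) (simp add: power_divide)
  have f6: "?f (x ^ 6) \<le> 10020117587 / 10 ^ 10" by (rule order_trans[OF f[OF xp(4)]]) (simp add: power_divide)
  have f9: "?f (x ^ 9) \<le> 10000899687 / 10 ^ 10" by (rule order_trans[OF f[OF xp(5)]]) (simp add: power_divide)
  have "tpart 3 M (x ^ 1) \<le> Y 1" for M
  proof (rule T3.tpart_le_supersolution)
    fix j :: nat assume j: "1 \<le> j"
    have n: "newton (\<lambda>i. Y (j * i)) 3 = Y j ^ 3 / 6 + Y j * Y (j * 2) / 2 + Y (j * 3) / 3"
      by (simp add: newton_3)
    consider "j = 1" | "j = 2" | "j = 3" | "4 \<le> j" using j by linarith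
    then show "1 + x ^ j * newton (\<lambda>i. Y (j * i)) 3 \<le> Y j"
    proof cases
      case 1
      have m: "Y (1 * 2) = Y 2" "Y (1 * 3) = Y 3" by simp_all
      show ?thesis unfolding n unfolding 1 m Y_small by (simp add: x_def power_divide)
    next
      case 2
      have m: "Y (2 * 2) = ?f (x ^ 4)" "Y (2 * 3) = ?f (x ^ 6)" by (simp_all add: Y_large)
      have "1 + x ^ 2 * (Y 2 ^ 3 / 6 + Y 2 * ?f (x ^ 4) / 2 + ?f (x ^ 6) / 3)
        \<le> 1 + 1261538270 / 10 ^ 10 * (Y 2 ^ 3 / 6 + Y 2 * (10161764512 / 10 ^ 10) / 2 + 10020117587 / 10 ^ 10 / 3)"
        using f4 f6 x2 x unfolding Y_small by (intro add_left_mono mult_mono add_mono divide_right_mono) auto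
      also have "\<dots> \<le> Y 2" unfolding Y_small by (simp add: power_divide)
      finally show ?thesis unfolding n unfolding 2 m .
    next
      case 3
      have m: "Y (3 * 2) = ?f (x ^ 6)" "Y (3 * 3) = ?f (x ^ 9)" by (simp_all add: Y_large)
      have "1 + x ^ 3 * (Y 3 ^ 3 / 6 + Y 3 * ?f (x ^ 6) / 2 + ?f (x ^ 9) / 3)
        \<le> 1 + 448074929 / 10 ^ 10 * (Y 3 ^ 3 / 6 + Y 3 * (10020117587 / 10 ^ 10) / 2 + 10000899687 / 10 ^ 10 / 3)"
        using f6 f9 x3 x unfolding Y_small by (intro add_left_mono mult_mono add_mono divide_right_mono) auto
      also have "\<dots> \<le> Y 3" unfolding Y_small by (simp add: power_divide)
      finally show ?thesis unfolding n unfolding 3 m .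
    next
      case 4
      have "x ^ j \<le> x ^ 4" using 4 x by (intro power_decreasing) auto
      then have "x ^ j \<le> 1 / 50" using x by linarith
      from small_supersolution[OF _ this]
      have "1 + x ^ j * (?f (x ^ j) ^ 3 / 6 + ?f (x ^ j) * ?f ((x ^ j)\<^sup>2) / 2 + ?f ((x ^ j) ^ 3) / 3) \<le> ?f (x ^ j)"
        using x by simp
      moreover have "Y (j * 2) = ?f ((x ^ j)\<^sup>2)" "Y (j * 3) = ?f ((x ^ j) ^ 3)"
        using Y_large[of "j * 2"] Y_large[of "j * 3"] 4 by (simp_all only: power_mult)
      ultimately show ?thesis unfolding n Y_large[OF 4] by (simp only:)
    qed
    have "1 \<le> Y j" if "4 \<le> j" unfolding Y_large[OF that] using x by simp
    moreover have "j = 1 \<or> j = 2 \<or> j = 3 \<or> 4 \<le> j" using j by linarith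
    ultimately show "1 \<le> Y j" using Y_small by auto
  qed (use x in auto)
  then have "summable (\<lambda>n. real (tcount 3 n) * x ^ n)"
    using T3.summable_iff_tpart_bounded[of x] x by auto
  then show ?thesis unfolding x_def[symmetric] using x by (intro T3.rad_upper) auto
qed

text \<open>A subsolution \<open>L\<close> lies below the series if the right-hand side of the
  equation, as a function of its first argument, has slope below 1 up to \<open>L\<close>. The slope
  at \<open>L\<close> is q (L^2 + b) / 2, whence the hypothesis.\<close>

lemma tgf_3_ge:
  fixes q :: real
  assumes q: "0 \<le> q" "q \<le> rad 3" and b: "b \<le> tgf 3 (q\<^sup>2)" "0 \<le> b" and c: "c \<le> tgf 3 (q ^ 3)"
    and L: "0 \<le> L" "q * (L\<^sup>2 + b) < 2" "L \<le> 1 + q * (L ^ 3 / 6 + L * b / 2 + c / 3)"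
  shows "L \<le> tgf 3 q"
proof (rule ccontr)
  let ?y = "tgf 3 q"
  assume "\<not> L \<le> ?y"
  then have less: "?y < L" by simp
  have y1: "1 \<le> ?y" using T3.tgf_real_ge_1 q by simp
  have "?y = 1 + q * (?y ^ 3 / 6 + ?y * tgf 3 (q\<^sup>2) / 2 + tgf 3 (q ^ 3) / 3)"
    using T3.tgf_eq_h[of q] q by (simp add: T3.h_def newton_3)
  also have "\<dots> \<ge> 1 + q * (?y ^ 3 / 6 + ?y * b / 2 + c / 3)"
    using q b c y1 by (intro add_left_mono mult_left_mono add_mono divide_right_mono) auto
  finally have "L - ?y \<le> q * ((L ^ 3 - ?y ^ 3) / 6 + (L - ?y) * b / 2)"
    using L(3) by (simp add: algebra_simps diff_divide_distrib)
  also have "(L ^ 3 - ?y ^ 3) / 6 \<le> (L - ?y) * L\<^sup>2 / 2"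
  proof -
    have "L ^ 3 - ?y ^ 3 = (L - ?y) * (L\<^sup>2 + L * ?y + ?y\<^sup>2)" by (simp add: power2_eq_square power3_eq_cube algebra_simps)
    also have "\<dots> \<le> (L - ?y) * (3 * L\<^sup>2)"
    proof (rule mult_left_mono)
      have "L * ?y \<le> L\<^sup>2" "?y\<^sup>2 \<le> L\<^sup>2" using less y1 L by (auto simp: power2_eq_square intro!: mult_mono)
      then show "L\<^sup>2 + L * ?y + ?y\<^sup>2 \<le> 3 * L\<^sup>2" by simp
    qed (use less in simp)
    finally show ?thesis by simp
  qed
  also have "q * ((L - ?y) * L\<^sup>2 / 2 + (L - ?y) * b / 2) = (L - ?y) * (q * (L\<^sup>2 + b) / 2)"
    by (simp add: algebra_simps add_divide_distrib)
  also have "\<dots> < (L - ?y) * 1"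
    using less L by (intro mult_strict_left_mono) auto
  finally show False using q by (simp add: mult_left_mono)
qed

text \<open>If x were within the disc, y = T(x) would solve a cubic equation whose other
  coefficients are bounded below by T(x^2) and T(x^3). Beyond the critical point the cubic
  expression exceeds y for all y \<ge> 1, which its tangent certifies. The bounds at the powers of x
  start from the trivial bound 1 at high powers.\<close>

lemma rad_3_upper: "rad 3 \<le> 3551818 / 10 ^ 7"
proof (rule ccontr)
  define x :: real where "x = 3551818 / 10 ^ 7"
  assume "\<not> rad 3 \<le> 3551818 / 10 ^ 7"
  then have x: "0 \<le> x" "x \<le> rad 3" by (simp_all add: x_def)
  have xk: "x ^ k \<le> rad 3" if "1 \<le> k" for k
    using T3.power_le_rad[of x k] x that by simp
  have g1: "1 \<le> tgf 3 (x ^ k)" if "1 \<le> k" for k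
    by (rule T3.tgf_real_ge_1) (use xk[OF that] x in auto)
  have pw: "(x ^ k)\<^sup>2 = x ^ (k * 2)" "(x ^ k) ^ 3 = x ^ (k * 3)" for k
    by (simp_all only: power_mult)
  have step: "L \<le> tgf 3 (x ^ k)"
    if "1 \<le> k" "k * 2 = k2" "k * 3 = k3" "b \<le> tgf 3 (x ^ k2)" "c \<le> tgf 3 (x ^ k3)" "0 \<le> b" "0 \<le> L"
      "x ^ k * (L\<^sup>2 + b) < 2" "L \<le> 1 + x ^ k * (L ^ 3 / 6 + L * b / 2 + c / 3)" for k k2 k3 b c L
  proof (rule tgf_3_ge[of "x ^ k" b c])
    show "b \<le> tgf 3 ((x ^ k)\<^sup>2)" "c \<le> tgf 3 ((x ^ k) ^ 3)" unfolding pw that(2,3) by (rule that)+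
  qed (use that xk[OF that(1)] x in auto)
  have L8: "200050669 / 200000000 \<le> tgf 3 (x ^ 8)"
  proof (rule step)
    show "1 \<le> tgf 3 (x ^ 16)" by (rule g1) simp
    show "1 \<le> tgf 3 (x ^ 24)" by (rule g1) simp
  qed (simp_all add: x_def power_divide)
  have L9: "62505623 / 62500000 \<le> tgf 3 (x ^ 9)"
  proof (rule step)
    show "1 \<le> tgf 3 (x ^ 18)" by (rule g1) simp
    show "1 \<le> tgf 3 (x ^ 27)" by (rule g1) simp
  qed (simp_all add: x_def power_divide)
  have L6: "1002011767 / 1000000000 \<le> tgf 3 (x ^ 6)"
  proof (rule step)
    show "1 \<le> tgf 3 (x ^ 12)" by (rule g1) simp
    show "1 \<le> tgf 3 (x ^ 18)" by (rule g1) simp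
  qed (simp_all add: x_def power_divide)
  have L4: "508088223 / 500000000 \<le> tgf 3 (x ^ 4)"
  proof (rule step)
    show "200050669 / 200000000 \<le> tgf 3 (x ^ 8)" by (rule L8)
    show "1 \<le> tgf 3 (x ^ 12)" by (rule g1) simp
  qed (simp_all add: x_def power_divide)
  have L2: "229489939 / 200000000 \<le> tgf 3 (x ^ 2)"
  proof (rule step)
    show "508088223 / 500000000 \<le> tgf 3 (x ^ 4)" by (rule L4)
    show "1002011767 / 1000000000 \<le> tgf 3 (x ^ 6)" by (rule L6)
  qed (simp_all add: x_def power_divide)
  have L3: "1047013013 / 1000000000 \<le> tgf 3 (x ^ 3)"
  proof (rule step)
    show "1002011767 / 1000000000 \<le> tgf 3 (x ^ 6)" by (rule L6)
    show "62505623 / 62500000 \<le> tgf 3 (x ^ 9)" by (rule L9)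
  qed (simp_all add: x_def power_divide)
  define y where "y = tgf 3 x"
  have y1: "1 \<le> y" unfolding y_def using g1[of 1] by simp
  have "y = 1 + x * (y ^ 3 / 6 + y * tgf 3 (x ^ 2) / 2 + tgf 3 (x ^ 3) / 3)"
    unfolding y_def using T3.tgf_eq_h[of x] x by (simp add: T3.h_def newton_3)
  also have "\<dots> \<ge> 1 + x * (y ^ 3 / 6 + y * (229489939 / 200000000) / 2 + 1047013013 / 1000000000 / 3)"
    using L2 L3 y1 x by (intro add_left_mono mult_left_mono add_mono divide_right_mono) auto
  finally have 1: "1 + x * (y ^ 3 / 6 + y * (229489939 / 200000000) / 2 + 1047013013 / 1000000000 / 3) \<le> y" .
  \<comment> \<open>The point of tangency is approximately the critical value, where the right-hand
    side has slope 1 in y; there the linear terms nearly cancel and a constant contradiction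
    remains.\<close>
  let ?z = "21174205 / 10 ^ 7 :: real"
  have "3 * v\<^sup>2 * u - 2 * v ^ 3 \<le> u ^ 3" if "0 \<le> u" "0 \<le> v" for u v :: real
  proof -
    have "0 \<le> (u - v)\<^sup>2 * (u + 2 * v)" using that by simp
    also have "\<dots> = u ^ 3 - (3 * v\<^sup>2 * u - 2 * v ^ 3)"
      by (simp add: power2_eq_square power3_eq_cube algebra_simps)
    finally show ?thesis by simp
  qed
  from this[of y ?z] have "3 * ?z\<^sup>2 * y - 2 * ?z ^ 3 \<le> y ^ 3" using y1 by simp
  then show False using 1 y1 unfolding x_def by (simp add: field_simps power_divide)
qed

lemma betaR_3: "betaR 3 = 9 / 8 * ln (1 / alphaR 3)"
  by (simp add: betaR_def)

text \<open>Ten terms of the series of 2 artanh y, where ln x = 2 artanh ((x - 1) / (x +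
  1)).\<close>

lemma ln_artanh_bounds:
  fixes x y :: real
  assumes "1 < x" "y = (x - 1) / (x + 1)"
  defines "s \<equiv> 2 * (y + y ^ 3 / 3 + y ^ 5 / 5 + y ^ 7 / 7 + y ^ 9 / 9 + y ^ 11 / 11 + y ^ 13 / 13
    + y ^ 15 / 15 + y ^ 17 / 17 + y ^ 19 / 19)"
  shows "s \<le> ln x" "ln x \<le> s + 2 * (y ^ 21 / (1 - y\<^sup>2) / 21)"
proof -
  have "(\<Sum>k<10. 2 * y ^ (2 * k + 1) / real (2 * k + 1)) = s"
    unfolding s_def by (simp add: lessThan_nat_numeral lessThan_Suc flip: power_Suc)
  then show "s \<le> ln x" "ln x \<le> s + 2 * (y ^ 21 / (1 - y\<^sup>2) / 21)"
    using ln_approx_bounds[OF assms(1), of 10] unfolding assms(2)[symmetric] by auto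
qed

lemma ln_2_bounds: "69314718 / 10 ^ 8 \<le> ln (2::real)" "ln (2::real) \<le> 69314719 / 10 ^ 8"
proof -
  show "69314718 / 10 ^ 8 \<le> ln (2::real)"
    by (rule order_trans[OF _ ln_artanh_bounds(1)[of 2 "1 / 3"]]) (simp_all add: power_divide)
  show "ln (2::real) \<le> 69314719 / 10 ^ 8"
    by (rule order_trans[OF ln_artanh_bounds(2)[of 2 "1 / 3"]]) (simp_all add: power_divide)
qed

text \<open>The factor \<open>8\<close> makes the argument \<open>8 c\<^sup>2\<close> close to \<open>1\<close> for the two values of \<open>c\<close> below.\<close>

lemma ln_inverse_bounds:
  fixes c y :: real
  assumes "0 < c" "1 < 8 * c\<^sup>2" "y = (8 * c\<^sup>2 - 1) / (8 * c\<^sup>2 + 1)"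
  shows "ln (1 / c) \<le> (3 * (69314719 / 10 ^ 8) - 2 * y) / 2"
    and "(3 * (69314718 / 10 ^ 8) - (2 * y + 2 * (y ^ 3 / (1 - y\<^sup>2) / 3))) / 2 \<le> ln (1 / c)"
proof -
  have "ln (8 * c\<^sup>2) = 3 * ln 2 + 2 * ln c"
    using assms(1) ln_realpow[of 2 3] ln_realpow[of c 2] by (simp add: ln_mult)
  then have "ln (1 / c) = (3 * ln 2 - ln (8 * c\<^sup>2)) / 2"
    using assms(1) by (simp add: ln_div)
  moreover have "2 * y \<le> ln (8 * c\<^sup>2)" "ln (8 * c\<^sup>2) \<le> 2 * y + 2 * (y ^ 3 / (1 - y\<^sup>2) / 3)"
    using ln_approx_bounds[OF assms(2), of 1] unfolding assms(3)[symmetric] by (auto simp: eval_nat_numeral)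
  ultimately show "ln (1 / c) \<le> (3 * (69314719 / 10 ^ 8) - 2 * y) / 2"
    and "(3 * (69314718 / 10 ^ 8) - (2 * y + 2 * (y ^ 3 / (1 - y\<^sup>2) / 3))) / 2 \<le> ln (1 / c)"
    using ln_2_bounds by simp_all
qed

text \<open>The decimal value belongs to the series by non-leaf vertices, with radius
  \<open>alphaR 3 ^ 3\<close>; its logarithm is three times that of \<open>alphaR 3\<close>, hence
  the factor 3.\<close>

lemma betaR_3_bounds: "\<bar>3 * betaR 3 - 1.164517\<bar> < 1 / 10 ^ 6"
proof -
  have b: "3 * betaR 3 = 9 / 8 * ln (1 / rad 3)"
    unfolding betaR_3 T3.ln_alphaR by simp
  have "ln (1 / rad 3) \<le> ln (1 / (3551814 / 10 ^ 7))"
    using rad_3_lower T3.rad_pos by (subst ln_le_cancel_iff) (auto simp: field_simps)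
  also have "\<dots> \<le> 1035127 / 10 ^ 6"
    by (rule order_trans[OF ln_inverse_bounds(1)[OF _ _ refl]]) (simp_all add: power_divide)
  finally have 1: "ln (1 / rad 3) \<le> 1035127 / 10 ^ 6" .
  have "10351254 / 10 ^ 7 \<le> ln (1 / (3551818 / 10 ^ 7 :: real))"
    by (rule order_trans[OF _ ln_inverse_bounds(2)[OF _ _ refl]]) (simp_all add: power_divide)
  also have "\<dots> \<le> ln (1 / rad 3)"
    using rad_3_upper T3.rad_pos by (subst ln_le_cancel_iff) (auto simp: field_simps)
  finally have 2: "10351254 / 10 ^ 7 \<le> ln (1 / rad 3)" .
  show ?thesis unfolding b abs_less_iff using 1 2 by simp
qed

section \<open>Negative symbols\<close>

lemma square_le_powr:
  fixes q y :: real
  assumes "1 < q" "0 \<le> y"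
  shows "y\<^sup>2 \<le> 2 / (ln q)\<^sup>2 * q powr y"
proof -
  have l: "0 < ln q" using assms by simp
  have "(y * ln q)\<^sup>2 / 2 \<le> exp (y * ln q)"
    using exp_lower_Taylor_quadratic[of "y * ln q"] assms l by (smt (verit) mult_nonneg_nonneg)
  then show ?thesis using assms l by (simp add: powr_def power_mult_distrib field_simps)
qed

lemma geometric_sum_le:
  fixes q :: real
  assumes "1 < q"
  shows "(\<Sum>i<n. q ^ i) \<le> q ^ n / (q - 1)"
  using assms by (simp add: geometric_sum divide_right_mono)

text \<open>Replacing the factor \<open>i\<^sup>-\<^sup>3\<^sup>/\<^sup>2\<close> by \<open>x\<^sup>-\<^sup>3\<^sup>/\<^sup>2\<close> costs only a geometric factor, which is absorbed by
  the growth rate.\<close>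

lemma shift_powr_le:
  fixes q x i :: real
  assumes "1 < q" "0 \<le> i" "0 < x" "i \<le> x + 1"
  shows "(i + 1) powr (-3/2) \<le> 8 / (ln q)\<^sup>2 * x powr (-3/2) * q powr ((3 + x - i) / 2)"
proof -
  define v where "v = 3 + x - i"
  have v: "2 \<le> v" using assms by (simp add: v_def)
  have "0 \<le> i * (2 + x - i) + 2" if "i \<le> x + 1" 
    using assms that by (intro add_nonneg_nonneg mult_nonneg_nonneg) auto
  then have "x \<le> (i + 1) * v" using assms by (simp add: v_def algebra_simps)
  then have "x powr (3/2) \<le> ((i + 1) * v) powr (3/2)" using assms by (intro powr_mono2) auto
  also have "\<dots> = (i + 1) powr (3/2) * v powr (3/2)" using assms v by (simp add: powr_mult)
  also have "v powr (3/2) \<le> v powr 2" using v by (intro powr_mono) auto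
  also have "v powr 2 = 4 * (v / 2)\<^sup>2" using v by (simp add: power_divide)
  also have "\<dots> \<le> 4 * (2 / (ln q)\<^sup>2 * q powr (v / 2))"
    using v assms by (intro mult_left_mono square_le_powr) auto
  finally have "x powr (3/2) \<le> (i + 1) powr (3/2) * (4 * (2 / (ln q)\<^sup>2 * q powr (v / 2)))"
    by (simp add: mult_left_mono)
  then show ?thesis using assms by (simp add: powr_minus v_def field_simps)
qed

section \<open>Sums of tree numbers and cardinalities of sets of shapes\<close>

context regular_trees begin

definition growth :: real where "growth = 1 / rad N"

lemma growth_gt_1: "1 < growth"
  using rad_pos rad_less_1 by (simp add: growth_def)

lemma tcount_upper:
  obtains C where "0 < C" "\<And>i. real (tcount N i) \<le> C * (real i + 1) powr (-3/2) * growth ^ i"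
proof -
  obtain c C where C: "0 < C" "\<And>n. 1 \<le> n \<Longrightarrow> real (tcount N n) \<le> C * real n powr (-3/2) * (1 / rad N) ^ n"
    using tcount_theta by metis
  let ?C = "max 1 (C * 2 powr (3/2))"
  have "real (tcount N i) \<le> ?C * (real i + 1) powr (-3/2) * growth ^ i" for i
  proof (cases "i = 0")
    case False
    have "real i powr (-3/2) \<le> ((real i + 1) / 2) powr (-3/2)"
      using False by (intro powr_mono2') auto
    also have "\<dots> = 2 powr (3/2) * (real i + 1) powr (-3/2)"
      by (simp add: powr_divide powr_minus field_simps)
    finally have "C * real i powr (-3/2) \<le> C * (2 powr (3/2) * (real i + 1) powr (-3/2))"
      using C by (intro mult_left_mono) auto
    also have "\<dots> \<le> ?C * (real i + 1) powr (-3/2)" unfolding mult.assoc[symmetric] by (intro mult_right_mono) auto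
    finally have "C * real i powr (-3/2) * growth ^ i \<le> ?C * (real i + 1) powr (-3/2) * growth ^ i"
      using growth_gt_1 by (intro mult_right_mono) auto
    then show ?thesis using C(2)[of i] False unfolding growth_def by simp
  qed simp
  then show ?thesis using that[of ?C] by simp
qed

text \<open>The sum is dominated by its top terms. Half of the exponential growth pays for
  exchanging the power of i + 1 for that of x; the rest is a geometric sum with ratio
  \<open>sqrt growth\<close>.\<close>

lemma sum_tcount_upper:
  obtains C where "0 < C" "\<And>x n. 1 \<le> x \<Longrightarrow> real n \<le> x + 2 \<Longrightarrow>
     (\<Sum>i<n. real (tcount N i)) \<le> C * x powr (-3/2) * growth powr x"
proof -
  let ?q = growth
  obtain C where C: "0 < C" "\<And>i. real (tcount N i) \<le> C * (real i + 1) powr (-3/2) * ?q ^ i"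
    using tcount_upper by blast
  have q: "1 < ?q" "1 < sqrt ?q" "0 < ln ?q" using growth_gt_1 by auto
  define L where "L = 8 / (ln ?q)\<^sup>2"
  have L: "0 < L" using q by (simp add: L_def)
  have "(\<Sum>i<n. real (tcount N i)) \<le> (C * L * ?q powr (5/2) / (sqrt ?q - 1)) * x powr (-3/2) * ?q powr x"
    if x: "1 \<le> x" and n: "real n \<le> x + 2" for x n
  proof -
    have "real (tcount N i) \<le> C * L * x powr (-3/2) * ?q powr ((3 + x) / 2) * sqrt ?q ^ i" if "i < n" for i
    proof -
      have i: "real i \<le> x + 1" using that n by linarith
      have "(real i + 1) powr (-3/2) \<le> L * x powr (-3/2) * ?q powr ((3 + x - real i) / 2)"
        unfolding L_def using x i q by (intro shift_powr_le) auto
      then have "C * (real i + 1) powr (-3/2) * ?q ^ i \<le> C * (L * x powr (-3/2) * ?q powr ((3 + x - real i) / 2)) * ?q ^ i"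
        using C q by (intro mult_right_mono mult_left_mono) auto
      also have "?q ^ i = ?q powr real i" using q by (simp add: powr_realpow)
      also have "C * (L * x powr (-3/2) * ?q powr ((3 + x - real i) / 2)) * ?q powr real i
          = C * L * x powr (-3/2) * (?q powr ((3 + x - real i) / 2) * ?q powr real i)" by simp
      also have "?q powr ((3 + x - real i) / 2) * ?q powr real i = ?q powr ((3 + x) / 2) * ?q powr (real i / 2)"
        by (simp add: field_simps flip: powr_add)
      also have "?q powr (real i / 2) = sqrt ?q ^ i"
        using q by (simp add: powr_half_sqrt[symmetric] powr_powr flip: powr_realpow)
      finally show ?thesis using C(2)[of i] q by (simp add: powr_realpow mult.assoc)
    qed
    then have "(\<Sum>i<n. real (tcount N i)) \<le> (\<Sum>i<n. C * L * x powr (-3/2) * ?q powr ((3 + x) / 2) * sqrt ?q ^ i)"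
      by (intro sum_mono) auto
    also have "\<dots> = C * L * x powr (-3/2) * ?q powr ((3 + x) / 2) * (\<Sum>i<n. sqrt ?q ^ i)"
      by (simp add: sum_distrib_left)
    also have "\<dots> \<le> C * L * x powr (-3/2) * ?q powr ((3 + x) / 2) * (?q powr ((x + 2) / 2) / (sqrt ?q - 1))"
    proof (intro mult_left_mono)
      have "sqrt ?q ^ n = ?q powr (real n / 2)"
        using q by (simp add: powr_half_sqrt[symmetric] powr_powr flip: powr_realpow)
      also have "\<dots> \<le> ?q powr ((x + 2) / 2)" using q n by (intro powr_mono) auto
      finally show "(\<Sum>i<n. sqrt ?q ^ i) \<le> ?q powr ((x + 2) / 2) / (sqrt ?q - 1)"
        using geometric_sum_le[OF q(2), of n] q by (smt (verit) divide_right_mono)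
    qed (use C L in auto)
    also have "\<dots> = (C * L / (sqrt ?q - 1)) * x powr (-3/2) * (?q powr ((3 + x) / 2) * ?q powr ((x + 2) / 2))"
      by simp
    also have "?q powr ((3 + x) / 2) * ?q powr ((x + 2) / 2) = ?q powr (5/2) * ?q powr x"
    proof -
      have "(3 + x) / 2 + (x + 2) / 2 = 5 / 2 + x" by (simp add: field_simps)
      then show ?thesis by (simp only: powr_add[symmetric])
    qed
    finally show ?thesis by (simp add: field_simps)
  qed
  then show ?thesis using that[of "C * L * ?q powr (5/2) / (sqrt ?q - 1)"] C L q by simp
qed

text \<open>With the defects the rate per non-leaf vertex is at most growth^(1 + \<theta>/2); over
  (1 - \<theta>) x vertices this gives at most growth^((1 - \<theta>/2) x) up to a constant. The
  remaining factor growth^(-\<theta> x/2) beats every power of x, in particular x^(-3/2).\<close>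

lemma sum_tcount_defect_upper:
  assumes \<theta>: "0 < \<theta>" "\<theta> \<le> 1 / 2"
  obtains C u where "0 < C" "0 < u" "u < 1" "\<And>x n. 1 \<le> x \<Longrightarrow> real n \<le> max 0 ((1 - \<theta>) * x + 2) \<Longrightarrow>
     (\<Sum>i<n. real (tcount N i) * ((1 / u) ^ (2 * B) * vfac d N u ^ (N * i + 1))) \<le> C * x powr (-3/2) * growth powr x"
proof -
  let ?q = growth
  obtain C where C: "0 < C" "\<And>i. real (tcount N i) \<le> C * (real i + 1) powr (-3/2) * ?q ^ i"
    using tcount_upper by blast
  have q: "1 < ?q" "0 < ln ?q" using growth_gt_1 by auto
  have Cq: "real (tcount N i) \<le> C * ?q ^ i" for i
  proof -
    have "(real i + 1) powr (-3/2) \<le> 1" using powr_mono2'[of "-3/2" 1 "real i + 1"] by simp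
    then have "C * (real i + 1) powr (-3/2) * ?q ^ i \<le> C * 1 * ?q ^ i" using C q by (intro mult_right_mono mult_left_mono) auto
    then show ?thesis using C(2)[of i] by simp
  qed
  \<comment> \<open>There are about \<open>N\<close> vertices per non-leaf vertex, so the
    \<open>N\<close>-th power of \<open>vfac\<close> is the rate to be made small by the choice of
    \<open>u\<close>.\<close>
  have "((\<lambda>u. vfac d N u ^ N) \<longlongrightarrow> vfac d N 0 ^ N) (at_right 0)"
    unfolding vfac_def by (intro tendsto_intros) auto
  moreover have "vfac d N 0 ^ N < ?q powr (\<theta> / 2)" using \<theta> q by (simp add: vfac_def)
  ultimately have "\<forall>\<^sub>F u in at_right 0. vfac d N u ^ N < ?q powr (\<theta> / 2)" by (rule order_tendstoD)
  then have ev: "\<forall>\<^sub>F u in at_right 0. vfac d N u ^ N < ?q powr (\<theta> / 2) \<and> 0 < u \<and> u < 1"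
    using eventually_at_right_real[of 0 "1::real"] by (auto elim: eventually_elim2)
  obtain u :: real where u: "vfac d N u ^ N < ?q powr (\<theta> / 2)" "0 < u" "u < 1"
    using eventually_happens'[OF trivial_limit_at_right_real ev] by blast
  let ?c = "vfac d N u"
  have c1: "1 \<le> ?c" using u by (intro vfac_ge_1) auto
  let ?r = "?q powr (1 + \<theta> / 2)"
  have r: "1 < ?r" using q \<theta> by (intro gr_one_powr) auto
  define D where "D = C * ((1 / u) ^ (2 * B) * ?c) / (?r - 1) * ?q powr (2 + \<theta>)"
  define L where "L = 2 / (ln (?q powr (\<theta> / 2)))\<^sup>2"
  have D: "0 < D" unfolding D_def using C u c1 r q by (intro mult_pos_pos divide_pos_pos) auto
  have q\<theta>: "1 < ?q powr (\<theta> / 2)" using q \<theta> by (intro gr_one_powr) auto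
  have L: "0 < L" unfolding L_def by (intro divide_pos_pos zero_less_power ln_gt_zero q\<theta>) simp
  have "(\<Sum>i<n. real (tcount N i) * ((1 / u) ^ (2 * B) * ?c ^ (N * i + 1))) \<le> (D * L) * x powr (-3/2) * ?q powr x"
    if x: "1 \<le> x" and n: "real n \<le> max 0 ((1 - \<theta>) * x + 2)" for x n
  proof -
    have "real (tcount N i) * ((1 / u) ^ (2 * B) * ?c ^ (N * i + 1)) \<le> C * ((1 / u) ^ (2 * B) * ?c) * ?r ^ i" for i
    proof -
      have "real (tcount N i) * ((1 / u) ^ (2 * B) * ?c ^ (N * i + 1)) \<le> (C * ?q ^ i) * ((1 / u) ^ (2 * B) * ?c ^ (N * i + 1))"
        using Cq[of i] u c1 by (intro mult_right_mono) auto
      also have "\<dots> = C * ((1 / u) ^ (2 * B) * ?c) * (?q * ?c ^ N) ^ i"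
        by (simp add: power_mult power_mult_distrib)
      also have "\<dots> \<le> C * ((1 / u) ^ (2 * B) * ?c) * ?r ^ i"
      proof (intro mult_left_mono power_mono)
        show "?q * ?c ^ N \<le> ?r" using u(1) q by (simp add: powr_add)
      qed (use C u c1 q in auto)
      finally show ?thesis .
    qed
    then have "(\<Sum>i<n. real (tcount N i) * ((1 / u) ^ (2 * B) * ?c ^ (N * i + 1)))
        \<le> (\<Sum>i<n. C * ((1 / u) ^ (2 * B) * ?c) * ?r ^ i)"
      by (intro sum_mono) auto
    also have "\<dots> = C * ((1 / u) ^ (2 * B) * ?c) * (\<Sum>i<n. ?r ^ i)" by (simp add: sum_distrib_left)
    also have "\<dots> \<le> C * ((1 / u) ^ (2 * B) * ?c) * (?r ^ n / (?r - 1))"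
      using C u c1 by (intro mult_left_mono geometric_sum_le r) auto
    also have "?r ^ n \<le> ?q powr (2 + \<theta>) * ?q powr ((1 - \<theta> / 2) * x)"
    proof -
      have nx: "real n \<le> (1 - \<theta>) * x + 2" using n x \<theta> by (simp add: max_def split: if_splits)
      have "?r ^ n = ?q powr ((1 + \<theta> / 2) * real n)" using q by (simp add: powr_powr flip: powr_realpow)
      also have "\<dots> \<le> ?q powr ((2 + \<theta>) + (1 - \<theta> / 2) * x)"
      proof (rule powr_mono)
        have "(1 + \<theta> / 2) * real n \<le> (1 + \<theta> / 2) * ((1 - \<theta>) * x + 2)" using nx \<theta> by (intro mult_left_mono) auto
        also have "\<dots> = (2 + \<theta>) + (1 - \<theta> / 2) * x - \<theta>\<^sup>2 / 2 * x" by (simp add: power2_eq_square field_simps)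
        also have "\<dots> \<le> (2 + \<theta>) + (1 - \<theta> / 2) * x" using x by simp
        finally show "(1 + \<theta> / 2) * real n \<le> (2 + \<theta>) + (1 - \<theta> / 2) * x" .
      qed (use q in simp)
      finally show ?thesis by (simp add: powr_add)
    qed
    finally have "(\<Sum>i<n. real (tcount N i) * ((1 / u) ^ (2 * B) * ?c ^ (N * i + 1)))
        \<le> C * ((1 / u) ^ (2 * B) * ?c) * (?q powr (2 + \<theta>) * ?q powr ((1 - \<theta> / 2) * x) / (?r - 1))"
      using C u c1 r by (simp add: mult_left_mono divide_right_mono)
    also have "\<dots> = D * ?q powr ((1 - \<theta> / 2) * x)" by (simp add: D_def)
    also have "\<dots> \<le> D * (L * x powr (-3/2) * ?q powr x)"
    proof (intro mult_left_mono)
      have "x powr (3/2) \<le> x powr 2" using x by (intro powr_mono) auto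
      also have "\<dots> = x\<^sup>2" using x by simp
      also have "\<dots> \<le> L * (?q powr (\<theta> / 2)) powr x"
        unfolding L_def using x q\<theta> by (intro square_le_powr) auto
      finally have "x powr (3/2) * ?q powr ((1 - \<theta> / 2) * x) \<le> L * (?q powr (\<theta> / 2)) powr x * ?q powr ((1 - \<theta> / 2) * x)"
        by (intro mult_right_mono) auto
      also have "\<dots> = L * ?q powr x" by (simp add: powr_powr mult.assoc algebra_simps flip: powr_add)
      finally show "?q powr ((1 - \<theta> / 2) * x) \<le> L * x powr (-3/2) * ?q powr x"
        using x by (simp add: powr_minus field_simps)
    qed (use D in simp)
    finally show ?thesis by (simp add: mult.assoc)
  qed
  then show ?thesis using that[of "D * L" u] D L u by simp
qed

text \<open>Symbols without defects number at most one per tree, up to x + 1 vertices; all others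
  live on trees smaller by \<theta> x, which outweighs their multiplicity.\<close>

lemma card_shapes_upper:
  assumes \<theta>: "0 < \<theta>" "\<theta> \<le> 1 / 2"
  obtains C where "0 < C" "\<And>x S. 1 \<le> x \<Longrightarrow>
     (\<And>\<tau>. \<tau> \<in> S \<Longrightarrow> \<exists>t D K. shape d N \<tau> t D K \<and> D \<le> B \<and> K \<le> B \<and>
        real (inodes t) < x + 1 - (if D + K = 0 then 0 else \<theta> * x)) \<Longrightarrow>
     finite S \<and> real (card S) \<le> C * x powr (-3/2) * growth powr x"
proof -
  obtain C1 where C1: "0 < C1" "\<And>x n. 1 \<le> x \<Longrightarrow> real n \<le> x + 2 \<Longrightarrow>
     (\<Sum>i<n. real (tcount N i)) \<le> C1 * x powr (-3/2) * growth powr x"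
    using sum_tcount_upper by blast
  obtain C2 u where C2: "0 < C2" "0 < u" "u < 1" "\<And>x n. 1 \<le> x \<Longrightarrow> real n \<le> max 0 ((1 - \<theta>) * x + 2) \<Longrightarrow>
     (\<Sum>i<n. real (tcount N i) * ((1 / u) ^ (2 * B) * vfac d N u ^ (N * i + 1))) \<le> C2 * x powr (-3/2) * growth powr x"
    using sum_tcount_defect_upper[OF \<theta>, of B d] by blast
  have "finite S \<and> real (card S) \<le> (C1 + C2) * x powr (-3/2) * growth powr x"
    if x: "1 \<le> x" and S: "\<And>\<tau>. \<tau> \<in> S \<Longrightarrow> \<exists>t D K. shape d N \<tau> t D K \<and> D \<le> B \<and> K \<le> B \<and>
        real (inodes t) < x + 1 - (if D + K = 0 then 0 else \<theta> * x)" for x S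
  proof -
    define n m where "n = nat \<lceil>x + 1\<rceil>" and "m = nat \<lceil>(1 - \<theta>) * x + 1\<rceil>"
    define S0 where "S0 = {\<tau> \<in> S. \<exists>t. shape d N \<tau> t 0 0 \<and> inodes t < n}"
    define S1 where "S1 = {\<tau> \<in> S. \<exists>t D K. shape d N \<tau> t D K \<and> D \<le> B \<and> K \<le> B \<and> inodes t < m}"
    have "S \<subseteq> S0 \<union> S1"
    proof
      fix \<tau> assume "\<tau> \<in> S"
      with S[OF this] obtain t D K where t: "shape d N \<tau> t D K" "D \<le> B" "K \<le> B"
        "real (inodes t) < x + 1 - (if D + K = 0 then 0 else \<theta> * x)" by blast
      show "\<tau> \<in> S0 \<union> S1"
      proof (cases "D + K = 0")
        case True
        then have "inodes t < n" using t(4) unfolding n_def by (simp, linarith)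
        then show ?thesis using t True \<open>\<tau> \<in> S\<close> by (auto simp: S0_def)
      next
        case False
        then have "real (inodes t) < (1 - \<theta>) * x + 1" using t(4) by (auto simp: algebra_simps)
        then have "inodes t < m" unfolding m_def by linarith
        then show ?thesis using t \<open>\<tau> \<in> S\<close> by (auto simp: S1_def)
      qed
    qed
    then have eq: "S = S0 \<union> S1" by (auto simp: S0_def S1_def)
    have N1: "1 \<le> N" using N2 by simp
    have S0: "finite S0 \<and> real (card S0) \<le> (\<Sum>i<n. real (tcount N i))"
      by (rule card_perfect_shapes_le[OF N1]) (auto simp: S0_def)
    have S1: "finite S1 \<and> real (card S1) \<le> (\<Sum>i<m. real (tcount N i) * ((1 / u) ^ (2 * B) * vfac d N u ^ (N * i + 1)))"
      by (rule card_shapes_le[OF N1 C2(2,3)]) (auto simp: S1_def)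
    have "real n \<le> x + 2" unfolding n_def using x by linarith
    moreover have "0 \<le> (1 - \<theta>) * x" using x \<theta> by simp
    then have "real m \<le> max 0 ((1 - \<theta>) * x + 2)" unfolding m_def by linarith
    ultimately have "real (card S0) \<le> C1 * x powr (-3/2) * growth powr x" "real (card S1) \<le> C2 * x powr (-3/2) * growth powr x"
      using C1(2)[OF x] C2(4)[OF x] S0 S1 order_trans by blast+
    moreover have "real (card S) \<le> real (card S0) + real (card S1)"
      unfolding eq using card_Un_le[of S0 S1] by linarith
    ultimately show ?thesis using S0 S1 eq by (auto simp: distrib_right)
  qed
  then show ?thesis using that[of "C1 + C2"] C1 C2 by simp
qed

lemma card_shapes_bounded:
  obtains C where "0 < C" "\<And>S. (\<And>\<tau>. \<tau> \<in> S \<Longrightarrow> \<exists>t D K. shape d N \<tau> t D K \<and> D \<le> B \<and> K \<le> B \<and> inodes t < n) \<Longrightarrow>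
     finite S \<and> real (card S) \<le> C"
proof -
  let ?C = "(\<Sum>i<n. real (tcount N i) * ((1 / (1/2)) ^ (2 * B) * vfac d N (1/2) ^ (N * i + 1)))"
  have "finite S \<and> real (card S) \<le> max 1 ?C"
    if "\<And>\<tau>. \<tau> \<in> S \<Longrightarrow> \<exists>t D K. shape d N \<tau> t D K \<and> D \<le> B \<and> K \<le> B \<and> inodes t < n" for S
    using card_shapes_le[of N "1/2" S d B n] that N2 by fastforce
  then show ?thesis using that[of "max 1 ?C"] by simp
qed

end

section \<open>Negative symbols near and away from criticality\<close>

lemma neg_symbols_shape:
  assumes "N \<ge> 1" "\<rho> > 0" "\<tau> \<in> neg_symbols N d \<rho> \<kappa>"
  obtains t D K where "shape d N \<tau> t D K"
    "real (inodes t) * (((real N + 1) * \<rho> - (real N - 1) * real d) / 2 - (real N - 1) * \<kappa>)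
      + (- (\<rho> + real d) / 2 - \<kappa>) + real D * ((real d - \<rho>) / 2 + \<kappa>) + min \<rho> 1 * real K < 0"
    "real D \<le> (real N - 1) * real (inodes t) + 1"
proof -
  have neg: "\<tau> \<in> FF d N" "homog d \<rho> \<kappa> \<tau> < 0" using assms(3) by (auto simp: neg_symbols_def)
  have "\<tau> \<notin> range (Xpow d)"
  proof
    assume "\<tau> \<in> range (Xpow d)"
    then obtain k where "\<tau> = Xpow d k" by auto
    then have "min \<rho> 1 * real (\<Sum>i\<le>d. k i) < 0" using homog_Xpow[OF assms(2), where d=d and k=k and \<kappa>=\<kappa>] neg(2) by simp
    moreover have "0 \<le> min \<rho> 1 * real (\<Sum>i\<le>d. k i)"
      using assms(2) by (intro mult_nonneg_nonneg of_nat_0_le_iff) simp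
    ultimately show False by linarith
  qed
  then obtain t D K where t: "shape d N \<tau> t D K" using FF_shape[OF neg(1) assms(1)] by blast
  from shape_homog(1)[OF assms(2,1) this, of \<kappa>] neg(2) that[OF t] show ?thesis by linarith
qed

text \<open>Keeps \<open>min \<rho> 1\<close>, the cost of a polynomial factor, away from 0.\<close>

lemma rho_c_ge_half:
  assumes "N > 2" "d \<ge> 1"
  shows "1 / 2 \<le> rho_c N d"
proof -
  have "1 / 2 \<le> (real N - 1) / (real N + 1)" using assms by (simp add: field_simps)
  also have "\<dots> \<le> real d * ((real N - 1) / (real N + 1))"
    using assms mult_right_mono[of 1 "real d" "(real N - 1) / (real N + 1)"] by simp
  finally show ?thesis by (simp add: rho_c_def)
qed

lemma alpha_eq: "(real N + 1) * \<rho> - (real N - 1) * real d = (real N + 1) * (\<rho> - rho_c N d)"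
proof -
  have "(real N + 1) * rho_c N d = real d * (real N - 1)" by (simp add: rho_c_def add_pos_pos)
  then show ?thesis by (simp add: algebra_simps)
qed

text \<open>\<open>c0\<close> is a lower bound for the cost of one defect: at least d / (2 (N + 1))
  for a missing child, since \<rho> stays in the lower half of the interval from rho_c to d, and at
  least 1/2 for a polynomial factor. One defect thus consumes a fraction \<theta> of the budget A x
  = d N / (N + 1), and at most d / c0 defects fit.\<close>

lemma neg_shape_near_critical:
  fixes d N :: nat and \<rho> :: real
  assumes N: "N > 2" and d: "d \<ge> 1" and \<rho>: "rho_c N d < \<rho>" "\<rho> < rho_c N d + real d / (real N + 1)"
  defines "\<epsilon> \<equiv> \<rho> - rho_c N d" and "c0 \<equiv> min (real d / (2 * (real N + 1))) (1 / 2)"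
  defines "x \<equiv> 2 * real d * real N / ((real N + 1)\<^sup>2 * \<epsilon>)"
    and "\<theta> \<equiv> min (1 / 2) (c0 * (real N + 1) / (real d * real N))"
    and "B \<equiv> nat \<lceil>real d / c0\<rceil>"
  shows "1 \<le> x" and "\<forall>\<^sub>F \<kappa> in at_right 0. \<forall>\<tau>\<in>neg_symbols N d \<rho> \<kappa>. \<exists>t D K. shape d N \<tau> t D K \<and> D \<le> B \<and> K \<le> B \<and>
        real (inodes t) < x + 1 - (if D + K = 0 then 0 else \<theta> * x)"
proof -
  have eps: "0 < \<epsilon>" "\<epsilon> < real d / (real N + 1)" using \<rho> by (auto simp: \<epsilon>_def)
  have dN: "0 < real d" "2 < real N" using N d by auto
  have \<rho>h: "1 / 2 < \<rho>" using rho_c_ge_half[OF N d] \<rho> by linarith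
  define A where "A = (real N + 1) * \<epsilon> / 2"
  define m where "m = (\<rho> + real d) / 2"
  have A: "0 < A" using eps dN by (simp add: A_def)
  have Ax: "A * x = real d * real N / (real N + 1)"
  proof -
    have "((N1 * \<epsilon>) / 2) * (2 * real d * real N / (N1\<^sup>2 * \<epsilon>)) = real d * real N / N1" if "0 < N1" for N1 :: real
      using that eps by (simp add: field_simps power2_eq_square)
    from this[of "real N + 1"] show ?thesis using dN by (simp add: A_def x_def)
  qed
  have rc: "rho_c N d = real d - 2 * real d / (real N + 1)"
    by (simp add: rho_c_def field_simps)
  have m: "m = real d * real N / (real N + 1) + \<epsilon> / 2"
  proof -
    have "\<rho> = \<epsilon> + (real d - 2 * real d / (real N + 1))" using rc by (simp add: \<epsilon>_def)
    moreover have "(real d - 2 * real d / (real N + 1) + real d) / 2 = real d * real N / (real N + 1)"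
      using dN by (simp add: field_simps)
    ultimately show ?thesis unfolding m_def by (simp add: add_divide_distrib diff_divide_distrib)
  qed
  show x1: "1 \<le> x"
  proof -
    have "A * 1 \<le> real d / 2" using eps dN by (simp add: A_def field_simps)
    also have "\<dots> \<le> real d * real N / (real N + 1)" using dN by (simp add: field_simps)
    finally show ?thesis unfolding Ax[symmetric] using A by (simp only: mult_le_cancel_left_pos)
  qed
  have c0: "0 < c0" using dN by (simp add: c0_def)
  have c0': "c0 \<le> 1 / 2" "c0 \<le> real d / (2 * (real N + 1))"
    unfolding c0_def by (rule min.cobounded2, rule min.cobounded1)
  \<comment> \<open>The last two entries keep the gain per vertex above A / 2 and the total
    contribution of \<kappa> below \<epsilon> / 2; up to 2 (m + 1) / A vertices occur, so the bound
    depends on \<rho>.\<close>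
  define \<kappa>0 where "\<kappa>0 = min 1 (min (A / (2 * (real N - 1))) ((\<epsilon> / 2) / (1 + 2 * (real N - 1) * (m + 1) / A)))"
  have m0: "0 < m" using \<rho>h dN by (simp add: m_def)
  have \<kappa>0: "0 < \<kappa>0" using A eps dN m0 by (auto simp: \<kappa>0_def intro!: divide_pos_pos add_pos_pos mult_pos_pos)
  have main: "\<exists>t D K. shape d N \<tau> t D K \<and> D \<le> B \<and> K \<le> B \<and>
        real (inodes t) < x + 1 - (if D + K = 0 then 0 else \<theta> * x)"
    if \<kappa>: "0 < \<kappa>" "\<kappa> < \<kappa>0" and \<tau>: "\<tau> \<in> neg_symbols N d \<rho> \<kappa>" for \<kappa> \<tau>
  proof -
    obtain t D K where t: "shape d N \<tau> t D K"
      "real (inodes t) * (((real N + 1) * \<rho> - (real N - 1) * real d) / 2 - (real N - 1) * \<kappa>)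
        + (- (\<rho> + real d) / 2 - \<kappa>) + real D * ((real d - \<rho>) / 2 + \<kappa>) + min \<rho> 1 * real K < 0"
      by (rule neg_symbols_shape[OF _ _ \<tau>]) (use N \<rho>h in auto)
    let ?i = "real (inodes t)" and ?e = "real (D + K)"
    define al where "al = A - (real N - 1) * \<kappa>"
    have \<kappa>': "\<kappa> \<le> 1" "\<kappa> \<le> A / (2 * (real N - 1))" "\<kappa> \<le> (\<epsilon> / 2) / (1 + 2 * (real N - 1) * (m + 1) / A)"
      using \<kappa> by (auto simp: \<kappa>0_def)
    have al: "A / 2 \<le> al" using \<kappa>'(2) dN by (simp add: al_def field_simps)
    have lin: "?i * al + real D * ((real d - \<rho>) / 2 + \<kappa>) + min \<rho> 1 * real K < m + \<kappa>"
      using t(2) unfolding alpha_eq al_def A_def m_def \<epsilon>_def by linarith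
    have "real d / (real N + 1) \<le> real d - \<rho>" 
    proof -
      have "2 * real d / (real N + 1) = 2 * (real d / (real N + 1))" by simp
      then show ?thesis using eps(2) rc unfolding \<epsilon>_def by linarith
    qed
    then have "c0 \<le> (real d - \<rho>) / 2 + \<kappa>" 
    proof -
      have "real d / (2 * (real N + 1)) = real d / (real N + 1) / 2" by simp
      also have "\<dots> \<le> (real d - \<rho>) / 2"
        using \<open>real d / (real N + 1) \<le> real d - \<rho>\<close> by (rule divide_right_mono) simp
      finally show ?thesis using c0'(2) \<kappa>(1) by linarith
    qed
    then have "real D * c0 \<le> real D * ((real d - \<rho>) / 2 + \<kappa>)" by (intro mult_left_mono) auto
    moreover have "c0 * real K \<le> min \<rho> 1 * real K" using c0'(1) \<rho>h by (intro mult_right_mono) auto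
    ultimately have l1: "?i * al + c0 * ?e < m + \<kappa>" using lin by (simp add: algebra_simps)
    have "?i * (A / 2) \<le> ?i * al" using al by (intro mult_left_mono) auto
    moreover have "0 \<le> c0 * ?e" using c0 by simp
    ultimately have "?i * (A / 2) \<le> m + 1" using l1 \<kappa>' by linarith
    then have iA: "?i \<le> 2 * (m + 1) / A" using A by (simp add: field_simps)
    have "\<kappa> + ?i * ((real N - 1) * \<kappa>) \<le> \<epsilon> / 2"
    proof -
      have "?i * ((real N - 1) * \<kappa>) \<le> (2 * (m + 1) / A) * ((real N - 1) * \<kappa>)"
        using iA dN \<kappa> by (intro mult_right_mono) auto
      moreover have "\<kappa> + (2 * M / A) * (r * \<kappa>) = \<kappa> * (1 + 2 * r * M / A)" for M r
        by (simp add: algebra_simps)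
      ultimately have "\<kappa> + ?i * ((real N - 1) * \<kappa>) \<le> \<kappa> * (1 + 2 * (real N - 1) * (m + 1) / A)"
        by (metis add_left_mono)
      also have "\<dots> \<le> (\<epsilon> / 2) / (1 + 2 * (real N - 1) * (m + 1) / A) * (1 + 2 * (real N - 1) * (m + 1) / A)"
        using \<kappa>'(3) A m0 dN by (intro mult_right_mono add_nonneg_nonneg divide_nonneg_nonneg mult_nonneg_nonneg) auto
      also have "\<dots> = \<epsilon> / 2"
      proof -
        have "0 < 1 + 2 * (real N - 1) * (m + 1) / A" using A m0 dN by (intro add_pos_pos divide_pos_pos mult_pos_pos) auto
        moreover have "r / y * y = r" if "0 < y" for r y :: real using that by simp
        ultimately show ?thesis by blast
      qed
      finally show ?thesis .
    qed
    then have l2: "?i * A + c0 * ?e < A * x + \<epsilon>"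
      using l1 unfolding al_def m Ax by (simp add: algebra_simps)
    \<comment> \<open>The excess \<epsilon> is worth at most one vertex, which explains the
      threshold \<open>x + 1\<close>.\<close>
    have ep: "\<epsilon> \<le> A * 1" using eps dN by (simp add: A_def)
    have iA0: "0 \<le> ?i * A" using A by simp
    have "A * x + \<epsilon> \<le> real d"
    proof -
      have "real d * real N / (real N + 1) + real d / (real N + 1) = real d * (real N + 1) / (real N + 1)"
        by (simp only: distrib_left add_divide_distrib mult_1_right)
      also have "\<dots> = real d" by simp
      finally have "real d * real N / (real N + 1) + real d / (real N + 1) = real d" .
      then show ?thesis unfolding Ax using eps(2) by linarith
    qed
    then have "c0 * ?e \<le> real d" using l2 iA0 by linarith
    then have "?e \<le> real d / c0" using c0 by (simp add: field_simps)
    then have "D + K \<le> B" unfolding B_def by linarith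
    moreover have "?i < x + 1 - (if D + K = 0 then 0 else \<theta> * x)"
    proof (cases "D + K = 0")
      case True
      have "A * ?i < A * (x + 1)" using l2 ep True by (simp add: algebra_simps)
      then show ?thesis using A True by simp
    next
      case False
      then have "c0 * 1 \<le> c0 * ?e" using c0 by (intro mult_left_mono) auto
      moreover have "A * (\<theta> * x) \<le> c0"
      proof -
        have "A * (\<theta> * x) = \<theta> * (A * x)" by simp
        also have "\<dots> \<le> (c0 * (real N + 1) / (real d * real N)) * (A * x)"
          using A x1 by (intro mult_right_mono) (auto simp: \<theta>_def)
        also have "\<dots> = c0"
        proof -
          have "c0 * b / a * (a / b) = c0" if "0 < a" "0 < b" for a b :: real using that by simp
          from this[of "real d * real N" "real N + 1"] show ?thesis unfolding Ax using dN by simp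
        qed
        finally show ?thesis .
      qed
      ultimately have "A * ?i < A * (x + 1 - \<theta> * x)" using l2 ep by (simp add: algebra_simps)
      then have "?i < x + 1 - \<theta> * x" using A by (simp only: mult_less_cancel_left_pos)
      then show ?thesis unfolding if_not_P[OF False] .
    qed
    ultimately show ?thesis using t(1) by (intro exI[of _ t] exI[of _ D] exI[of _ K]) auto
  qed
  show "\<forall>\<^sub>F \<kappa> in at_right 0. \<forall>\<tau>\<in>neg_symbols N d \<rho> \<kappa>. \<exists>t D K. shape d N \<tau> t D K \<and> D \<le> B \<and> K \<le> B \<and>
        real (inodes t) < x + 1 - (if D + K = 0 then 0 else \<theta> * x)"
    using eventually_at_right_real[OF \<kappa>0]
  proof eventually_elim
    case (elim \<kappa>)
    then have "0 < \<kappa>" "\<kappa> < \<kappa>0" by auto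
    then show ?case using main by blast
  qed
qed

text \<open>At this distance from rho_c each non-leaf vertex gains at least d / 4, so only bounded
  trees occur. This breaks down when \<rho> > d makes an empty slot lower the homogeneity; then the
  number of slots is controlled by the number of leaves.\<close>

lemma neg_shape_away_from_critical:
  fixes d N :: nat and \<rho> :: real
  assumes N: "N > 2" and d: "d \<ge> 1" and \<rho>: "rho_c N d + real d / (real N + 1) \<le> \<rho>" "\<rho> \<le> 2"
  defines "n \<equiv> nat \<lceil>2 * (real d + 4) / real d\<rceil> + 1"
  defines "B \<equiv> N * n + 1 + nat \<lceil>real d + 4\<rceil>"
  shows "\<forall>\<^sub>F \<kappa> in at_right 0. \<forall>\<tau>\<in>neg_symbols N d \<rho> \<kappa>. \<exists>t D K. shape d N \<tau> t D K \<and> D \<le> B \<and> K \<le> B \<and> inodes t < n"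
proof -
  define A where "A = (real N + 1) * (\<rho> - rho_c N d) / 2"
  have dN: "1 \<le> real d" "2 < real N" using N d by auto
  have \<rho>h: "1 / 2 < \<rho>"
    using rho_c_ge_half[OF N d] \<rho> dN divide_pos_pos[of "real d" "real N + 1"] by linarith
  have A: "real d / 2 \<le> A"
  proof -
    have "(real N + 1) * (real d / (real N + 1)) \<le> (real N + 1) * (\<rho> - rho_c N d)"
      using \<rho> by (intro mult_left_mono) auto
    then show ?thesis using dN by (simp add: A_def)
  qed
  define \<kappa>0 where "\<kappa>0 = min 1 (real d / (4 * (real N - 1)))"
  have \<kappa>0: "0 < \<kappa>0" using dN by (auto simp: \<kappa>0_def)
  have main: "\<exists>t D K. shape d N \<tau> t D K \<and> D \<le> B \<and> K \<le> B \<and> inodes t < n"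
    if \<kappa>: "0 < \<kappa>" "\<kappa> < \<kappa>0" and \<tau>: "\<tau> \<in> neg_symbols N d \<rho> \<kappa>" for \<kappa> \<tau>
  proof -
    obtain t D K where t: "shape d N \<tau> t D K"
      "real (inodes t) * (((real N + 1) * \<rho> - (real N - 1) * real d) / 2 - (real N - 1) * \<kappa>)
        + (- (\<rho> + real d) / 2 - \<kappa>) + real D * ((real d - \<rho>) / 2 + \<kappa>) + min \<rho> 1 * real K < 0"
      "real D \<le> (real N - 1) * real (inodes t) + 1"
      by (rule neg_symbols_shape[OF _ _ \<tau>]) (use N \<rho>h in auto)
    let ?i = "real (inodes t)"
    define al \<delta> where "al = A - (real N - 1) * \<kappa>" and "\<delta> = (real d - \<rho>) / 2 + \<kappa>"
    have lin: "?i * al + real D * \<delta> + min \<rho> 1 * real K < (\<rho> + real d) / 2 + \<kappa>"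
      using t(2) unfolding alpha_eq al_def A_def \<delta>_def by linarith
    have \<kappa>': "\<kappa> \<le> 1" "\<kappa> \<le> real d / (4 * (real N - 1))" using \<kappa> by (auto simp: \<kappa>0_def)
    have "(real N - 1) * \<kappa> \<le> real d / 4" using \<kappa>'(2) dN by (simp add: field_simps)
    then have al: "real d / 4 \<le> al" using A unfolding al_def by linarith
    have K2: "real K / 2 \<le> min \<rho> 1 * real K"
      using mult_right_mono[of "1/2" "min \<rho> 1" "real K"] \<rho>h by auto
    have "?i * (real d / 4) \<le> (real d + 4) / 2 \<and> real K / 2 \<le> (real d + 4) / 2"
    proof (cases "0 \<le> \<delta>")
      case True
      have "?i * (real d / 4) \<le> ?i * al" using al by (intro mult_left_mono) auto
      moreover have "0 \<le> ?i * (real d / 4)" "0 \<le> real D * \<delta>" "0 \<le> real K / 2" using True by auto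
      moreover have "(\<rho> + real d) / 2 + \<kappa> \<le> (real d + 4) / 2" using \<kappa>'(1) \<rho>(2) by argo
      moreover have "a + e \<le> r" if "a \<le> b" "0 \<le> c" "b + c + g < v" "e \<le> g" "v \<le> r" for a b c e g v r :: real
        using that by linarith
      ultimately have "?i * (real d / 4) + real K / 2 \<le> (real d + 4) / 2"
        using lin K2 by blast
      then show ?thesis using \<open>0 \<le> ?i * (real d / 4)\<close> \<open>0 \<le> real K / 2\<close> by (intro conjI) linarith+
    next
      case False
      \<comment> \<open>The worst case has all leaves erased. The terms in d and \<kappa> then
        cancel and (i - 1) \<rho> plus the polynomial cost remains, which is negative only for i =
        0.\<close>
      have "((real N - 1) * ?i + 1) * \<delta> \<le> real D * \<delta>"
        using t(3) False by (intro mult_right_mono_neg) auto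
      then have "?i * al + ((real N - 1) * ?i + 1) * \<delta> + min \<rho> 1 * real K < (\<rho> + real d) / 2 + \<kappa>"
        using lin by linarith
      moreover have "?i * al + ((real N - 1) * ?i + 1) * \<delta> - ((\<rho> + real d) / 2 + \<kappa>) = ?i * \<rho> - \<rho>"
      proof -
        have al': "al = ((real N + 1) * \<rho> - (real N - 1) * real d) / 2 - (real N - 1) * \<kappa>"
          unfolding alpha_eq al_def A_def by simp
        show ?thesis unfolding al' \<delta>_def by (simp add: field_simps)
      qed
      ultimately have neg: "?i * \<rho> - \<rho> + min \<rho> 1 * real K < 0" by linarith
      have "inodes t = 0"
      proof (rule ccontr)
        assume "inodes t \<noteq> 0"
        then have "1 * \<rho> \<le> ?i * \<rho>" using \<rho>h by (intro mult_right_mono) auto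
        then show False using neg K2 by linarith
      qed
      then show ?thesis using neg K2 \<rho>(2) dN by simp
    qed
    then have 1: "?i * (real d / 4) \<le> (real d + 4) / 2" and 2: "real K / 2 \<le> (real d + 4) / 2" by auto
    have "?i \<le> 2 * (real d + 4) / real d" using 1 dN by (simp add: field_simps)
    then have i: "inodes t < n" unfolding n_def by linarith
    have "real D \<le> real N * ?i + 1" using t(3) by (simp add: algebra_simps)
    also have "\<dots> \<le> real N * real n + 1" using i by (intro add_right_mono mult_left_mono) auto
    finally have "real D \<le> real (N * n + 1)" by simp
    then have "D \<le> B" unfolding B_def by linarith
    moreover have "real K \<le> real d + 4" using 2 by simp
    then have "K \<le> B" unfolding B_def by linarith
    ultimately show ?thesis using t(1) i by blast
  qed
  show ?thesis
    using eventually_at_right_real[OF \<kappa>0]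
  proof eventually_elim
    case (elim \<kappa>)
    then have "0 < \<kappa>" "\<kappa> < \<kappa>0" by auto
    then show ?case using main by blast
  qed
qed

text \<open>The constants may not depend on \<rho>, so its range is cut at a fixed distance from
  rho_c. Below the cut the tree asymptotics apply at the threshold x = k / \<epsilon>; above it the
  count and the claimed expression both stay between positive constants.\<close>

theorem theorem4p20:
  fixes d N :: nat
  assumes "d \<ge> 1" and "N > 2"
  shows "(\<exists>Cm Cp :: real. 0 < Cm \<and> 0 < Cp \<and>
           (\<forall>\<rho>::real. rho_c N d < \<rho> \<and> \<rho> \<le> 2 \<longrightarrow>
             (\<forall>\<^sub>F \<kappa> in at_right 0.
                finite (neg_symbols N d \<rho> \<kappa>) \<and>
                Cm * (\<rho> - rho_c N d) powr (3/2) * exp (betaR N * real d / (\<rho> - rho_c N d))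
                  \<le> real (c_F N d \<rho> \<kappa>) \<and>
                real (c_F N d \<rho> \<kappa>)
                  \<le> Cp * (\<rho> - rho_c N d) powr (3/2) * exp (betaR N * real d / (\<rho> - rho_c N d)))))
         \<and> betaR 3 = 9 / 8 * ln (1 / alphaR 3)
         \<and> \<bar>3 * betaR 3 - 1.164517\<bar> < 1 / 10 ^ 6"
proof (intro conjI)
  interpret regular_trees N using assms by unfold_locales simp
  have dN: "1 \<le> real d" "2 < real N" "1 \<le> N" using assms by auto
  have pos\<kappa>: "\<forall>\<^sub>F \<kappa>::real in at_right 0. 0 < \<kappa>" by (simp add: eventually_at_right_less)
  define \<epsilon>0 where "\<epsilon>0 = real d / (real N + 1)"
  define k where "k = 2 * real d * real N / (real N + 1)\<^sup>2"
  define f where "f = (\<lambda>\<epsilon>::real. \<epsilon> powr (3/2) * exp (betaR N * real d / \<epsilon>))"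
  have \<epsilon>0: "0 < \<epsilon>0" and k: "0 < k" using dN by (auto simp: \<epsilon>0_def k_def)
  have lng: "0 < ln growth" using growth_gt_1 by simp
  \<comment> \<open>The factor 1 / N in \<open>ln_alphaR\<close> turns the N^2 of
    \<open>betaR\<close> into the N of \<open>k\<close>, so that growth^x is exactly the exponential
    of the statement.\<close>
  have \<beta>: "betaR N * real d = k * ln growth"
  proof -
    have "betaR N = 2 * real N ^ 2 / (real N + 1) ^ 2 * (ln growth / real N)"
      unfolding betaR_def ln_alphaR growth_def ..
    then show ?thesis using dN by (simp add: k_def power2_eq_square field_simps)
  qed
  have x_f: "(k / \<epsilon>) powr (-3/2) * growth powr (k / \<epsilon>) = k powr (-3/2) * f \<epsilon>" if "0 < \<epsilon>" for \<epsilon>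
  proof -
    have "growth powr (k / \<epsilon>) = exp (betaR N * real d / \<epsilon>)"
      unfolding \<beta> using growth_gt_1 by (simp add: powr_def)
    moreover have "(k / \<epsilon>) powr (-3/2) = k powr (-3/2) * \<epsilon> powr (3/2)"
      using that k by (simp add: powr_divide powr_minus field_simps)
    ultimately show ?thesis by (simp add: f_def)
  qed
  define c0 where "c0 = min (real d / (2 * (real N + 1))) (1 / 2)"
  define \<theta> where "\<theta> = min (1 / 2) (c0 * (real N + 1) / (real d * real N))"
  define B where "B = nat \<lceil>real d / c0\<rceil>"
  have "0 < c0" using dN by (simp add: c0_def)
  then have "0 < \<theta>" using dN by (simp add: \<theta>_def)
  moreover have "\<theta> \<le> 1 / 2" unfolding \<theta>_def by (rule min.cobounded1)
  ultimately have \<theta>: "0 < \<theta>" "\<theta> \<le> 1 / 2" by auto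
  obtain C1 where C1: "0 < C1" "\<And>x S. 1 \<le> x \<Longrightarrow>
     (\<And>\<tau>. \<tau> \<in> S \<Longrightarrow> \<exists>t D K. shape d N \<tau> t D K \<and> D \<le> B \<and> K \<le> B \<and>
        real (inodes t) < x + 1 - (if D + K = 0 then 0 else \<theta> * x)) \<Longrightarrow>
     finite S \<and> real (card S) \<le> C1 * x powr (-3/2) * growth powr x"
    using card_shapes_upper[OF \<theta>, of d B] by blast
  define n where "n = nat \<lceil>2 * (real d + 4) / real d\<rceil> + 1"
  define B' where "B' = N * n + 1 + nat \<lceil>real d + 4\<rceil>"
  obtain C2 where C2: "0 < C2" "\<And>S. (\<And>\<tau>. \<tau> \<in> S \<Longrightarrow> \<exists>t D K. shape d N \<tau> t D K \<and> D \<le> B' \<and> K \<le> B' \<and> inodes t < n) \<Longrightarrow>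
     finite S \<and> real (card S) \<le> C2"
    using card_shapes_bounded[of d B' n] by blast
  obtain c3 where c3: "0 < c3" "\<And>n. 1 \<le> n \<Longrightarrow> c3 * real n powr (-3/2) * growth ^ n \<le> real (tcount N n)"
    using tcount_theta unfolding growth_def by metis
  define m0 M0 where "m0 = \<epsilon>0 powr (3/2)" and "M0 = 2 powr (3/2) * exp (betaR N * real d / \<epsilon>0)"
  have mM: "0 < m0" "0 < M0" using \<epsilon>0 by (auto simp: m0_def M0_def)
  have f_bounds: "m0 \<le> f \<epsilon>" "f \<epsilon> \<le> M0" if "\<epsilon>0 \<le> \<epsilon>" "\<epsilon> \<le> 2" for \<epsilon>
  proof -
    have b0: "0 \<le> betaR N * real d" unfolding \<beta> using k lng by simp
    have e: "0 < \<epsilon>" using \<epsilon>0 that by simp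
    have "\<epsilon>0 powr (3/2) * 1 \<le> \<epsilon> powr (3/2) * exp (betaR N * real d / \<epsilon>)"
      using that \<epsilon>0 b0 e by (intro mult_mono powr_mono2) auto
    then show "m0 \<le> f \<epsilon>" by (simp add: m0_def f_def)
    show "f \<epsilon> \<le> M0" unfolding f_def M0_def
      using that \<epsilon>0 b0 e by (intro mult_mono powr_mono2) (auto intro: divide_left_mono)
  qed
  define Cp where "Cp = max (C1 * k powr (-3/2)) (C2 / m0)"
  define Cm where "Cm = min (c3 / growth * k powr (-3/2)) (1 / M0)"
  have Cp: "0 < Cp" using C2 mM by (simp add: Cp_def less_max_iff_disj)
  have Cm: "0 < Cm" using c3 k mM growth_gt_1 by (simp add: Cm_def)
  have f_nonneg: "0 \<le> f \<epsilon>" for \<epsilon> by (simp add: f_def)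
  have main: "\<forall>\<^sub>F \<kappa> in at_right 0. finite (neg_symbols N d \<rho> \<kappa>) \<and>
      Cm * f (\<rho> - rho_c N d) \<le> real (c_F N d \<rho> \<kappa>) \<and> real (c_F N d \<rho> \<kappa>) \<le> Cp * f (\<rho> - rho_c N d)"
    if \<rho>: "rho_c N d < \<rho>" "\<rho> \<le> 2" for \<rho>
  proof (cases "\<rho> < rho_c N d + \<epsilon>0")
    case True
    let ?\<epsilon> = "\<rho> - rho_c N d"
    let ?x = "k / ?\<epsilon>"
    have eps: "0 < ?\<epsilon>" using \<rho> by simp
    have x_eq: "2 * real d * real N / ((real N + 1)\<^sup>2 * ?\<epsilon>) = ?x" by (simp add: k_def)
    note near = neg_shape_near_critical[OF assms(2,1) \<rho>(1) True[unfolded \<epsilon>0_def],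
        folded c0_def, folded \<theta>_def B_def, unfolded x_eq]
    have x1: "1 \<le> ?x" by (rule near(1))
    show ?thesis using near(2) pos\<kappa>
    proof eventually_elim
      case (elim \<kappa>)
      have up: "finite (neg_symbols N d \<rho> \<kappa>) \<and> real (c_F N d \<rho> \<kappa>) \<le> C1 * ?x powr (-3/2) * growth powr ?x"
        unfolding c_F_def by (rule C1(2)[OF x1]) (use elim(1) in blast)
      have "C1 * ?x powr (-3/2) * growth powr ?x = C1 * k powr (-3/2) * f ?\<epsilon>"
        using x_f[OF eps] by (simp add: mult.assoc)
      also have "\<dots> \<le> Cp * f ?\<epsilon>" by (intro mult_right_mono f_nonneg) (simp add: Cp_def)
      finally have upper: "real (c_F N d \<rho> \<kappa>) \<le> Cp * f ?\<epsilon>" using up by linarith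
      \<comment> \<open>Regular trees with at most x non-leaf vertices are negative, and rounding
        down loses no more than a factor \<open>growth\<close>.\<close>
      define i where "i = nat \<lfloor>?x\<rfloor>"
      have i: "1 \<le> i" "real i \<le> ?x" "?x - 1 \<le> real i" using x1 unfolding i_def by linarith+
      have "tcount N i \<le> c_F N d \<rho> \<kappa>"
      proof (rule tcount_le_c_F[OF dN(3)])
        show "finite (neg_symbols N d \<rho> \<kappa>)" using up by blast
        have "real i * ((real N + 1) * ?\<epsilon> / 2) \<le> ?x * ((real N + 1) * ?\<epsilon> / 2)"
          using i eps dN by (intro mult_right_mono) auto
        also have "\<dots> = real d * real N / (real N + 1)"
        proof -
          have "2 * real d * real N / N1\<^sup>2 / e * (N1 * e / 2) = real d * real N / N1" if "0 < N1" "0 < e" for N1 e :: real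
            using that by (simp add: field_simps power2_eq_square)
          from this[of "real N + 1" ?\<epsilon>] show ?thesis using eps by (simp add: k_def)
        qed
        also have "\<dots> = (rho_c N d + real d) / 2" by (simp add: rho_c_def field_simps)
        finally have "real i * ((real N + 1) * ?\<epsilon> / 2) < (\<rho> + real d) / 2" using \<rho> by simp
        moreover have "0 \<le> real i * ((real N - 1) * \<kappa>)" using dN elim(2) by simp
        ultimately have "real i * ((real N + 1) * ?\<epsilon> / 2) - real i * ((real N - 1) * \<kappa>) - (\<rho> + real d) / 2 - \<kappa> < 0"
          using elim(2) by linarith
        then show "real i * (((real N + 1) * \<rho> - (real N - 1) * real d) / 2 - (real N - 1) * \<kappa>) - (\<rho> + real d) / 2 - \<kappa> < 0"
          unfolding alpha_eq by (simp only: right_diff_distrib)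
      qed
      then have "real (tcount N i) \<le> real (c_F N d \<rho> \<kappa>)" by simp
      moreover have "c3 / growth * (?x powr (-3/2) * growth powr ?x) \<le> real (tcount N i)"
      proof -
        have "growth powr ?x / growth = growth powr (?x - 1)" using growth_gt_1 by (simp add: powr_diff)
        also have "\<dots> \<le> growth powr real i" using i growth_gt_1 by (intro powr_mono) auto
        also have "\<dots> = growth ^ i" using growth_gt_1 by (simp add: powr_realpow)
        finally have g: "growth powr ?x / growth \<le> growth ^ i" .
        have "?x powr (-3/2) \<le> real i powr (-3/2)" using i by (intro powr_mono2') auto
        then have "?x powr (-3/2) * (growth powr ?x / growth) \<le> real i powr (-3/2) * growth ^ i"
          using g growth_gt_1 by (intro mult_mono) auto
        then have "c3 * (?x powr (-3/2) * (growth powr ?x / growth)) \<le> c3 * (real i powr (-3/2) * growth ^ i)"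
          using c3(1) by (intro mult_left_mono) auto
        then show ?thesis using c3(2)[OF i(1)] by (simp add: mult.assoc)
      qed
      moreover have "Cm * f ?\<epsilon> \<le> c3 / growth * (?x powr (-3/2) * growth powr ?x)"
      proof -
        have "Cm * f ?\<epsilon> \<le> (c3 / growth * k powr (-3/2)) * f ?\<epsilon>"
          by (intro mult_right_mono f_nonneg) (simp add: Cm_def)
        then show ?thesis unfolding x_f[OF eps] by (simp add: mult.assoc)
      qed
      ultimately show ?case using up upper by linarith
    qed
  next
    case False
    let ?\<epsilon> = "\<rho> - rho_c N d"
    have rc: "1 / 2 \<le> rho_c N d" by (rule rho_c_ge_half[OF assms(2,1)])
    have e: "\<epsilon>0 \<le> ?\<epsilon>" "?\<epsilon> \<le> 2" using False \<rho> rc by auto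
    have far: "\<forall>\<^sub>F \<kappa> in at_right 0. \<forall>\<tau>\<in>neg_symbols N d \<rho> \<kappa>.
        \<exists>t D K. shape d N \<tau> t D K \<and> D \<le> B' \<and> K \<le> B' \<and> inodes t < n"
      unfolding B'_def n_def
      by (rule neg_shape_away_from_critical[OF assms(2,1)]) (use False \<rho> in \<open>auto simp: \<epsilon>0_def\<close>)
    show ?thesis using far pos\<kappa>
    proof eventually_elim
      case (elim \<kappa>)
      have up: "finite (neg_symbols N d \<rho> \<kappa>) \<and> real (c_F N d \<rho> \<kappa>) \<le> C2"
        unfolding c_F_def by (rule C2(2)) (use elim(1) in blast)
      have "C2 = C2 / m0 * m0" using mM by simp
      also have "\<dots> \<le> Cp * f ?\<epsilon>"
        using f_bounds[OF e] mM C2 Cp by (intro mult_mono) (auto simp: Cp_def)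
      finally have upper: "real (c_F N d \<rho> \<kappa>) \<le> Cp * f ?\<epsilon>" using up by linarith
      \<comment> \<open>Away from criticality the noise alone provides the lower bound 1.\<close>
      have "tcount N 0 \<le> c_F N d \<rho> \<kappa>"
      proof (rule tcount_le_c_F[OF dN(3)])
        have "0 < (\<rho> + real d) / 2" using rc \<rho> dN by simp
        then show "real 0 * (((real N + 1) * \<rho> - (real N - 1) * real d) / 2 - (real N - 1) * \<kappa>) - (\<rho> + real d) / 2 - \<kappa> < 0"
          unfolding of_nat_0 mult_zero_left using elim(2) by linarith
      qed (use up in simp)
      then have "1 \<le> real (c_F N d \<rho> \<kappa>)" by simp
      moreover have "Cm * f ?\<epsilon> \<le> 1 / M0 * M0"
        using f_bounds[OF e] mM Cm f_nonneg by (intro mult_mono) (auto simp: Cm_def)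
      ultimately show ?case using up upper mM by simp
    qed
  qed
  show "\<exists>Cm Cp :: real. 0 < Cm \<and> 0 < Cp \<and>
           (\<forall>\<rho>::real. rho_c N d < \<rho> \<and> \<rho> \<le> 2 \<longrightarrow>
             (\<forall>\<^sub>F \<kappa> in at_right 0.
                finite (neg_symbols N d \<rho> \<kappa>) \<and>
                Cm * (\<rho> - rho_c N d) powr (3/2) * exp (betaR N * real d / (\<rho> - rho_c N d))
                  \<le> real (c_F N d \<rho> \<kappa>) \<and>
                real (c_F N d \<rho> \<kappa>)
                  \<le> Cp * (\<rho> - rho_c N d) powr (3/2) * exp (betaR N * real d / (\<rho> - rho_c N d))))"
    using main Cm Cp unfolding f_def mult.assoc by blast
qed (rule betaR_3 betaR_3_bounds)+

end
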